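(* Let $s>1$ and $t>0$, let $c_\alpha\in\mathbf C$ for $\alpha\in\mathbf N^d$, and suppose that $$\sum_{\alpha\in\mathbf N^d}|c_\alpha|\,r^{|\alpha|}\alpha!^s<\infty\quad\text{for all } r>0.$$ Define $u\in(\Sigma_t^s)'(\mathbf R^d)$ and $f\in(\Sigma_s^t)'(\mathbf R^d)$ by $$u=\sum_{\alpha\in\mathbf N^d}c_\alpha D^\alpha\delta_0,\qquad f(x)=\sum_{\alpha\in\mathbf N^d}c_\alpha x^\alpha.$$ Then $$\mathrm{WF}^{t,s}(u)=\{0\}\times V_s(u)\quad\text{and}\quad\mathrm{WF}^{s,t}(f)=V_s(u)\times\{0\}.$$
   Context: Notation: $\mathbf N=\{0,1,2,\dots\}$, $D^\beta=(-i)^{|\beta|}\partial^\beta$, $\delta_0$ is the Dirac distribution at $0$, $T^*\mathbf R^d\simeq\mathbf R^{2d}$. For $s,t>0$ with $s+t>1$, the (Beurling type) Gelfand--Shilov space $\Sigma_t^s(\mathbf R^d)$ consists of all $f\in C^\infty(\mathbf R^d)$ such that for every $h>0$ $$\|f\|_{\mathcal S_{t,h}^s}=\sup_{\alpha,\beta\in\mathbf N^d,\,x\in\mathbf R^d}\frac{|x^\alpha D^\beta f(x)|}{h^{|\alpha+\beta|}\alpha!^t\beta!^s}<\infty,$$ with the Fréchet topology given by these seminorms. $(\Sigma_t^s)'(\mathbf R^d)$ is its topological dual; the action $(u,\varphi)$ is conjugate linear in $\varphi$ and consistent with the $L^2$ inner product; in particular $(D^\alpha\delta_0,\varphi)=\overline{D^\alpha\varphi(0)}$.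 Under the summability condition the series for $u$ converges in $(\Sigma_t^s)'(\mathbf R^d)$, the series for $f$ converges in $(\Sigma_s^t)'(\mathbf R^d)$ (and absolutely pointwise), and $\widehat u=(2\pi)^{-d/2}f$, where $\widehat g(\xi)=(2\pi)^{-d/2}\int g(x)e^{-i\langle x,\xi\rangle}dx$ is extended to ultradistributions by duality. The set $V_s(u)\subseteq\mathbf R^d\setminus0$: a point $\eta\in\mathbf R^d\setminus0$ satisfies $\eta\notin V_s(u)$ if there is an open conic set $\Gamma_2\subseteq\mathbf R^d\setminus0$ with $\eta\in\Gamma_2$ and $\sup_{\xi\in\Gamma_2}e^{r|\xi|^{1/s}}|\widehat u(\xi)|<\infty$ for all $r>0$. (Equivalently, here, $\eta\notin V_s(u)$ iff there is an open $U\subseteq\mathbf R^d\setminus0$ containing $\eta$ with $\sup_{x\in U,\lambda>0}e^{r\lambda}|f(\lambda^sx)|<\infty$ for all $r>0$.) Short-time Fourier transform: with $T_xf(y)=f(y-x)$, $M_\xi f(y)=e^{i\langle y,\xi\rangle}f(y)$, set $V_\psi u(x,\xi)=(2\pi)^{-d/2}(u,M_\xi T_x\psi)$. Wave front set: for $u\in(\Sigma_t^s)'(\mathbf R^d)$ and a fixed $\psi\in\Sigma_t^s(\mathbf R^d)\setminus\{0\}$, $(x_0,\xi_0)\in T^*\mathbf R^d\setminus0$ satisfies $(x_0,\xi_0)\notin\mathrm{WF}^{t,s}(u)$ if there is an open set $U\subseteq T^*\mathbf R^d\setminus0$ containing $(x_0,\xi_0)$ such that $$\sup_{\lambda>0,\,(x,\xi)\in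 U}e^{r\lambda}|V_\psi u(\lambda^tx,\lambda^s\xi)|<\infty\quad\forall r>0.$$ The definition does not depend on the choice of $\psi$. $\mathrm{WF}^{s,t}$ (for elements of $(\Sigma_s^t)'(\mathbf R^d)$) is obtained by exchanging the roles of $s$ and $t$. *)

theory Defs
  imports "HOL-Analysis.Analysis"
begin

text \<open>
  \<open>\<real>\<^sup>d\<close> is \<open>real ^ 'd\<close> for an arbitrary finite index type \<open>'d\<close>; multi-indices in
  \<open>\<nat>\<^sup>d\<close> are functions \<open>'d \<Rightarrow> nat\<close>.
\<close>

definition mi_abs :: "('d::finite \<Rightarrow> nat) \<Rightarrow> nat" where
  "mi_abs \<alpha> = (\<Sum>i\<in>UNIV. \<alpha> i)"

definition mi_fact :: "('d::finite \<Rightarrow> nat) \<Rightarrow> real" where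
  "mi_fact \<alpha> = (\<Prod>i\<in>UNIV. fact (\<alpha> i))"

definition mi_pow :: "real ^ 'd \<Rightarrow> ('d::finite \<Rightarrow> nat) \<Rightarrow> real" where
  "mi_pow x \<alpha> = (\<Prod>i\<in>UNIV. (x $ i) ^ \<alpha> i)"

definition partial_deriv :: "'d::finite \<Rightarrow> (real ^ 'd \<Rightarrow> complex) \<Rightarrow> real ^ 'd \<Rightarrow> complex" where
  "partial_deriv i f x = frechet_derivative f (at x) (axis i 1)"

definition smooth_fun :: "(real ^ 'd::finite \<Rightarrow> complex) \<Rightarrow> bool" where
  "smooth_fun f \<longleftrightarrow> (\<forall>is x. foldr partial_deriv is f differentiable (at x))"

text \<open>
  The mixed partial derivative of multi-index \<open>\<beta>\<close> takes the single partial derivatives in some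
  order containing each index \<open>i\<close> exactly \<open>\<beta> i\<close> times; for smooth functions the order is
  irrelevant.
\<close>

definition mi_deriv :: "('d::finite \<Rightarrow> nat) \<Rightarrow> (real ^ 'd \<Rightarrow> complex) \<Rightarrow> real ^ 'd \<Rightarrow> complex" where
  "mi_deriv \<beta> f = foldr partial_deriv (SOME is. \<forall>i. count_list is i = \<beta> i) f"

definition mi_D :: "('d::finite \<Rightarrow> nat) \<Rightarrow> (real ^ 'd \<Rightarrow> complex) \<Rightarrow> real ^ 'd \<Rightarrow> complex" where
  "mi_D \<beta> f x = (- \<i>) ^ mi_abs \<beta> * mi_deriv \<beta> f x"


text \<open>
  Beurling type Gelfand--Shilov spaces. In \<open>gs_space t s\<close> (usually written \<open>\<Sigma>\<close> with lower index
  \<open>t\<close> and upper index \<open>s\<close>) the first parameter governs decay and the second one regularity.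
\<close>

definition gs_quotient ::
    "real \<Rightarrow> real \<Rightarrow> real \<Rightarrow> (real ^ 'd::finite \<Rightarrow> complex) \<Rightarrow>
      ('d \<Rightarrow> nat) \<times> ('d \<Rightarrow> nat) \<times> (real ^ 'd) \<Rightarrow> real" where
  "gs_quotient t s h f = (\<lambda>(\<alpha>, \<beta>, x).
     cmod (complex_of_real (mi_pow x \<alpha>) * mi_D \<beta> f x) /
       (h ^ (mi_abs \<alpha> + mi_abs \<beta>) * mi_fact \<alpha> powr t * mi_fact \<beta> powr s))"

definition gs_space :: "real \<Rightarrow> real \<Rightarrow> (real ^ 'd::finite \<Rightarrow> complex) set" where
  "gs_space t s = {f. smooth_fun f \<and> (\<forall>h>0. bdd_above (range (gs_quotient t s h f)))}"

definition gs_seminorm :: "real \<Rightarrow> real \<Rightarrow> real \<Rightarrow> (real ^ 'd::finite \<Rightarrow> complex) \<Rightarrow> real" where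
  "gs_seminorm t s h f = (SUP p. gs_quotient t s h f p)"

definition gs_topology :: "real \<Rightarrow> real \<Rightarrow> (real ^ 'd::finite \<Rightarrow> complex) topology" where
  "gs_topology t s = topology_generated_by
     {{\<phi> \<in> gs_space t s. gs_seminorm t s h (\<lambda>x. \<phi> x - \<phi>\<^sub>0 x) < \<epsilon>} | \<phi>\<^sub>0 h \<epsilon>.
        \<phi>\<^sub>0 \<in> gs_space t s \<and> h > 0 \<and> \<epsilon> > 0}"

text \<open>
  Ultradistributions are represented by total functions; only their values on the test function
  space matter. They act conjugate linearly, so that \<open>u \<phi>\<close> is the sesquilinear pairing
  \<open>(u, \<phi>)\<close> extending the \<open>L\<^sup>2\<close> inner product.
\<close>

type_synonym 'd distr = "(real ^ 'd \<Rightarrow> complex) \<Rightarrow> complex"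

definition gs_dual :: "real \<Rightarrow> real \<Rightarrow> 'd::finite distr set" where
  "gs_dual t s = {u.
     (\<forall>\<phi>\<in>gs_space t s. \<forall>\<theta>\<in>gs_space t s. \<forall>a b.
        u (\<lambda>x. a * \<phi> x + b * \<theta> x) = cnj a * u \<phi> + cnj b * u \<theta>) \<and>
     continuous_map (gs_topology t s) euclidean u}"

definition fun_distr :: "(real ^ 'd::finite \<Rightarrow> complex) \<Rightarrow> 'd distr" where
  "fun_distr g \<phi> = (LINT x|lborel. g x * cnj (\<phi> x))"

definition delta0 :: "'d::finite distr" where
  "delta0 \<phi> = cnj (\<phi> 0)"

text \<open>\<open>D\<^sup>\<alpha>\<close> is formally self-adjoint for the \<open>L\<^sup>2\<close> inner product, hence no sign below.\<close>

definition distr_D :: "('d::finite \<Rightarrow> nat) \<Rightarrow> 'd distr \<Rightarrow> 'd distr" where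
  "distr_D \<alpha> u \<phi> = u (mi_D \<alpha> \<phi>)"


text \<open>
  By unitarity of the Fourier transform, its extension by duality is
  \<open>(F u, \<phi>) = (u, F\<^sup>-\<^sup>1 \<phi>)\<close>; it maps the dual of \<open>gs_space t s\<close> to the dual of \<open>gs_space s t\<close>.
\<close>

definition inv_fourier :: "(real ^ 'd::finite \<Rightarrow> complex) \<Rightarrow> real ^ 'd \<Rightarrow> complex" where
  "inv_fourier \<phi> x = complex_of_real ((2 * pi) powr (- real CARD('d) / 2)) *
     (LINT \<xi>|lborel. \<phi> \<xi> * exp (\<i> * complex_of_real (x \<bullet> \<xi>)))"

definition distr_fourier :: "'d::finite distr \<Rightarrow> 'd distr" where
  "distr_fourier u \<phi> = u (inv_fourier \<phi>)"

text \<open>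
  The Fourier transform as a function: the continuous function that represents
  \<^term>\<open>distr_fourier u\<close> on \<^term>\<open>gs_space s t\<close>. It is meaningful only for those \<open>u\<close> whose Fourier
  transform is such a function.
\<close>

definition fourier_fun :: "real \<Rightarrow> real \<Rightarrow> 'd::finite distr \<Rightarrow> real ^ 'd \<Rightarrow> complex" where
  "fourier_fun t s u = (THE g. continuous_on UNIV g \<and>
     (\<forall>\<phi>\<in>gs_space s t. integrable lborel (\<lambda>\<xi>. g \<xi> * cnj (\<phi> \<xi>)) \<and>
        distr_fourier u \<phi> = fun_distr g \<phi>))"

text \<open>
  The set \<open>V\<^sub>s(u)\<close> for \<open>u\<close> in the dual of \<open>gs_space t s\<close>; the parameter \<open>t\<close> only records that
  space. Cones are invariant under positive dilations and need not contain \<open>0\<close>, in contrast to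
  the library's \<open>cone\<close> and \<open>conic\<close>.
\<close>

definition V_set :: "real \<Rightarrow> real \<Rightarrow> 'd::finite distr \<Rightarrow> (real ^ 'd) set" where
  "V_set t s u = {\<eta>. \<eta> \<noteq> 0 \<and>
     \<not> (\<exists>\<Gamma>. open \<Gamma> \<and> \<Gamma> \<subseteq> - {0} \<and> (\<forall>\<xi>\<in>\<Gamma>. \<forall>\<mu>>0. \<mu> *\<^sub>R \<xi> \<in> \<Gamma>) \<and> \<eta> \<in> \<Gamma> \<and>
        (\<forall>r>0. bdd_above
          ((\<lambda>\<xi>. exp (r * norm \<xi> powr (1 / s)) * cmod (fourier_fun t s u \<xi>)) ` \<Gamma>)))}"


definition translate :: "real ^ 'd \<Rightarrow> (real ^ 'd \<Rightarrow> complex) \<Rightarrow> real ^ 'd::finite \<Rightarrow> complex" where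
  "translate x f y = f (y - x)"

definition modulate :: "real ^ 'd \<Rightarrow> (real ^ 'd \<Rightarrow> complex) \<Rightarrow> real ^ 'd::finite \<Rightarrow> complex" where
  "modulate \<xi> f y = exp (\<i> * complex_of_real (y \<bullet> \<xi>)) * f y"

definition stft ::
    "(real ^ 'd \<Rightarrow> complex) \<Rightarrow> 'd distr \<Rightarrow> real ^ 'd \<Rightarrow> real ^ 'd::finite \<Rightarrow> complex" where
  "stft \<psi> u x \<xi> = complex_of_real ((2 * pi) powr (- real CARD('d) / 2)) *
     u (modulate \<xi> (translate x \<psi>))"

text \<open>
  The wave front set, for \<open>u\<close> in the dual of \<open>gs_space t s\<close>, computed with the window \<open>\<psi>\<close>, a
  nonzero element of \<open>gs_space t s\<close>.
\<close>

definition wave_front_set ::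
    "(real ^ 'd \<Rightarrow> complex) \<Rightarrow> real \<Rightarrow> real \<Rightarrow> 'd::finite distr \<Rightarrow> ((real ^ 'd) \<times> (real ^ 'd)) set" where
  "wave_front_set \<psi> t s u = {z. z \<noteq> 0 \<and>
     \<not> (\<exists>U. open U \<and> U \<subseteq> - {0} \<and> z \<in> U \<and>
        (\<forall>r>0. bdd_above {exp (r * \<mu>) * cmod (stft \<psi> u ((\<mu> powr t) *\<^sub>R x) ((\<mu> powr s) *\<^sub>R \<xi>)) |
           \<mu> x \<xi>. \<mu> > 0 \<and> (x, \<xi>) \<in> U}))}"

end

theory Submission
  imports Defs "HOL-Probability.Probability"
begin

text \<open>
  The Fourier transform of \<open>u\<close> is, up to a constant, the entire function \<open>F\<close> with coefficients
  \<open>c\<close>, which grows slower than \<open>exp (r \<bar>x\<bar>\<^bsup>1/s\<^esup>)\<close> for every \<open>r > 0\<close>. The short-time Fourier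
  transform \<open>V\<close> of \<open>F\<close> satisfies
  \<open>\<bar>V x \<xi>\<bar> \<le> C exp (a \<bar>x\<bar>\<^bsup>1/s\<^esup> - R \<bar>\<xi>\<bar>\<^bsup>1/t\<^esup>)\<close> for all \<open>R\<close>, so it is regular at all points with
  \<open>\<xi> \<noteq> 0\<close>. At \<open>(x, 0)\<close> regularity is equivalent to the decay of \<open>F\<close> in a cone around \<open>x\<close>: one
  direction estimates the integral directly, the other one uses Fourier inversion.

  Both parts of the theorem are instances of this. For the window \<open>\<theta>\<close> the bound on \<open>V\<close> follows by
  integration by parts. If \<open>\<psi>\<close> is the inverse transform of \<open>\<kappa>\<close>, then the transform of \<open>u\<close> with
  window \<open>\<psi>\<close> at \<open>(x, \<xi>)\<close> is, up to a unimodular factor and a constant, that of \<open>F\<close> with window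
  \<open>\<kappa>\<close> at \<open>(\<xi>, - x)\<close>; here the bound is read off from the series for \<open>u\<close>, so that only the decay
  of \<open>\<kappa>\<close>, not of its derivatives, is needed.
\<close>


section \<open>Elementary estimates\<close>

text \<open>The weights \<open>norm x powr (1 / s)\<close> and
  \<open>norm \<xi> powr (1 / t)\<close> are homogeneous of degree one under the dilations that
  define the wave front set, so every bound becomes linear in the dilation parameter and only rates
  have to be compared. As s > 1, the first weight is subadditive, and a window can be moved at the
  cost of a factor exponential in the weight of the shift. The second weight is not subadditive when
  t < 1, so no estimate splits it over a sum. Cones are therefore separated by the decay of the
  window, and the function behind \<open>fourier_fun\<close> is identified by translating and
  modulating one given window. The factorial bounds hold for every ratio h and therefore absorb
  geometric factors. Hence \<alpha>! and |\<alpha>|! are interchangeable, and derivatives can be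
  indexed by lists of directions.\<close>

lemma power_le_fact_exp:
  fixes z :: real
  assumes "z \<ge> 0"
  shows "z ^ m \<le> fact m * exp z"
proof -
  have "(\<Sum>n\<in>{m}. z ^ n /\<^sub>R fact n) \<le> (\<Sum>n. z ^ n /\<^sub>R fact n)"
    using assms by (intro sum_le_suminf summable_exp_generic) auto
  then have "z ^ m / fact m \<le> exp z"
    by (simp add: exp_def divide_inverse mult.commute)
  then show ?thesis by (simp add: field_simps)
qed

text \<open>The one-term bound of the exponential series at z = (y / h) powr (1 / s), raised to the
  power s. It trades a monomial for a Gevrey factor of any ratio h, the price being the rate of the
  exponential.\<close>

lemma power_le_fact_powr_exp:
  fixes y h s :: real
  assumes "y \<ge> 0" "h > 0" "s > 0"
  shows "y ^ m \<le> h ^ m * fact m powr s * exp (s * (y / h) powr (1 / s))"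
proof -
  define z where "z = (y / h) powr (1 / s)"
  have z: "z \<ge> 0" "z powr s = y / h"
    using assms by (auto simp: z_def powr_powr)
  have "(z ^ m) powr s \<le> (fact m * exp z) powr s"
    using z assms by (intro powr_mono2 power_le_fact_exp) auto
  also have "\<dots> = fact m powr s * exp (s * z)"
    by (simp add: powr_mult powr_def[of "exp z"])
  also have "(z ^ m) powr s = (y / h) ^ m"
  proof (cases "z = 0")
    case True
    then have "y / h = 0" using z(2) by simp
    then show ?thesis using True \<open>s > 0\<close> by (cases m) auto
  next
    case False
    then have "(z ^ m) powr s = (z powr s) ^ m"
      using z(1) by (simp add: powr_powr powr_realpow [symmetric] mult.commute)
    then show ?thesis using z by simp
  qed
  finally show ?thesis
    using assms by (simp add: power_divide z_def[symmetric] field_simps)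
qed

text \<open>Taking powers 1 / t turns the Gevrey factor into a plain factorial, so the moments can
  be summed against the exponential series; the result is then raised back to the power t. This
  reverses the preceding estimate.\<close>

lemma exp_decay_of_moments:
  fixes F y C H t :: real
  assumes "F \<ge> 0" "y \<ge> 0" "C \<ge> 0" "H > 0" "t > 0"
    and moments: "\<And>m. y ^ m * F \<le> C * H ^ m * fact m powr t"
  shows "F \<le> 2 powr t * C * exp (- (t / (2 * H powr (1 / t)) * y powr (1 / t)))"
proof -
  define z where "z = y powr (1 / t)"
  define G where "G = F powr (1 / t)"
  define D where "D = C powr (1 / t)"
  define K where "K = H powr (1 / t)"
  \<comment> \<open>Half of the radius of convergence: the summed series is geometric with ratio 1/2
    and sum 2, which is the source of \<open>2 powr t\<close> and of the 2 in the rate.\<close>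
  define \<rho> where "\<rho> = 1 / (2 * K)"
  have K: "K > 0" and \<rho>: "\<rho> > 0" and z: "z \<ge> 0" and G: "G \<ge> 0"
    using \<open>H > 0\<close> by (auto simp: K_def \<rho>_def z_def G_def)
  have pw: "(a ^ m) powr b = (a powr b) ^ m" if "a \<ge> 0" "b > 0" for a b :: real and m
    using that by (cases "a = 0"; cases m)
      (auto simp: powr_powr powr_realpow [symmetric] mult.commute powr_mult)
  have mom: "z ^ m * G \<le> D * K ^ m * fact m" for m
  proof -
    have "(y ^ m * F) powr (1 / t) \<le> (C * H ^ m * fact m powr t) powr (1 / t)"
      using assms by (intro powr_mono2 moments) auto
    then show ?thesis
      using assms by (simp add: powr_mult pw powr_powr z_def G_def D_def K_def)
  qed
  have trm: "(\<rho> * z) ^ m /\<^sub>R fact m * G \<le> D * (1 / 2) ^ m" for m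
  proof -
    have "(\<rho> * z) ^ m /\<^sub>R fact m * G = \<rho> ^ m * (z ^ m * G) / fact m"
      by (simp add: power_mult_distrib field_simps)
    also have "\<dots> \<le> \<rho> ^ m * (D * K ^ m * fact m) / fact m"
      using \<rho> by (intro divide_right_mono mult_left_mono mom) auto
    also have "\<dots> = D * (\<rho> * K) ^ m"
      by (simp add: power_mult_distrib)
    also have "\<rho> * K = 1 / 2" using K by (simp add: \<rho>_def)
    finally show ?thesis .
  qed
  have "exp (\<rho> * z) * G = (\<Sum>m. (\<rho> * z) ^ m /\<^sub>R fact m * G)"
    unfolding exp_def by (rule suminf_mult2, rule summable_exp_generic)
  also have "\<dots> \<le> (\<Sum>m. D * (1 / 2) ^ m)"
    by (intro suminf_le trm summable_mult2 summable_exp_generic summable_mult summable_geometric) auto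
  also have "\<dots> = 2 * D"
    using suminf_geometric[of "1 / 2 :: real"] by (subst suminf_mult) (auto simp: summable_geometric)
  finally have "exp (\<rho> * z) * G \<le> 2 * D" .
  then have "(exp (\<rho> * z) * G) powr t \<le> (2 * D) powr t"
    using G \<open>t > 0\<close> by (intro powr_mono2) auto
  then have "exp (t * (\<rho> * z)) * F \<le> 2 powr t * C"
    using assms by (simp add: powr_mult G_def D_def powr_powr powr_def[of "exp _"])
  then have "F \<le> 2 powr t * C * exp (- (t * (\<rho> * z)))"
    by (simp add: exp_minus field_simps)
  then show ?thesis by (simp add: \<rho>_def K_def z_def)
qed

lemma norm_le_CARD_component:
  fixes x :: "real ^ 'd::finite"
  shows "\<exists>k. norm x \<le> real CARD('d) * \<bar>x $ k\<bar>"
proof (rule ccontr)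
  assume "\<not> ?thesis"
  then have *: "\<bar>x $ k\<bar> < norm x / real CARD('d)" for k
    by (simp add: field_simps not_le)
  have "norm x \<le> (\<Sum>k\<in>UNIV. \<bar>x $ k\<bar>)" by (rule norm_le_l1_cart)
  also have "\<dots> < (\<Sum>k\<in>(UNIV::'d set). norm x / real CARD('d))"
    by (intro sum_strict_mono *) auto
  finally show False by simp
qed

text \<open>The dominating coordinate depends on \<open>x\<close>, hence moments are assumed for
  every \<open>k\<close>; comparing it with the norm costs the factor \<open>CARD('d)\<close> next
  to \<open>H\<close>.\<close>

lemma exp_decay_of_component_moments:
  fixes x :: "real ^ 'd::finite" and F C H t :: real
  assumes "F \<ge> 0" "C \<ge> 0" "H > 0" "t > 0"
    and moments: "\<And>k m. \<bar>x $ k\<bar> ^ m * F \<le> C * H ^ m * fact m powr t"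
  shows "F \<le> 2 powr t * C *
    exp (- (t / (2 * (CARD('d) * H) powr (1 / t)) * norm x powr (1 / t)))"
proof (rule exp_decay_of_moments)
  obtain k where k: "norm x \<le> real CARD('d) * \<bar>x $ k\<bar>"
    using norm_le_CARD_component by blast
  fix m
  have "norm x ^ m * F \<le> (real CARD('d) * \<bar>x $ k\<bar>) ^ m * F"
    using k assms by (intro mult_right_mono power_mono) auto
  also have "\<dots> = real CARD('d) ^ m * (\<bar>x $ k\<bar> ^ m * F)"
    by (simp add: power_mult_distrib)
  also have "\<dots> \<le> real CARD('d) ^ m * (C * H ^ m * fact m powr t)"
    by (intro mult_left_mono moments) auto
  finally show "norm x ^ m * F \<le> C * (CARD('d) * H) ^ m * fact m powr t"
    by (simp add: power_mult_distrib mult_ac)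
qed (use assms in auto)

section \<open>Multi-indices\<close>

lemma mi_abs_count_list: "mi_abs (count_list is) = length is" for "is" :: "'d::finite list"
  unfolding mi_abs_def by (rule sum_count_set) auto

lemma ex_count_list: "\<exists>is. \<forall>i. count_list is i = \<beta> i" for \<beta> :: "'d::finite \<Rightarrow> nat"
proof -
  obtain xs where "mset xs = Abs_multiset \<beta>" using ex_mset by blast
  then have "count (mset xs) i = \<beta> i" for i
    by (simp add: count_Abs_multiset)
  then show ?thesis by (auto simp: count_mset intro!: exI[of _ xs])
qed

text \<open>Adjoining an index multiplies the multinomial coefficient by a binomial one, which is at
  most a power of 2. A geometric factor is affordable because seminorms are finite for every h and
  the coefficients are summable for every r.\<close>

lemma fact_sum_le:
  assumes "finite S"
  shows "fact (\<Sum>i\<in>S. \<alpha> i) \<le> ((2::real) ^ card S) ^ (\<Sum>i\<in>S. \<alpha> i) * (\<Prod>i\<in>S. fact (\<alpha> i))"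
  using assms
proof (induction S)
  case (insert k S)
  let ?n = "\<Sum>i\<in>S. \<alpha> i"
  have "fact (\<alpha> k + ?n) = fact (\<alpha> k) * fact ?n * real ((\<alpha> k + ?n) choose \<alpha> k)"
    by (subst binomial_fact) auto
  also have "\<dots> \<le> fact (\<alpha> k) * fact ?n * 2 ^ (\<alpha> k + ?n)"
  proof (intro mult_left_mono)
    show "real ((\<alpha> k + ?n) choose \<alpha> k) \<le> 2 ^ (\<alpha> k + ?n)"
      using of_nat_mono[OF binomial_le_pow2[of "\<alpha> k + ?n" "\<alpha> k"], where 'a = real] by simp
  qed auto
  also have "\<dots> \<le> fact (\<alpha> k) * ((2 ^ card S) ^ ?n * (\<Prod>i\<in>S. fact (\<alpha> i))) * 2 ^ (\<alpha> k + ?n)"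
    using insert.IH by (intro mult_left_mono mult_right_mono) auto
  also have "\<dots> \<le> fact (\<alpha> k) * ((2 ^ card S) ^ (\<alpha> k + ?n) * (\<Prod>i\<in>S. fact (\<alpha> i))) * 2 ^ (\<alpha> k + ?n)"
    by (intro mult_left_mono mult_right_mono power_increasing) (auto intro!: prod_nonneg)
  also have "\<dots> = (2 ^ card (insert k S)) ^ (\<alpha> k + ?n) * (\<Prod>i\<in>insert k S. fact (\<alpha> i))"
    using insert by (simp add: power_mult_distrib)
  finally show ?case using insert by simp
qed auto

lemma fact_mi_abs_le:
  "fact (mi_abs \<alpha>) \<le> ((2::real) ^ CARD('d)) ^ mi_abs \<alpha> * mi_fact \<alpha>"
  for \<alpha> :: "'d::finite \<Rightarrow> nat"
  unfolding mi_abs_def mi_fact_def by (rule fact_sum_le) simp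

lemma mi_fact_pos: "mi_fact \<alpha> > 0"
  unfolding mi_fact_def by (intro prod_pos) auto

lemma mi_fact_le_fact: "mi_fact \<alpha> \<le> fact (mi_abs \<alpha>)" for \<alpha> :: "'d::finite \<Rightarrow> nat"
proof -
  have "(\<Prod>i\<in>S. fact (\<alpha> i)) \<le> (fact (\<Sum>i\<in>S. \<alpha> i) :: real)" if "finite S" for S :: "'d set"
    using that
  proof (induction S)
    case (insert k S)
    let ?n = "\<Sum>i\<in>S. \<alpha> i"
    have "fact (\<alpha> k) * (\<Prod>i\<in>S. fact (\<alpha> i)) \<le> fact (\<alpha> k) * (fact ?n :: real)"
      using insert.IH by (intro mult_left_mono) auto
    also have "\<dots> \<le> fact (\<alpha> k + ?n)"
    proof -
      have "fact (\<alpha> k) * fact ?n \<le> (fact (\<alpha> k + ?n) :: nat)"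
        by (rule dvd_imp_le[OF fact_fact_dvd_fact]) simp
      from of_nat_mono[OF this, where 'a = real] show ?thesis by simp
    qed
    finally show ?case using insert by simp
  qed auto
  from this[of UNIV] show ?thesis unfolding mi_abs_def mi_fact_def by simp
qed

lemma abs_mi_pow_le: "\<bar>mi_pow x \<alpha>\<bar> \<le> norm x ^ mi_abs \<alpha>" for x :: "real ^ 'd::finite"
proof -
  have "\<bar>mi_pow x \<alpha>\<bar> = (\<Prod>i\<in>UNIV. \<bar>x $ i\<bar> ^ \<alpha> i)"
    unfolding mi_pow_def by (simp add: abs_prod power_abs)
  also have "\<dots> \<le> (\<Prod>i\<in>UNIV. norm x ^ \<alpha> i)"
    by (intro prod_mono conjI power_mono) (auto simp: component_le_norm_cart)
  also have "\<dots> = norm x ^ mi_abs \<alpha>"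
    unfolding mi_abs_def by (rule power_sum[symmetric])
  finally show ?thesis .
qed

lemma mi_fact_powr_le: "s \<ge> 0 \<Longrightarrow> mi_fact \<alpha> powr s \<le> fact (mi_abs \<alpha>) powr s"
  using mi_fact_le_fact[of \<alpha>] mi_fact_pos[of \<alpha>] by (intro powr_mono2) auto

lemma fact_powr_le_mi_fact:
  fixes \<alpha> :: "'d::finite \<Rightarrow> nat"
  assumes "s \<ge> 0"
  shows "fact (mi_abs \<alpha>) powr s \<le> ((2 ^ CARD('d)) powr s) ^ mi_abs \<alpha> * mi_fact \<alpha> powr s"
proof -
  have "fact (mi_abs \<alpha>) powr s \<le> ((2 ^ CARD('d)) ^ mi_abs \<alpha> * mi_fact \<alpha>) powr s"
    using assms by (intro powr_mono2 fact_mi_abs_le) auto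
  also have "\<dots> = (((2::real) ^ CARD('d)) ^ mi_abs \<alpha>) powr s * mi_fact \<alpha> powr s"
    using mi_fact_pos[of \<alpha>] by (subst powr_mult) auto
  also have "(((2::real) ^ CARD('d)) ^ mi_abs \<alpha>) powr s = ((2 ^ CARD('d)) powr s) ^ mi_abs \<alpha>"
    by (simp add: powr_realpow[symmetric] powr_powr mult_ac)
  finally show ?thesis .
qed

section \<open>Smooth functions and their partial derivatives\<close>

text \<open>Lists of directions replace multi-indices so that Leibniz' rule and integration by parts
  become inductions. Since \<open>foldr\<close> applies the last entry first,
  \<open>is @ [i]\<close> differentiates in direction \<open>i\<close> before anything else.\<close>

abbreviation partials :: "'d::finite list \<Rightarrow> (real ^ 'd \<Rightarrow> complex) \<Rightarrow> real ^ 'd \<Rightarrow> complex" where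
  "partials is f \<equiv> foldr partial_deriv is f"

lemma partial_deriv_eqI:
  "(f has_derivative f') (at x) \<Longrightarrow> partial_deriv i f x = f' (axis i 1)"
  unfolding partial_deriv_def using frechet_derivative_at by metis

lemma partial_deriv_works:
  assumes "f differentiable (at x)"
  obtains f' where "(f has_derivative f') (at x)" "\<And>i. partial_deriv i f x = f' (axis i 1)"
  using assms partial_deriv_eqI unfolding differentiable_def by blast

lemma smooth_fun_differentiable: "smooth_fun f \<Longrightarrow> f differentiable (at x)"
  unfolding smooth_fun_def by (metis foldr.simps(1) id_apply)

lemma smooth_fun_partial_deriv: "smooth_fun f \<Longrightarrow> smooth_fun (partial_deriv i f)"
  unfolding smooth_fun_def
proof safe
  fix "is" x
  assume "\<forall>is x. partials is f differentiable at x"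
  then have "partials (is @ [i]) f differentiable at x" by blast
  then show "partials is (partial_deriv i f) differentiable at x" by simp
qed

lemma smooth_fun_partials: "smooth_fun f \<Longrightarrow> smooth_fun (partials is f)"
  by (induction "is") (auto intro: smooth_fun_partial_deriv)

lemma smooth_fun_continuous: "smooth_fun f \<Longrightarrow> continuous_on A f"
  by (simp add: continuous_at_imp_continuous_on differentiable_imp_continuous_within
      smooth_fun_differentiable)

text \<open>Smoothness is the largest property that implies differentiability and is inherited by
  partial derivatives; closure properties follow by exhibiting a suitable \<open>P\<close>.\<close>

lemma smooth_fun_coinduct:
  assumes "P f"
    and "\<And>g x. P g \<Longrightarrow> g differentiable (at x)"
    and "\<And>g i. P g \<Longrightarrow> P (partial_deriv i g)"
  shows "smooth_fun f"
proof -
  have "P (partials is f)" for "is" by (induction "is") (auto intro: assms)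
  then show ?thesis unfolding smooth_fun_def using assms(2) by blast
qed

lemma partial_deriv_add:
  assumes "f differentiable (at x)" "g differentiable (at x)"
  shows "partial_deriv i (\<lambda>x. f x + g x) x = partial_deriv i f x + partial_deriv i g x"
proof -
  obtain f' g' where *: "(f has_derivative f') (at x)" "(g has_derivative g') (at x)"
    and **: "partial_deriv i f x = f' (axis i 1)" "partial_deriv i g x = g' (axis i 1)"
    using assms by (meson partial_deriv_works)
  show ?thesis using partial_deriv_eqI[OF has_derivative_add[OF *]] ** by simp
qed

lemma partial_deriv_mult:
  assumes "f differentiable (at x)" "g differentiable (at x)"
  shows "partial_deriv i (\<lambda>x. f x * g x) x = partial_deriv i f x * g x + f x * partial_deriv i g x"
proof -
  obtain f' g' where *: "(f has_derivative f') (at x)" "(g has_derivative g') (at x)"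
    and **: "partial_deriv i f x = f' (axis i 1)" "partial_deriv i g x = g' (axis i 1)"
    using assms by (meson partial_deriv_works)
  show ?thesis using partial_deriv_eqI[OF has_derivative_mult[OF *]] ** by simp
qed

lemma partial_deriv_const: "partial_deriv i (\<lambda>x. c) = (\<lambda>x. 0)"
  by (rule ext, subst partial_deriv_eqI[where f' = "\<lambda>_. 0"]) auto

lemma partial_deriv_cmult:
  assumes "f differentiable (at x)"
  shows "partial_deriv i (\<lambda>x. c * f x) x = c * partial_deriv i f x"
proof -
  obtain f' where *: "(f has_derivative f') (at x)" and **: "partial_deriv i f x = f' (axis i 1)"
    using assms by (meson partial_deriv_works)
  show ?thesis using partial_deriv_eqI[OF has_derivative_mult_right[OF *, of c]] ** by simp
qed

lemma partial_deriv_cnj: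
  assumes "f differentiable (at x)"
  shows "partial_deriv i (\<lambda>x. cnj (f x)) x = cnj (partial_deriv i f x)"
proof -
  obtain f' where *: "(f has_derivative f') (at x)" and **: "partial_deriv i f x = f' (axis i 1)"
    using assms by (meson partial_deriv_works)
  show ?thesis
    using partial_deriv_eqI[OF bounded_linear.has_derivative[OF bounded_linear_cnj *]] ** by simp
qed

lemma partial_deriv_translate:
  assumes "\<And>x. f differentiable (at x)"
  shows "partial_deriv i (translate a f) = translate a (partial_deriv i f)"
proof
  fix x
  obtain f' where *: "(f has_derivative f') (at (x - a))"
    and **: "partial_deriv i f (x - a) = f' (axis i 1)"
    using assms by (meson partial_deriv_works)
  have "((\<lambda>x. f (x - a)) has_derivative f') (at x)"
    by (rule has_derivative_compose[of "\<lambda>x. x - a" "\<lambda>h. h" x UNIV f f', OF _ *])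
      (auto intro!: derivative_eq_intros)
  then show "partial_deriv i (translate a f) x = translate a (partial_deriv i f) x"
    using partial_deriv_eqI ** by (fastforce simp: translate_def[abs_def])
qed

lemma smooth_fun_add:
  assumes "smooth_fun f" "smooth_fun g"
  shows "smooth_fun (\<lambda>x. f x + g x)"
proof (rule smooth_fun_coinduct[where P = "\<lambda>h. \<exists>f g. smooth_fun f \<and> smooth_fun g \<and> h = (\<lambda>x. f x + g x)"])
  fix h :: "real ^ 'a \<Rightarrow> complex" and i
  assume "\<exists>f g. smooth_fun f \<and> smooth_fun g \<and> h = (\<lambda>x. f x + g x)"
  then obtain f g where *: "smooth_fun f" "smooth_fun g" "h = (\<lambda>x. f x + g x)" by blast
  have "partial_deriv i h = (\<lambda>x. partial_deriv i f x + partial_deriv i g x)"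
    unfolding * by (intro ext partial_deriv_add smooth_fun_differentiable *)
  then show "\<exists>f g. smooth_fun f \<and> smooth_fun g \<and> partial_deriv i h = (\<lambda>x. f x + g x)"
    using * smooth_fun_partial_deriv by blast
next
  show "\<exists>f' g'. smooth_fun f' \<and> smooth_fun g' \<and> (\<lambda>x. f x + g x) = (\<lambda>x. f' x + g' x)"
    using assms by blast
qed (auto intro!: differentiable_add intro: smooth_fun_differentiable)

lemma smooth_fun_cmult:
  assumes "smooth_fun f"
  shows "smooth_fun (\<lambda>x. c * f x)"
proof (rule smooth_fun_coinduct[where P = "\<lambda>h. \<exists>f. smooth_fun f \<and> h = (\<lambda>x. c * f x)"])
  fix h :: "real ^ 'a \<Rightarrow> complex" and i
  assume "\<exists>f. smooth_fun f \<and> h = (\<lambda>x. c * f x)"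
  then obtain f where *: "smooth_fun f" "h = (\<lambda>x. c * f x)" by blast
  have "partial_deriv i h = (\<lambda>x. c * partial_deriv i f x)"
    unfolding * by (intro ext partial_deriv_cmult smooth_fun_differentiable *)
  then show "\<exists>f. smooth_fun f \<and> partial_deriv i h = (\<lambda>x. c * f x)"
    using * smooth_fun_partial_deriv by blast
next
  show "\<exists>f'. smooth_fun f' \<and> (\<lambda>x. c * f x) = (\<lambda>x. c * f' x)"
    using assms by blast
qed (auto intro!: differentiable_mult intro: smooth_fun_differentiable)

lemma smooth_fun_cnj:
  assumes "smooth_fun f"
  shows "smooth_fun (\<lambda>x. cnj (f x))"
proof (rule smooth_fun_coinduct[where P = "\<lambda>h. \<exists>f. smooth_fun f \<and> h = (\<lambda>x. cnj (f x))"])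
  fix h :: "real ^ 'a \<Rightarrow> complex" and i
  assume "\<exists>f. smooth_fun f \<and> h = (\<lambda>x. cnj (f x))"
  then obtain f where *: "smooth_fun f" "h = (\<lambda>x. cnj (f x))" by blast
  have "partial_deriv i h = (\<lambda>x. cnj (partial_deriv i f x))"
    unfolding * by (intro ext partial_deriv_cnj smooth_fun_differentiable *)
  then show "\<exists>f. smooth_fun f \<and> partial_deriv i h = (\<lambda>x. cnj (f x))"
    using * smooth_fun_partial_deriv by blast
next
  fix h :: "real ^ 'a \<Rightarrow> complex" and x
  assume "\<exists>f. smooth_fun f \<and> h = (\<lambda>x. cnj (f x))"
  then obtain f where *: "smooth_fun f" "h = (\<lambda>x. cnj (f x))" by blast
  then show "h differentiable (at x)"
    using smooth_fun_differentiable[of f x] has_derivative_cnj unfolding differentiable_def by blast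
qed (use assms in auto)

lemma smooth_fun_translate:
  assumes "smooth_fun f"
  shows "smooth_fun (translate a f)"
proof (rule smooth_fun_coinduct[where P = "\<lambda>h. \<exists>f. smooth_fun f \<and> h = translate a f"])
  fix h :: "real ^ 'a \<Rightarrow> complex" and i
  assume "\<exists>f. smooth_fun f \<and> h = translate a f"
  then show "\<exists>f. smooth_fun f \<and> partial_deriv i h = translate a f"
    using partial_deriv_translate smooth_fun_differentiable smooth_fun_partial_deriv by metis
next
  fix h :: "real ^ 'a \<Rightarrow> complex" and x
  assume "\<exists>f. smooth_fun f \<and> h = translate a f"
  then obtain f where *: "smooth_fun f" "h = translate a f" by blast
  have "(\<lambda>x. f (x - a)) differentiable at x"
    by (rule differentiable_compose[where f = f]) (use smooth_fun_differentiable[OF *(1)] in auto)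
  then show "h differentiable (at x)" by (simp add: * translate_def[abs_def])
qed (use assms in auto)

text \<open>Closed under partial derivatives, hence a coinduction invariant for products.\<close>

inductive sum_of_products :: "(real ^ 'd::finite \<Rightarrow> complex) \<Rightarrow> bool" where
  prod: "smooth_fun f \<Longrightarrow> smooth_fun g \<Longrightarrow> sum_of_products (\<lambda>x. f x * g x)"
| add: "sum_of_products f \<Longrightarrow> sum_of_products g \<Longrightarrow> sum_of_products (\<lambda>x. f x + g x)"

lemma sum_of_products_partial:
  "sum_of_products h \<Longrightarrow> (\<forall>x. h differentiable (at x)) \<and> sum_of_products (partial_deriv i h)"
proof (induction rule: sum_of_products.induct)
  case (prod f g)
  have eq: "partial_deriv i (\<lambda>x. f x * g x) = (\<lambda>x. partial_deriv i f x * g x + f x * partial_deriv i g x)"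
    by (intro ext partial_deriv_mult smooth_fun_differentiable prod)
  have "sum_of_products (\<lambda>x. partial_deriv i f x * g x + f x * partial_deriv i g x)"
    by (rule sum_of_products.add[of "\<lambda>x. partial_deriv i f x * g x" "\<lambda>x. f x * partial_deriv i g x"])
      (auto intro!: sum_of_products.prod prod smooth_fun_partial_deriv)
  then show ?case
    unfolding eq using prod by (auto intro!: differentiable_mult intro: smooth_fun_differentiable)
next
  case (add f g)
  have eq: "partial_deriv i (\<lambda>x. f x + g x) = (\<lambda>x. partial_deriv i f x + partial_deriv i g x)"
    by (intro ext partial_deriv_add) (use add in auto)
  show ?case unfolding eq using add by (auto intro!: sum_of_products.add)
qed

lemma smooth_fun_mult:
  assumes "smooth_fun f" "smooth_fun g"
  shows "smooth_fun (\<lambda>x. f x * g x)"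
  by (rule smooth_fun_coinduct[where P = sum_of_products])
    (use assms sum_of_products_partial in \<open>auto intro: sum_of_products.prod\<close>)

lemma partials_add:
  assumes "smooth_fun f" "smooth_fun g"
  shows "partials is (\<lambda>x. f x + g x) = (\<lambda>x. partials is f x + partials is g x)"
proof (induction "is")
  case (Cons i "is")
  then show ?case
    by (auto intro!: ext partial_deriv_add smooth_fun_differentiable smooth_fun_partials assms)
qed auto

lemma partials_cmult:
  assumes "smooth_fun f"
  shows "partials is (\<lambda>x. c * f x) = (\<lambda>x. c * partials is f x)"
proof (induction "is")
  case (Cons i "is")
  then show ?case
    by (auto intro!: ext partial_deriv_cmult smooth_fun_differentiable smooth_fun_partials assms)
qed auto

lemma partials_cnj:
  assumes "smooth_fun f"
  shows "partials is (\<lambda>x. cnj (f x)) = (\<lambda>x. cnj (partials is f x))"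
proof (induction "is")
  case (Cons i "is")
  then show ?case
    by (auto intro!: ext partial_deriv_cnj smooth_fun_differentiable smooth_fun_partials assms)
qed auto

lemma partials_translate:
  assumes "smooth_fun f"
  shows "partials is (translate a f) = translate a (partials is f)"
  by (induction "is") (auto intro!: partial_deriv_translate smooth_fun_differentiable
      smooth_fun_partials assms)

text \<open>Leibniz' rule in the form of a binomial bound, which hides the combinatorics of sublists.\<close>

lemma partials_mult_bound:
  assumes "smooth_fun f" "smooth_fun g"
    and "\<And>js. cmod (partials js f y) \<le> A (length js)"
    and "\<And>js. cmod (partials js g y) \<le> B (length js)"
  shows "cmod (partials is (\<lambda>x. f x * g x) y) \<le>
    (\<Sum>k\<le>length is. real (length is choose k) * A k * B (length is - k))"
  using assms
proof (induction "is" arbitrary: f g A B rule: rev_induct)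
  case Nil
  have "cmod (f y) \<le> A 0" "cmod (g y) \<le> B 0" using Nil(3)[of "[]"] Nil(4)[of "[]"] by auto
  moreover have "0 \<le> A 0" using calculation norm_ge_zero order_trans by blast
  ultimately show ?case by (auto simp: norm_mult intro!: mult_mono)
next
  case (snoc i "is")
  let ?n = "length is"
  have eq: "partial_deriv i (\<lambda>x. f x * g x) = (\<lambda>x. partial_deriv i f x * g x + f x * partial_deriv i g x)"
    by (intro ext partial_deriv_mult smooth_fun_differentiable snoc)
  have sm: "smooth_fun (\<lambda>x. partial_deriv i f x * g x)" "smooth_fun (\<lambda>x. f x * partial_deriv i g x)"
    by (intro smooth_fun_mult smooth_fun_partial_deriv snoc)+
  \<comment> \<open>The hypotheses range over all lists, so a derivative of \<open>f\<close> or
    \<open>g\<close> satisfies the same bounds with the index shifted by one.\<close>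
  have A: "cmod (partials js (partial_deriv i f) y) \<le> A (Suc (length js))" for js
    using snoc.prems(3)[of "js @ [i]"] by simp
  have B: "cmod (partials js (partial_deriv i g) y) \<le> B (Suc (length js))" for js
    using snoc.prems(4)[of "js @ [i]"] by simp
  have "cmod (partials (is @ [i]) (\<lambda>x. f x * g x) y) \<le>
    cmod (partials is (\<lambda>x. partial_deriv i f x * g x) y) + cmod (partials is (\<lambda>x. f x * partial_deriv i g x) y)"
    by (simp add: eq partials_add[OF sm] norm_triangle_ineq)
  also have "\<dots> \<le> (\<Sum>k\<le>?n. real (?n choose k) * A (Suc k) * B (?n - k)) +
      (\<Sum>k\<le>?n. real (?n choose k) * A k * B (Suc (?n - k)))"
    by (intro add_mono snoc.IH[of _ _ "\<lambda>n. A (Suc n)" B] snoc.IH[of _ _ A "\<lambda>n. B (Suc n)"]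
        A B snoc.prems smooth_fun_partial_deriv)
  also have "(\<Sum>k\<le>?n. real (?n choose k) * A k * B (Suc (?n - k))) =
      (\<Sum>k\<le>?n. real (?n choose k) * A k * B (Suc ?n - k))"
    by (intro sum.cong) (auto simp: Suc_diff_le)
  also have "(\<Sum>k\<le>?n. real (?n choose k) * A (Suc k) * B (?n - k)) +
      (\<Sum>k\<le>?n. real (?n choose k) * A k * B (Suc ?n - k)) =
      (\<Sum>k\<le>Suc ?n. real (Suc ?n choose k) * A k * B (Suc ?n - k))"
  proof -
    \<comment> \<open>Pascal's rule; the top term gained by reindexing has the coefficient
      \<open>?n choose Suc ?n\<close>, which is zero.\<close>
    have "(\<Sum>k\<le>Suc ?n. real (Suc ?n choose k) * A k * B (Suc ?n - k)) =
      A 0 * B (Suc ?n) + (\<Sum>k\<le>?n. real (Suc ?n choose Suc k) * A (Suc k) * B (?n - k))"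
      by (subst sum.atMost_Suc_shift) simp
    also have "(\<Sum>k\<le>?n. real (Suc ?n choose Suc k) * A (Suc k) * B (?n - k)) =
      (\<Sum>k\<le>?n. real (?n choose k) * A (Suc k) * B (?n - k)) +
      (\<Sum>k\<le>?n. real (?n choose Suc k) * A (Suc k) * B (?n - k))"
      by (simp add: algebra_simps sum.distrib)
    also have "A 0 * B (Suc ?n) + (\<dots>) = (\<Sum>k\<le>?n. real (?n choose k) * A (Suc k) * B (?n - k)) +
      (A 0 * B (Suc ?n) + (\<Sum>k\<le>?n. real (?n choose Suc k) * A (Suc k) * B (Suc ?n - Suc k)))"
      by simp
    also have "A 0 * B (Suc ?n) + (\<Sum>k\<le>?n. real (?n choose Suc k) * A (Suc k) * B (Suc ?n - Suc k)) =
      (\<Sum>k\<le>Suc ?n. real (?n choose k) * A k * B (Suc ?n - k))"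
      by (subst sum.atMost_Suc_shift) simp
    finally show ?thesis by simp
  qed
  finally show ?case by simp
qed


section \<open>Symmetry of mixed partial derivatives\<close>

lemma has_vector_derivative_along_axis:
  assumes "\<And>y. f differentiable (at y)"
  shows "((\<lambda>s. f (a + s *\<^sub>R axis i 1)) has_vector_derivative
    partial_deriv i f (a + s *\<^sub>R axis i 1)) (at s within S)"
proof -
  obtain f' where f': "(f has_derivative f') (at (a + s *\<^sub>R axis i 1))"
    and eq: "partial_deriv i f (a + s *\<^sub>R axis i 1) = f' (axis i 1)"
    using assms by (meson partial_deriv_works)
  interpret f': bounded_linear f' using f' by (rule has_derivative_bounded_linear)
  have "((\<lambda>s. a + s *\<^sub>R axis i 1) has_derivative (\<lambda>t. t *\<^sub>R axis i 1)) (at s within S)"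
    by (auto intro!: derivative_eq_intros)
  from has_derivative_compose[OF this f'] show ?thesis
    by (simp add: has_vector_derivative_def eq f'.scaleR)
qed

text \<open>The mean value inequality is applied in direction \<open>i\<close> to the increment of
  \<open>f\<close> in direction \<open>j\<close>, less its expected value. The derivative of this
  expression is an increment of \<open>partial_deriv i f\<close>, which differentiability at
  \<open>x\<close> linearises.\<close>

lemma second_difference_approx:
  fixes f :: "real ^ 'd::finite \<Rightarrow> complex"
  assumes f: "\<And>y. f differentiable (at y)" and g: "partial_deriv i f differentiable (at x)"
    and "e > 0"
  shows "\<exists>\<delta>>0. \<forall>h. 0 < h \<and> h < \<delta> \<longrightarrow>
    cmod (f (x + h *\<^sub>R axis i 1 + h *\<^sub>R axis j 1) - f (x + h *\<^sub>R axis i 1) - f (x + h *\<^sub>R axis j 1) + f x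
      - h\<^sup>2 *\<^sub>R partial_deriv j (partial_deriv i f) x) \<le> e * h\<^sup>2"
proof -
  let ?g = "partial_deriv i f"
  obtain A where A: "(?g has_derivative A) (at x)" and Aj: "partial_deriv j ?g x = A (axis j 1)"
    using g by (meson partial_deriv_works)
  interpret A: bounded_linear A using A by (rule has_derivative_bounded_linear)
  \<comment> \<open>The two points compared below lie at distance at most 2 h and h from
    \<open>x\<close>, so their errors add up to three times \<open>e / 3\<close>; h < d / 2 keeps
    both in range.\<close>
  obtain d where "d > 0" and d: "\<And>y. norm (y - x) < d \<Longrightarrow> norm (?g y - ?g x - A (y - x)) \<le> e / 3 * norm (y - x)"
    using A \<open>e > 0\<close> unfolding has_derivative_at_alt by (meson divide_pos_pos zero_less_numeral)
  show ?thesis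
  proof (intro exI[of _ "d / 2"] conjI allI impI)
    fix h assume h: "0 < h \<and> h < d / 2"
    define \<phi> where "\<phi> s = f (x + h *\<^sub>R axis j 1 + s *\<^sub>R axis i 1) - f (x + s *\<^sub>R axis i 1) - s *\<^sub>R (h *\<^sub>R A (axis j 1))" for s
    define \<phi>' where "\<phi>' s = ?g (x + h *\<^sub>R axis j 1 + s *\<^sub>R axis i 1) - ?g (x + s *\<^sub>R axis i 1) - h *\<^sub>R A (axis j 1)" for s
    have deriv: "(\<phi> has_derivative (\<lambda>t. t *\<^sub>R \<phi>' s)) (at s within {0..h})" for s
      unfolding has_vector_derivative_def[symmetric] \<phi>_def[abs_def] \<phi>'_def
      by (intro has_vector_derivative_diff has_vector_derivative_along_axis f)
        (auto intro!: derivative_eq_intros)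
    have bound: "norm (\<phi>' s) \<le> e * h" if s: "s \<in> {0..h}" for s
    proof -
      let ?y = "x + h *\<^sub>R axis j 1 + s *\<^sub>R axis i 1" and ?z = "x + s *\<^sub>R axis i 1"
      have ax: "norm (axis k 1 :: real ^ 'd) = 1" for k by (simp add: norm_axis_1)
      have "norm (h *\<^sub>R axis j 1 + s *\<^sub>R axis i 1 :: real ^ 'd) \<le> norm (h *\<^sub>R axis j 1 :: real ^ 'd) + norm (s *\<^sub>R axis i 1 :: real ^ 'd)"
        by (rule norm_triangle_ineq)
      then have ny: "norm (?y - x) \<le> 2 * h" using s h ax by (simp add: algebra_simps)
      have nz: "norm (?z - x) \<le> h" using s h ax by simp
      have "norm (?g ?y - ?g x - A (?y - x)) \<le> e / 3 * norm (?y - x)"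
        using ny h by (intro d) auto
      then have 1: "norm (?g ?y - ?g x - A (?y - x)) \<le> e / 3 * (2 * h)"
        using ny \<open>e > 0\<close> by (meson divide_pos_pos less_imp_le mult_left_mono order_trans zero_less_numeral)
      have "norm (?g ?z - ?g x - A (?z - x)) \<le> e / 3 * norm (?z - x)"
        using nz h by (intro d) auto
      then have 2: "norm (?g ?z - ?g x - A (?z - x)) \<le> e / 3 * h"
        using nz \<open>e > 0\<close> by (meson divide_pos_pos less_imp_le mult_left_mono order_trans zero_less_numeral)
      have "\<phi>' s = (?g ?y - ?g x - A (?y - x)) - (?g ?z - ?g x - A (?z - x))"
      proof -
        have "A (?y - x) = h *\<^sub>R A (axis j 1) + s *\<^sub>R A (axis i 1)" "A (?z - x) = s *\<^sub>R A (axis i 1)"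
          by (simp_all add: add.assoc A.add A.scaleR)
        then show ?thesis by (simp add: \<phi>'_def)
      qed
      then have "norm (\<phi>' s) \<le> norm (?g ?y - ?g x - A (?y - x)) + norm (?g ?z - ?g x - A (?z - x))"
        by (simp only: norm_triangle_ineq4)
      also have "\<dots> \<le> e / 3 * (2 * h) + e / 3 * h" by (rule add_mono[OF 1 2])
      finally show ?thesis by (simp add: field_simps)
    qed
    have "norm (\<phi> h - \<phi> 0) \<le> (e * h) * norm (h - 0)"
    proof (rule differentiable_bound[where S = "{0..h}" and f' = "\<lambda>s t. t *\<^sub>R \<phi>' s"])
      show "onorm (\<lambda>t. t *\<^sub>R \<phi>' s) \<le> e * h" if "s \<in> {0..h}" for s
        using h \<open>e > 0\<close> bound[OF that] by (intro onorm_bound) (auto simp: mult.commute intro!: mult_left_mono)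
    qed (use h deriv in auto)
    also have "\<phi> h - \<phi> 0 = f (x + h *\<^sub>R axis i 1 + h *\<^sub>R axis j 1) - f (x + h *\<^sub>R axis i 1) - f (x + h *\<^sub>R axis j 1) + f x
      - h\<^sup>2 *\<^sub>R partial_deriv j ?g x"
      by (simp add: \<phi>_def Aj power2_eq_square algebra_simps)
    finally show "cmod (f (x + h *\<^sub>R axis i 1 + h *\<^sub>R axis j 1) - f (x + h *\<^sub>R axis i 1) - f (x + h *\<^sub>R axis j 1) + f x
      - h\<^sup>2 *\<^sub>R partial_deriv j ?g x) \<le> e * h\<^sup>2"
      using h by (simp add: power2_eq_square mult.assoc)
  qed (use \<open>d > 0\<close> in auto)
qed

text \<open>The second difference is symmetric in the two directions, and after division by h^2 it
  approximates either mixed derivative.\<close>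

theorem partial_deriv_commute:
  fixes f :: "real ^ 'd::finite \<Rightarrow> complex"
  assumes "smooth_fun f"
  shows "partial_deriv i (partial_deriv j f) = partial_deriv j (partial_deriv i f)"
proof
  fix x
  let ?a = "partial_deriv i (partial_deriv j f) x" and ?b = "partial_deriv j (partial_deriv i f) x"
  have *: "cmod (?a - ?b) \<le> 2 * e" if pos: "e > 0" for e
  proof -
    have d: "\<And>y. f differentiable (at y)" "\<And>k. partial_deriv k f differentiable (at x)"
      using assms by (auto intro!: smooth_fun_differentiable smooth_fun_partial_deriv)
    let ?D = "\<lambda>h i j. f (x + h *\<^sub>R axis i 1 + h *\<^sub>R axis j 1) - f (x + h *\<^sub>R axis i 1) - f (x + h *\<^sub>R axis j 1) + f x"
    obtain d1 where d1: "d1 > 0" "\<And>h. 0 < h \<and> h < d1 \<Longrightarrow> cmod (?D h i j - h\<^sup>2 *\<^sub>R ?b) \<le> e * h\<^sup>2"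
      using second_difference_approx[of f i x e j] d pos by auto
    obtain d2 where d2: "d2 > 0" "\<And>h. 0 < h \<and> h < d2 \<Longrightarrow> cmod (?D h j i - h\<^sup>2 *\<^sub>R ?a) \<le> e * h\<^sup>2"
      using second_difference_approx[of f j x e i] d pos by auto
    define h where "h = min d1 d2 / 2"
    have h: "0 < h" "h < d1" "h < d2" using d1 d2 by (auto simp: h_def)
    have D: "?D h j i = ?D h i j" by (simp add: algebra_simps)
    have "h\<^sup>2 *\<^sub>R (?a - ?b) = (?D h i j - h\<^sup>2 *\<^sub>R ?b) - (?D h j i - h\<^sup>2 *\<^sub>R ?a)"
      unfolding D by (simp add: algebra_simps)
    then have "cmod (h\<^sup>2 *\<^sub>R (?a - ?b)) \<le> cmod (?D h i j - h\<^sup>2 *\<^sub>R ?b) + cmod (?D h j i - h\<^sup>2 *\<^sub>R ?a)"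
      by (simp only: norm_triangle_ineq4)
    also have "\<dots> \<le> e * h\<^sup>2 + e * h\<^sup>2"
      using h by (intro add_mono d1(2) d2(2)) auto
    finally have "cmod (h\<^sup>2 *\<^sub>R (?a - ?b)) \<le> e * h\<^sup>2 + e * h\<^sup>2" .
    then have "h\<^sup>2 * cmod (?a - ?b) \<le> h\<^sup>2 * (2 * e)" by (simp add: mult.commute)
    then show ?thesis using h by (subst (asm) mult_le_cancel_left_pos) auto
  qed
  have "cmod (?a - ?b) \<le> 0"
  proof (rule field_le_epsilon)
    fix e :: real assume "e > 0"
    then have "cmod (?a - ?b) \<le> 2 * (e / 2)" by (intro *) auto
    then show "cmod (?a - ?b) \<le> 0 + e" by simp
  qed
  then show "?a = ?b" by simp
qed

lemma partials_permute:
  assumes "smooth_fun f" "mset is = mset js"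
  shows "partials is f = partials js f"
proof -
  have "fold partial_deriv (rev is) f = fold partial_deriv (rev js) f"
    by (rule fold_permuted_eq[where P = smooth_fun])
      (use assms in \<open>auto intro: smooth_fun_partial_deriv partial_deriv_commute\<close>)
  then show ?thesis by (simp add: foldr_conv_fold)
qed

lemma mset_eq_iff_count_list: "mset xs = mset ys \<longleftrightarrow> count_list xs = count_list ys"
  by (auto simp: multiset_eq_iff count_mset fun_eq_iff)

lemma ex_list_of_mi:
  obtains "is" :: "'d::finite list" where "count_list is = \<beta>"
  using ex_count_list[of \<beta>] by (auto simp: fun_eq_iff)

text \<open>\<open>mi_deriv\<close> picks an unspecified order of differentiation; by symmetry any
  list with the same counts gives the same result.\<close>

lemma mi_D_count_list:
  assumes "smooth_fun f"
  shows "mi_D (count_list is) f x = (- \<i>) ^ length is * partials is f x"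
proof -
  define js where "js = (SOME js. \<forall>i. count_list js i = count_list is i)"
  have "\<forall>i. count_list js i = count_list is i"
    unfolding js_def by (rule someI[of _ "is"]) simp
  then have "mset js = mset is" by (simp add: mset_eq_iff_count_list fun_eq_iff)
  then have "partials js f = partials is f" by (rule partials_permute[OF assms])
  then show ?thesis
    by (simp add: mi_D_def mi_deriv_def mi_abs_count_list js_def[symmetric])
qed

lemma cmod_mi_D: "smooth_fun f \<Longrightarrow> cmod (mi_D (count_list is) f x) = cmod (partials is f x)"
  by (simp add: mi_D_count_list norm_mult norm_power)

lemma mi_D_lincomb:
  assumes "smooth_fun f" "smooth_fun g"
  shows "mi_D \<beta> (\<lambda>x. a * f x + b * g x) x = a * mi_D \<beta> f x + b * mi_D \<beta> g x"
proof -
  obtain "is" where \<beta>: "count_list is = \<beta>" by (rule ex_list_of_mi)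
  show ?thesis unfolding \<beta>[symmetric]
    by (subst (1 2 3) mi_D_count_list)
      (simp_all add: assms smooth_fun_add smooth_fun_cmult partials_add partials_cmult algebra_simps)
qed

subsection \<open>Characters and monomials\<close>

lemma mi_pow_count_list: "mi_pow x (count_list is) = (\<Prod>k\<leftarrow>is. x $ k)"
proof (induction "is")
  case (Cons k "is")
  have "mi_pow x (count_list (k # is)) = (\<Prod>i\<in>UNIV. (if i = k then x $ k else 1) * (x $ i) ^ count_list is i)"
    unfolding mi_pow_def by (intro prod.cong) auto
  also have "\<dots> = x $ k * mi_pow x (count_list is)"
    by (simp add: prod.distrib mi_pow_def)
  finally show ?case using Cons by (simp only: list.map prod_list.Cons)
qed (simp add: mi_pow_def)

definition character :: "real ^ 'd::finite \<Rightarrow> real ^ 'd \<Rightarrow> complex" where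
  "character \<xi> y = exp (\<i> * complex_of_real (y \<bullet> \<xi>))"

lemma cmod_character [simp]: "cmod (character \<xi> y) = 1"
  by (simp add: character_def)

lemma character_add: "character (\<xi> + \<eta>) y = character \<xi> y * character \<eta> y"
  by (simp add: character_def inner_add_right distrib_left exp_add)

lemma character_add_right: "character \<xi> (x + y) = character \<xi> x * character \<xi> y"
  by (simp add: character_def inner_add_left distrib_left exp_add)

lemma cnj_character: "cnj (character \<xi> y) = character (- \<xi>) y"
  by (simp add: character_def exp_cnj)

lemma character_commute: "character \<xi> y = character y \<xi>"
  by (simp add: character_def inner_commute)

lemma character_minus_right: "character \<xi> (- y) = character (- \<xi>) y"
  by (simp add: character_def)

lemma has_derivative_character:
  "(character \<xi> has_derivative (\<lambda>h. \<i> * complex_of_real (h \<bullet> \<xi>) * character \<xi> x)) (at x)"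
proof -
  have "((\<lambda>y. \<i> * complex_of_real (y \<bullet> \<xi>)) has_derivative (\<lambda>h. \<i> * complex_of_real (h \<bullet> \<xi>))) (at x)"
    by (intro bounded_linear.has_derivative[OF bounded_linear_const_mult]
        bounded_linear.has_derivative[OF bounded_linear_of_real]
        has_derivative_inner_left has_derivative_ident bounded_linear_ident)
  from has_derivative_compose[OF this DERIV_exp[unfolded has_field_derivative_def]]
  show ?thesis by (simp add: character_def[abs_def] mult.commute)
qed

lemma partial_deriv_character:
  "partial_deriv k (\<lambda>y. c * character \<xi> y) = (\<lambda>y. (c * (\<i> * \<xi> $ k)) * character \<xi> y)"
proof
  fix y
  have "((\<lambda>y. c * character \<xi> y) has_derivative
      (\<lambda>h. c * (\<i> * complex_of_real (h \<bullet> \<xi>) * character \<xi> y))) (at y)"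
    by (intro has_derivative_mult_right has_derivative_character)
  from partial_deriv_eqI[OF this, of k]
  show "partial_deriv k (\<lambda>y. c * character \<xi> y) y = (c * (\<i> * \<xi> $ k)) * character \<xi> y"
    by (simp add: inner_axis' mult_ac)
qed

lemma smooth_fun_character: "smooth_fun (character \<xi>)"
proof (rule smooth_fun_coinduct[where P = "\<lambda>h. \<exists>c. h = (\<lambda>y. c * character \<xi> y)"])
  show "\<exists>c. character \<xi> = (\<lambda>y. c * character \<xi> y)" by (intro exI[of _ 1]) simp
next
  fix g :: "real ^ 'a \<Rightarrow> complex" and x
  assume "\<exists>c. g = (\<lambda>y. c * character \<xi> y)"
  then show "g differentiable (at x)"
    using has_derivative_mult_right[OF has_derivative_character] unfolding differentiable_def by blast
next
  fix g :: "real ^ 'a \<Rightarrow> complex" and i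
  assume "\<exists>c. g = (\<lambda>y. c * character \<xi> y)"
  then show "\<exists>c. partial_deriv i g = (\<lambda>y. c * character \<xi> y)"
    using partial_deriv_character by blast
qed

lemma partials_character:
  "partials is (character \<xi>) = (\<lambda>y. (\<i> ^ length is * mi_pow \<xi> (count_list is)) * character \<xi> y)"
proof (induction "is")
  case (Cons k "is")
  have "mi_pow \<xi> (count_list (k # is)) = \<xi> $ k * mi_pow \<xi> (count_list is)"
    by (simp only: mi_pow_count_list list.map prod_list.Cons)
  then have "\<i> ^ length is * mi_pow \<xi> (count_list is) * (\<i> * \<xi> $ k) = \<i> ^ length (k # is) * mi_pow \<xi> (count_list (k # is))"
    by (simp add: mult_ac del: count_list.simps)
  then show ?case by (simp only: foldr.simps o_apply Cons.IH partial_deriv_character)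
qed (simp add: mi_pow_def)

text \<open>For \<open>\<alpha> i = 0\<close> the exponent is truncated at 0, and the factor
  \<open>\<alpha> i\<close> makes the derivative vanish as it should.\<close>

lemma partial_deriv_mi_pow:
  "partial_deriv i (\<lambda>x. c * complex_of_real (mi_pow x \<alpha>)) =
    (\<lambda>x. (c * \<alpha> i) * complex_of_real (mi_pow x (\<alpha>(i := \<alpha> i - 1))))"
    (is ?eq)
  and differentiable_mi_pow: "(\<lambda>x. c * complex_of_real (mi_pow x \<alpha>)) differentiable (at y)"
proof -
  let ?F = "\<lambda>x h. \<Sum>j\<in>UNIV. (real (\<alpha> j) * h $ j * (x $ j) ^ (\<alpha> j - 1)) * (\<Prod>k\<in>UNIV - {j}. (x $ k) ^ \<alpha> k)"
  have "((\<lambda>x. mi_pow x \<alpha>) has_derivative ?F x) (at x)" for x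
    unfolding mi_pow_def
    by (rule has_derivative_prod)
      (auto intro!: derivative_eq_intros bounded_linear.has_derivative[OF bounded_linear_vec_nth]
        simp: fun_eq_iff)
  then have D: "((\<lambda>x. c * complex_of_real (mi_pow x \<alpha>)) has_derivative (\<lambda>h. c * complex_of_real (?F x h))) (at x)" for x
    by (intro has_derivative_mult_right bounded_linear.has_derivative[OF bounded_linear_of_real])
  from D show "(\<lambda>x. c * complex_of_real (mi_pow x \<alpha>)) differentiable (at y)"
    unfolding differentiable_def by blast
  show ?eq
  proof
    fix x
    have "?F x (axis i 1) = (\<Sum>j\<in>UNIV. if j = i then \<alpha> i * (x $ i) ^ (\<alpha> i - 1) * (\<Prod>k\<in>UNIV - {i}. (x $ k) ^ \<alpha> k) else 0)"
      by (intro sum.cong) (auto simp: axis_def)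
    also have "\<dots> = \<alpha> i * ((x $ i) ^ (\<alpha> i - 1) * (\<Prod>k\<in>UNIV - {i}. (x $ k) ^ \<alpha> k))"
      by simp
    also have "(x $ i) ^ (\<alpha> i - 1) * (\<Prod>k\<in>UNIV - {i}. (x $ k) ^ \<alpha> k) = mi_pow x (\<alpha>(i := \<alpha> i - 1))"
      unfolding mi_pow_def by (subst (2) prod.remove[of _ i]) auto
    finally show "partial_deriv i (\<lambda>x. c * complex_of_real (mi_pow x \<alpha>)) x =
        (c * \<alpha> i) * complex_of_real (mi_pow x (\<alpha>(i := \<alpha> i - 1)))"
      using partial_deriv_eqI[OF D, of i x] by (simp add: mult_ac)
  qed
qed

lemma smooth_fun_mi_pow: "smooth_fun (\<lambda>x. complex_of_real (mi_pow x \<alpha>))"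
proof (rule smooth_fun_coinduct[where P = "\<lambda>h. \<exists>c \<alpha>. h = (\<lambda>x. c * complex_of_real (mi_pow x \<alpha>))"])
  show "\<exists>c \<beta>. (\<lambda>x. complex_of_real (mi_pow x \<alpha>)) = (\<lambda>x. c * complex_of_real (mi_pow x \<beta>))"
    by (rule exI[of _ 1], rule exI[of _ \<alpha>]) simp
qed (use partial_deriv_mi_pow differentiable_mi_pow in blast)+

text \<open>\<open>a\<close> is a product of exponents, each at most the total degree at its stage,
  so \<open>a * fact (mi_abs \<beta>)\<close> never grows along the list. The degree relation fails
  only once the derivative has vanished.\<close>

lemma partials_mi_pow:
  "\<exists>a \<beta>. partials is (\<lambda>x. complex_of_real (mi_pow x \<alpha>)) = (\<lambda>x. of_real a * complex_of_real (mi_pow x \<beta>)) \<and>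
    0 \<le> a \<and> a * fact (mi_abs \<beta>) \<le> fact (mi_abs \<alpha>) \<and> (a = 0 \<or> mi_abs \<beta> + length is = mi_abs \<alpha>)"
proof (induction "is")
  case Nil
  show ?case by (rule exI[of _ 1], rule exI[of _ \<alpha>]) simp
next
  case (Cons i "is")
  then obtain a \<beta> where eq: "partials is (\<lambda>x. complex_of_real (mi_pow x \<alpha>)) = (\<lambda>x. of_real a * complex_of_real (mi_pow x \<beta>))"
    and a: "0 \<le> a" "a * fact (mi_abs \<beta>) \<le> fact (mi_abs \<alpha>)" "a = 0 \<or> mi_abs \<beta> + length is = mi_abs \<alpha>"
    by blast
  define \<gamma> where "\<gamma> = \<beta>(i := \<beta> i - 1)"
  have eq': "partials (i # is) (\<lambda>x. complex_of_real (mi_pow x \<alpha>)) = (\<lambda>x. of_real (a * \<beta> i) * complex_of_real (mi_pow x \<gamma>))"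
    by (simp add: eq partial_deriv_mi_pow \<gamma>_def)
  have \<gamma>: "mi_abs \<beta> = Suc (mi_abs \<gamma>)" if "\<beta> i \<noteq> 0"
  proof -
    have "mi_abs \<beta> = \<beta> i + (\<Sum>j\<in>UNIV - {i}. \<beta> j)" "mi_abs \<gamma> = \<gamma> i + (\<Sum>j\<in>UNIV - {i}. \<gamma> j)"
      unfolding mi_abs_def by (subst sum.remove[of _ i]; simp)+
    moreover have "(\<Sum>j\<in>UNIV - {i}. \<gamma> j) = (\<Sum>j\<in>UNIV - {i}. \<beta> j)"
      by (intro sum.cong) (auto simp: \<gamma>_def)
    ultimately show ?thesis using that by (simp add: \<gamma>_def)
  qed
  have "\<beta> i \<le> mi_abs \<beta>" unfolding mi_abs_def by (intro member_le_sum) auto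
  have "a * \<beta> i * fact (mi_abs \<gamma>) \<le> fact (mi_abs \<alpha>)"
  proof (cases "\<beta> i = 0")
    case False
    then have "a * \<beta> i * fact (mi_abs \<gamma>) \<le> a * mi_abs \<beta> * fact (mi_abs \<gamma>)"
      using \<open>\<beta> i \<le> mi_abs \<beta>\<close> a by (intro mult_right_mono mult_left_mono) auto
    also have "\<dots> = a * fact (mi_abs \<beta>)" using \<gamma>[OF False] by simp
    finally show ?thesis using a by linarith
  qed auto
  moreover have "a * \<beta> i = 0 \<or> mi_abs \<gamma> + length (i # is) = mi_abs \<alpha>"
    using a(3) \<gamma> by (cases "\<beta> i = 0") auto
  ultimately show ?case using eq' a(1) by (intro exI[of _ "a * \<beta> i"] exI[of _ \<gamma>]) auto
qed


text \<open>The shares of \<open>a\<close> and \<open>b\<close> in their sum add up to one, and a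
  number in [0, 1] is at most its p-th power. With p = 1 / s this is the subadditivity that lets
  weights be translated.\<close>

lemma powr_add_le:
  fixes a b p :: real
  assumes "a \<ge> 0" "b \<ge> 0" "0 < p" "p \<le> 1"
  shows "(a + b) powr p \<le> a powr p + b powr p"
proof (cases "a + b = 0")
  case False
  define S where "S = a + b"
  have S: "S > 0" using False assms by (simp add: S_def)
  have *: "c / S \<le> c powr p / S powr p" if "0 \<le> c" "c \<le> S" for c
    using powr_mono'[of p 1 "c / S"] that S assms by (simp add: powr_divide)
  have "1 = a / S + b / S" using S by (simp add: S_def add_divide_distrib[symmetric])
  also have "\<dots> \<le> a powr p / S powr p + b powr p / S powr p"
    using assms by (intro add_mono *) (auto simp: S_def)
  finally show ?thesis using S by (simp add: S_def[symmetric] field_simps)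
qed (use assms in auto)

section \<open>Gelfand--Shilov spaces\<close>

text \<open>The quotient is tested on pure powers of one coordinate only; these are the component
  moments of the derivative.\<close>

lemma cmod_mi_D_le_exp_decay:
  fixes f :: "real ^ 'd::finite \<Rightarrow> complex" and h t s C :: real
  assumes "h > 0" "t > 0" and C: "\<And>p. gs_quotient t s h f p \<le> C"
  shows "cmod (mi_D \<beta> f x) \<le> (2 powr t * C * (h ^ mi_abs \<beta> * mi_fact \<beta> powr s)) *
    exp (- (t / (2 * (CARD('d) * h) powr (1 / t)) * norm x powr (1 / t)))"
proof -
  have D: "h ^ mi_abs \<beta> * mi_fact \<beta> powr s > 0"
    using \<open>h > 0\<close> mi_fact_pos[of \<beta>] by auto
  have "0 \<le> gs_quotient t s h f (\<lambda>_. 0, \<beta>, x)"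
    using \<open>h > 0\<close> by (auto simp: gs_quotient_def)
  then have "C \<ge> 0" using C order_trans by blast
  have moments: "\<bar>x $ k\<bar> ^ m * cmod (mi_D \<beta> f x) \<le> C * (h ^ mi_abs \<beta> * mi_fact \<beta> powr s) * h ^ m * fact m powr t" for k m
  proof -
    define \<alpha> where "\<alpha> = (\<lambda>i. if i = k then m else 0)"
    have "mi_pow x \<alpha> = (\<Prod>i\<in>UNIV. if i = k then (x $ i) ^ m else 1)"
      unfolding mi_pow_def \<alpha>_def by (intro prod.cong) auto
    moreover have "mi_fact \<alpha> = (\<Prod>i\<in>UNIV. if i = k then fact m else 1)"
      unfolding mi_fact_def \<alpha>_def by (intro prod.cong) auto
    ultimately have \<alpha>: "mi_pow x \<alpha> = (x $ k) ^ m" "mi_abs \<alpha> = m" "mi_fact \<alpha> = fact m"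
      by (simp_all add: mi_abs_def \<alpha>_def)
    have "gs_quotient t s h f (\<alpha>, \<beta>, x) \<le> C" by (rule C)
    then show ?thesis
      using \<open>h > 0\<close> mi_fact_pos[of \<beta>]
      by (simp add: gs_quotient_def \<alpha> norm_mult norm_power power_abs divide_le_eq power_add mult_ac)
  qed
  have "cmod (mi_D \<beta> f x) \<le> 2 powr t * (C * (h ^ mi_abs \<beta> * mi_fact \<beta> powr s)) *
    exp (- (t / (2 * (CARD('d) * h) powr (1 / t)) * norm x powr (1 / t)))"
    using \<open>C \<ge> 0\<close> D assms moments by (intro exp_decay_of_component_moments) auto
  then show ?thesis by (simp add: mult_ac)
qed

lemma gs_space_smooth: "\<phi> \<in> gs_space t s \<Longrightarrow> smooth_fun \<phi>"
  by (simp add: gs_space_def)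

lemma gs_quotient_le_seminorm:
  "\<phi> \<in> gs_space t s \<Longrightarrow> h > 0 \<Longrightarrow> gs_quotient t s h \<phi> p \<le> gs_seminorm t s h \<phi>"
  unfolding gs_seminorm_def by (intro cSUP_upper) (auto simp: gs_space_def)

lemma gs_space_decay:
  fixes \<phi> :: "real ^ 'd::finite \<Rightarrow> complex"
  assumes "\<phi> \<in> gs_space t s" "t > 0" "s \<ge> 0" "h > 0" "r > 0"
  obtains C where "C > 0" "\<And>is x. cmod (partials is \<phi> x) \<le>
    C * h ^ length is * fact (length is) powr s * exp (- (r * norm x powr (1 / t)))"
proof -
  \<comment> \<open>Chosen so that the rate supplied by the moment bound equals \<open>r\<close>;
    the minimum with \<open>h\<close> then serves the derivatives as well.\<close>
  define h0 where "h0 = (t / (2 * r)) powr t / CARD('d)"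
  have h0: "h0 > 0" "(CARD('d) * h0) powr (1 / t) = t / (2 * r)"
    using assms by (auto simp: h0_def powr_powr)
  define k where "k = min h h0"
  have k: "k > 0" "k \<le> h" "k \<le> h0" using h0 assms by (auto simp: k_def)
  define C where "C = gs_seminorm t s k \<phi>"
  have C: "gs_quotient t s k \<phi> p \<le> C" for p
    unfolding C_def using assms k by (intro gs_quotient_le_seminorm)
  have "0 \<le> gs_quotient t s k \<phi> (\<lambda>_. 0, \<lambda>_. 0, 0)"
    using k by (auto simp: gs_quotient_def)
  then have "C \<ge> 0" using C order_trans by blast
  have "(CARD('d) * k) powr (1 / t) \<le> (CARD('d) * h0) powr (1 / t)"
    using k assms by (intro powr_mono2) auto
  then have r: "r \<le> t / (2 * (CARD('d) * k) powr (1 / t))"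
  proof -
    have "2 * (CARD('d) * k) powr (1 / t) \<le> t / r"
      using \<open>_ \<le> (CARD('d) * h0) powr (1 / t)\<close> unfolding h0 by simp
    then have "r * (2 * (CARD('d) * k) powr (1 / t)) \<le> t"
      using \<open>r > 0\<close> by (simp add: pos_le_divide_eq mult.commute)
    then show ?thesis using k by (subst pos_le_divide_eq) auto
  qed
  show ?thesis
  proof (rule that)
    show "2 powr t * C + 1 > 0" using \<open>C \<ge> 0\<close> by (simp add: add_nonneg_pos)
    fix "is" :: "'d list" and x
    define \<beta> where "\<beta> = count_list is"
    have n: "mi_abs \<beta> = length is" by (simp add: \<beta>_def mi_abs_count_list)
    have "cmod (partials is \<phi> x) = cmod (mi_D \<beta> \<phi> x)"
      using assms by (simp add: \<beta>_def cmod_mi_D gs_space_smooth)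
    also have "\<dots> \<le> (2 powr t * C * (k ^ mi_abs \<beta> * mi_fact \<beta> powr s)) *
      exp (- (t / (2 * (CARD('d) * k) powr (1 / t)) * norm x powr (1 / t)))"
      using k assms C by (intro cmod_mi_D_le_exp_decay)
    also have "\<dots> \<le> ((2 powr t * C + 1) * (h ^ length is * fact (length is) powr s)) *
      exp (- (r * norm x powr (1 / t)))"
      using k assms \<open>C \<ge> 0\<close> mi_fact_powr_le[of s \<beta>] mult_right_mono[OF r, of "norm x powr (1 / t)"]
      unfolding n by (intro mult_mono power_mono) auto
    finally show "cmod (partials is \<phi> x) \<le> (2 powr t * C + 1) * h ^ length is *
      fact (length is) powr s * exp (- (r * norm x powr (1 / t)))"
      by (simp add: mult_ac)
  qed
qed

text \<open>Powers of \<open>x\<close> are absorbed by the exponential decay. Together with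
  \<open>gs_space_decay\<close> this replaces the seminorms by two independent quantifiers, one for
  the ratio of the derivative bounds and one for the rate of decay.\<close>

lemma gs_spaceI:
  fixes \<phi> :: "real ^ 'd::finite \<Rightarrow> complex"
  assumes "smooth_fun \<phi>" "t > 0" "s > 0"
    and decay: "\<And>h r. h > 0 \<Longrightarrow> r > 0 \<Longrightarrow> \<exists>C. \<forall>is x. cmod (partials is \<phi> x) \<le>
      C * h ^ length is * fact (length is) powr s * exp (- (r * norm x powr (1 / t)))"
  shows "\<phi> \<in> gs_space t s"
proof -
  have "bdd_above (range (gs_quotient t s h \<phi>))" if "h > 0" for h
  proof -
    define D where "D = (2::real) ^ CARD('d)"
    \<comment> \<open>The divisions pay for replacing the factorials of the total degrees by the
      products of factorials in \<open>gs_quotient\<close>.\<close>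
    define k where "k = h / D powr t"
    define l where "l = h / D powr s"
    have D: "D > 0" by (simp add: D_def)
    have kl: "k > 0" "l > 0" using that D by (auto simp: k_def l_def)
    \<comment> \<open>The rate at which \<open>power_le_fact_powr_exp\<close> lets a monomial grow;
      the decay cancels it exactly.\<close>
    define r where "r = t / k powr (1 / t)"
    have r0: "r > 0" using kl assms by (auto simp: r_def)
    have r: "t * (y / k) powr (1 / t) = r * y powr (1 / t)" if "y \<ge> 0" for y
      using kl assms that by (auto simp: r_def powr_divide)
    obtain C where C: "\<And>is x. cmod (partials is \<phi> x) \<le>
      C * l ^ length is * fact (length is) powr s * exp (- (r * norm x powr (1 / t)))"
      using decay[OF kl(2) r0] by auto
    have "0 \<le> C" using C[of "[]" 0] order_trans[OF norm_ge_zero] by fastforce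
    show ?thesis
    proof (rule bdd_aboveI2, clarify)
      fix \<alpha> \<beta> :: "'d \<Rightarrow> nat" and x :: "real ^ 'd"
      let ?m = "mi_abs \<alpha>" and ?n = "mi_abs \<beta>" and ?e = "exp (r * norm x powr (1 / t))"
      obtain "is" where \<beta>: "count_list is = \<beta>" by (rule ex_list_of_mi)
      have n: "?n = length is" by (simp add: \<beta>[symmetric] mi_abs_count_list)
      have "cmod (complex_of_real (mi_pow x \<alpha>) * mi_D \<beta> \<phi> x) = \<bar>mi_pow x \<alpha>\<bar> * cmod (partials is \<phi> x)"
        using assms by (simp add: \<beta>[symmetric] norm_mult cmod_mi_D)
      also have "\<dots> \<le> norm x ^ ?m * (C * l ^ ?n * fact ?n powr s * exp (- (r * norm x powr (1 / t))))"
        unfolding n by (intro mult_mono abs_mi_pow_le C) auto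
      also have "\<dots> \<le> (k ^ ?m * fact ?m powr t * ?e) * (C * l ^ ?n * fact ?n powr s * exp (- (r * norm x powr (1 / t))))"
        using power_le_fact_powr_exp[of "norm x" k t ?m] kl assms \<open>0 \<le> C\<close>
        by (intro mult_right_mono) (auto simp: r)
      also have "\<dots> = C * (k ^ ?m * fact ?m powr t) * (l ^ ?n * fact ?n powr s)"
        by (simp add: exp_minus field_simps)
      also have "\<dots> \<le> C * (k ^ ?m * ((D powr t) ^ ?m * mi_fact \<alpha> powr t)) * (l ^ ?n * ((D powr s) ^ ?n * mi_fact \<beta> powr s))"
        using kl \<open>0 \<le> C\<close> assms fact_powr_le_mi_fact[of t \<alpha>] fact_powr_le_mi_fact[of s \<beta>] unfolding D_def
        by (intro mult_mono mult_left_mono) auto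
      also have "\<dots> = C * (h ^ (?m + ?n) * mi_fact \<alpha> powr t * mi_fact \<beta> powr s)"
        using D by (simp add: k_def l_def power_divide power_add)
      finally show "gs_quotient t s h \<phi> (\<alpha>, \<beta>, x) \<le> C"
        using that mi_fact_pos[of \<alpha>] mi_fact_pos[of \<beta>]
        by (simp add: gs_quotient_def divide_le_eq)
    qed
  qed
  then show ?thesis using assms by (simp add: gs_space_def)
qed

lemma gs_space_lincomb:
  fixes \<phi> \<theta> :: "real ^ 'd::finite \<Rightarrow> complex"
  assumes "\<phi> \<in> gs_space t s" "\<theta> \<in> gs_space t s" "t > 0" "s > 0"
  shows "(\<lambda>x. a * \<phi> x + b * \<theta> x) \<in> gs_space t s"
proof (rule gs_spaceI)
  have "smooth_fun \<phi>" "smooth_fun \<theta>"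
    using assms(1,2) by (auto dest: gs_space_smooth)
  then have sm: "smooth_fun (\<lambda>x. a * \<phi> x)" "smooth_fun (\<lambda>x. b * \<theta> x)" "smooth_fun \<phi>" "smooth_fun \<theta>"
    by (auto intro!: smooth_fun_cmult)
  then show "smooth_fun (\<lambda>x. a * \<phi> x + b * \<theta> x)" by (intro smooth_fun_add)
  fix h r :: real assume hr: "h > 0" "r > 0"
  obtain C where "C > 0" and C: "\<And>is x. cmod (partials is \<phi> x) \<le>
    C * h ^ length is * fact (length is) powr s * exp (- (r * norm x powr (1 / t)))"
    using gs_space_decay[OF assms(1,3) less_imp_le[OF assms(4)] hr] by blast
  obtain E where "E > 0" and E: "\<And>is x. cmod (partials is \<theta> x) \<le>
    E * h ^ length is * fact (length is) powr s * exp (- (r * norm x powr (1 / t)))"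
    using gs_space_decay[OF assms(2,3) less_imp_le[OF assms(4)] hr] by blast
  have "cmod (partials is (\<lambda>x. a * \<phi> x + b * \<theta> x) x) \<le>
      (cmod a * C + cmod b * E) * h ^ length is * fact (length is) powr s * exp (- (r * norm x powr (1 / t)))"
    for "is" x
  proof -
    have "cmod (partials is (\<lambda>x. a * \<phi> x + b * \<theta> x) x) \<le> cmod a * cmod (partials is \<phi> x) + cmod b * cmod (partials is \<theta> x)"
      using sm by (simp add: partials_add partials_cmult norm_triangle_mono norm_mult)
    also have "\<dots> \<le> cmod a * (C * h ^ length is * fact (length is) powr s * exp (- (r * norm x powr (1 / t)))) +
      cmod b * (E * h ^ length is * fact (length is) powr s * exp (- (r * norm x powr (1 / t))))"
      by (intro add_mono mult_left_mono C E) auto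
    finally show ?thesis by (simp add: algebra_simps)
  qed
  then show "\<exists>C. \<forall>is x. cmod (partials is (\<lambda>x. a * \<phi> x + b * \<theta> x) x) \<le>
    C * h ^ length is * fact (length is) powr s * exp (- (r * norm x powr (1 / t)))" by blast
qed (use assms in auto)

text \<open>For 1 / t <= 1 the weight is subadditive, so the shift costs only the constant exp (r *
  norm a powr (1 / t)). It is applied to windows for F, whose decay parameter is s.\<close>

lemma gs_space_translate:
  assumes "\<phi> \<in> gs_space t s" "t > 0" "s > 0" "t \<ge> 1"
  shows "translate a \<phi> \<in> gs_space t s"
proof (rule gs_spaceI)
  have sm: "smooth_fun \<phi>" using assms by (intro gs_space_smooth)
  then show "smooth_fun (translate a \<phi>)" by (rule smooth_fun_translate)
  fix h r :: real assume hr: "h > 0" "r > 0"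
  obtain C where "C > 0" and C: "\<And>is x. cmod (partials is \<phi> x) \<le>
    C * h ^ length is * fact (length is) powr s * exp (- (r * norm x powr (1 / t)))"
    using gs_space_decay[OF assms(1,2) less_imp_le[OF assms(3)] hr] by blast
  let ?E = "exp (r * norm a powr (1 / t))"
  have "cmod (partials is (translate a \<phi>) x) \<le>
      (C * ?E) * h ^ length is * fact (length is) powr s * exp (- (r * norm x powr (1 / t)))"
    for "is" x
  proof -
    have "norm x powr (1 / t) \<le> (norm (x - a) + norm a) powr (1 / t)"
      using assms norm_triangle_sub[of x a] by (intro powr_mono2) (auto simp: add.commute)
    also have "\<dots> \<le> norm (x - a) powr (1 / t) + norm a powr (1 / t)"
      using assms by (intro powr_add_le) auto
    finally have "r * norm x powr (1 / t) \<le> r * (norm (x - a) powr (1 / t) + norm a powr (1 / t))"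
      using hr by (intro mult_left_mono) auto
    then have "exp (- (r * norm (x - a) powr (1 / t))) \<le> ?E * exp (- (r * norm x powr (1 / t)))"
      by (simp add: exp_add[symmetric] algebra_simps)
    then have "C * h ^ length is * fact (length is) powr s * exp (- (r * norm (x - a) powr (1 / t))) \<le>
        C * h ^ length is * fact (length is) powr s * (?E * exp (- (r * norm x powr (1 / t))))"
      using hr \<open>C > 0\<close> by (intro mult_left_mono) auto
    with C[of "is" "x - a"] show ?thesis
      by (simp add: partials_translate[OF sm] translate_def mult_ac)
  qed
  then show "\<exists>C. \<forall>is x. cmod (partials is (translate a \<phi>) x) \<le>
    C * h ^ length is * fact (length is) powr s * exp (- (r * norm x powr (1 / t)))" by blast
qed (use assms in auto)

section \<open>Leibniz bounds with factorial weights, and modulation\<close>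

lemma fact_mult_le_fact: "fact k * fact (n - k) \<le> (fact n :: real)" if "k \<le> n"
proof -
  have "fact k * fact (n - k) * (1::real) \<le> fact k * fact (n - k) * real (n choose k)"
    using that by (intro mult_left_mono) (auto simp: Suc_le_eq)
  also have "\<dots> = fact n" using that by (simp add: binomial_fact)
  finally show ?thesis by simp
qed

text \<open>Since k! (n - k)! is at most n!, the factorial powers leave the sum and the binomial
  theorem remains.\<close>

lemma binomial_fact_powr_sum_le:
  fixes a b s :: real
  assumes "a \<ge> 0" "b \<ge> 0" "s \<ge> 0"
  shows "(\<Sum>k\<le>n. real (n choose k) * (a ^ k * fact k powr s) * (b ^ (n - k) * fact (n - k) powr s))
    \<le> (a + b) ^ n * fact n powr s"
proof -
  have "(\<Sum>k\<le>n. real (n choose k) * (a ^ k * fact k powr s) * (b ^ (n - k) * fact (n - k) powr s))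
      \<le> (\<Sum>k\<le>n. (real (n choose k) * a ^ k * b ^ (n - k)) * fact n powr s)"
  proof (rule sum_mono)
    fix k assume "k \<in> {..n}"
    then have "(fact k * fact (n - k)) powr s \<le> (fact n :: real) powr s"
      using assms by (intro powr_mono2 fact_mult_le_fact) auto
    then have "(real (n choose k) * a ^ k * b ^ (n - k)) * (fact k powr s * fact (n - k) powr s) \<le>
      (real (n choose k) * a ^ k * b ^ (n - k)) * fact n powr s"
      using assms by (intro mult_left_mono) (auto simp: powr_mult)
    then show "real (n choose k) * (a ^ k * fact k powr s) * (b ^ (n - k) * fact (n - k) powr s) \<le>
      (real (n choose k) * a ^ k * b ^ (n - k)) * fact n powr s" by (simp add: mult_ac)
  qed
  also have "\<dots> = (a + b) ^ n * fact n powr s"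
    by (subst binomial_ring) (simp add: sum_distrib_right)
  finally show ?thesis .
qed

text \<open>The ratios of the two factors add. \<open>A\<close> and \<open>B\<close> may depend on
  the point \<open>y\<close>, so that weights in \<open>y\<close> are carried along as
  constants.\<close>

lemma partials_mult_fact_bound:
  fixes a b s A B :: real
  assumes "smooth_fun f" "smooth_fun g" "a \<ge> 0" "b \<ge> 0" "s \<ge> 0"
    and "\<And>js. cmod (partials js f y) \<le> A * a ^ length js * fact (length js) powr s"
    and "\<And>js. cmod (partials js g y) \<le> B * b ^ length js * fact (length js) powr s"
  shows "cmod (partials is (\<lambda>x. f x * g x) y) \<le> (A * B) * (a + b) ^ length is * fact (length is) powr s"
proof -
  let ?n = "length is"
  have "0 \<le> A" "0 \<le> B"
    using order_trans[OF norm_ge_zero assms(6)[of "[]"]] order_trans[OF norm_ge_zero assms(7)[of "[]"]] by simp_all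
  have "cmod (partials is (\<lambda>x. f x * g x) y) \<le>
    (\<Sum>k\<le>?n. real (?n choose k) * (A * a ^ k * fact k powr s) * (B * b ^ (?n - k) * fact (?n - k) powr s))"
    by (rule partials_mult_bound) (use assms in auto)
  also have "\<dots> = (A * B) * (\<Sum>k\<le>?n. real (?n choose k) * (a ^ k * fact k powr s) * (b ^ (?n - k) * fact (?n - k) powr s))"
    by (simp add: sum_distrib_left mult_ac)
  also have "\<dots> \<le> (A * B) * ((a + b) ^ ?n * fact ?n powr s)"
    using \<open>0 \<le> A\<close> \<open>0 \<le> B\<close> assms by (intro mult_left_mono binomial_fact_powr_sum_le) auto
  finally show ?thesis by (simp add: mult_ac)
qed

lemma partials_character_bound:
  assumes "h > 0" "s > 0"
  shows "cmod (partials js (character \<xi>) y) \<le>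
    exp (s * (norm \<xi> / h) powr (1 / s)) * h ^ length js * fact (length js) powr s"
proof -
  have "cmod (partials js (character \<xi>) y) = \<bar>mi_pow \<xi> (count_list js)\<bar>"
    by (simp add: partials_character norm_mult norm_power)
  also have "\<dots> \<le> norm \<xi> ^ length js"
    using abs_mi_pow_le[of \<xi> "count_list js"] by (simp add: mi_abs_count_list)
  also have "\<dots> \<le> h ^ length js * fact (length js) powr s * exp (s * (norm \<xi> / h) powr (1 / s))"
    using assms by (intro power_le_fact_powr_exp) auto
  finally show ?thesis by (simp add: mult_ac)
qed

lemma gs_space_modulate:
  assumes "\<phi> \<in> gs_space t s" "t > 0" "s > 0"
  shows "modulate \<xi> \<phi> \<in> gs_space t s"
proof (rule gs_spaceI)
  have sm: "smooth_fun \<phi>" using assms by (intro gs_space_smooth)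
  have eq: "modulate \<xi> \<phi> = (\<lambda>y. character \<xi> y * \<phi> y)" by (simp add: modulate_def[abs_def] character_def)
  show "smooth_fun (modulate \<xi> \<phi>)"
    unfolding eq by (intro smooth_fun_mult sm smooth_fun_character)
  fix h r :: real assume hr: "h > 0" "r > 0"
  \<comment> \<open>Half of the ratio is reserved for the character and half for
    \<open>\<phi>\<close>.\<close>
  then have h2: "h / 2 > 0" by simp
  obtain C where "C > 0" and C: "\<And>is x. cmod (partials is \<phi> x) \<le>
    C * (h / 2) ^ length is * fact (length is) powr s * exp (- (r * norm x powr (1 / t)))"
    using gs_space_decay[OF assms(1,2) less_imp_le[OF assms(3)] h2 hr(2)] by blast
  define E where "E = exp (s * (norm \<xi> / (h / 2)) powr (1 / s))"
  have "cmod (partials is (modulate \<xi> \<phi>) x) \<le>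
      (E * C) * h ^ length is * fact (length is) powr s * exp (- (r * norm x powr (1 / t)))"
    for "is" x
  proof -
    have "cmod (partials is (modulate \<xi> \<phi>) x) \<le>
      (E * (C * exp (- (r * norm x powr (1 / t))))) * (h / 2 + h / 2) ^ length is * fact (length is) powr s"
      unfolding eq
    proof (rule partials_mult_fact_bound)
      show "cmod (partials js \<phi> x) \<le> C * exp (- (r * norm x powr (1 / t))) * (h / 2) ^ length js * fact (length js) powr s" for js
        using C[of js x] by (simp add: mult_ac)
      show "cmod (partials js (character \<xi>) x) \<le> E * (h / 2) ^ length js * fact (length js) powr s" for js
        unfolding E_def using hr assms by (intro partials_character_bound) auto
    qed (use sm hr assms in \<open>auto intro: smooth_fun_character\<close>)
    then show ?thesis by (simp add: mult_ac)
  qed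
  then show "\<exists>C. \<forall>is x. cmod (partials is (modulate \<xi> \<phi>) x) \<le>
    C * h ^ length is * fact (length is) powr s * exp (- (r * norm x powr (1 / t)))" by blast
qed (use assms in auto)

text \<open>Control by one seminorm is enough: the preimage of an open set contains, around each of
  its points, a ball of that seminorm, and such balls belong to the generating family of the
  topology.\<close>

lemma gs_dualI:
  fixes u :: "'d::finite distr"
  assumes "t > 0" "s > 0" "h > 0"
    and lin: "\<And>\<phi> \<theta> a b. \<phi> \<in> gs_space t s \<Longrightarrow> \<theta> \<in> gs_space t s \<Longrightarrow>
      u (\<lambda>x. a * \<phi> x + b * \<theta> x) = cnj a * u \<phi> + cnj b * u \<theta>"
    and bound: "\<And>\<phi>. \<phi> \<in> gs_space t s \<Longrightarrow> cmod (u \<phi>) \<le> K * gs_seminorm t s h \<phi>"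
  shows "u \<in> gs_dual t s"
proof -
  let ?B = "\<lambda>(\<phi>0 :: real ^ 'd \<Rightarrow> complex) h \<epsilon>. {\<phi> \<in> gs_space t s. gs_seminorm t s h (\<lambda>x. \<phi> x - \<phi>0 x) < \<epsilon>}"
  let ?\<B> = "{?B \<phi>0 h \<epsilon> | \<phi>0 h \<epsilon>. \<phi>0 \<in> gs_space t s \<and> h > 0 \<and> \<epsilon> > 0}"
  have center: "\<phi> \<in> ?B \<phi> h \<epsilon>" if "\<phi> \<in> gs_space t s" "h > 0" "\<epsilon> > 0" for \<phi> h \<epsilon>
  proof -
    have z: "partials is (\<lambda>x. 0) = (\<lambda>x::real^'d. 0)" for "is"
      by (induction "is") (auto simp: partial_deriv_const)
    have "gs_seminorm t s h (\<lambda>x::real^'d. 0) = 0"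
      unfolding gs_seminorm_def gs_quotient_def mi_D_def mi_deriv_def z by simp
    then show ?thesis using that by simp
  qed
  have sub: "(\<lambda>x. \<phi> x - \<theta> x) \<in> gs_space t s" "u (\<lambda>x. \<phi> x - \<theta> x) = u \<phi> - u \<theta>"
    if "\<phi> \<in> gs_space t s" "\<theta> \<in> gs_space t s" for \<phi> \<theta>
    using gs_space_lincomb[OF that assms(1,2), of 1 "-1"] lin[OF that, of 1 "-1"] by simp_all
  have top: "topspace (gs_topology t s) = (gs_space t s :: (real^'d \<Rightarrow> complex) set)"
  proof -
    have "topspace (gs_topology t s) = \<Union>?\<B>"
      unfolding gs_topology_def by (rule topology_generated_by_topspace)
    also have "\<dots> = gs_space t s"
    proof (intro equalityI subsetI)
      fix \<phi> :: "real ^ 'd \<Rightarrow> complex" assume "\<phi> \<in> gs_space t s"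
      then have "?B \<phi> 1 1 \<in> ?\<B>" "\<phi> \<in> ?B \<phi> 1 1" using center[of \<phi> 1 1] by (blast intro: zero_less_one, simp)
      then show "\<phi> \<in> \<Union>?\<B>" by (rule UnionI)
    qed blast
    finally show ?thesis .
  qed
  have "openin (gs_topology t s) {\<phi> \<in> gs_space t s. u \<phi> \<in> V}" if "open V" for V
  proof (subst openin_subopen, safe)
    fix \<phi>0 assume \<phi>0: "\<phi>0 \<in> gs_space t s" "u \<phi>0 \<in> V"
    obtain e where "e > 0" and e: "\<And>z. cmod (z - u \<phi>0) < e \<Longrightarrow> z \<in> V"
      using \<open>open V\<close> \<phi>0(2) unfolding open_dist by (metis dist_norm)
    \<comment> \<open>The denominator is positive whatever the sign of \<open>K\<close>.\<close>
    define \<epsilon> where "\<epsilon> = e / (\<bar>K\<bar> + 1)"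
    have "\<epsilon> > 0" using \<open>e > 0\<close> by (auto simp: \<epsilon>_def)
    have "openin (gs_topology t s) (?B \<phi>0 h \<epsilon>)"
      unfolding gs_topology_def using \<open>h > 0\<close> \<open>\<epsilon> > 0\<close> \<phi>0(1)
      by (intro topology_generated_by_Basis) blast
    moreover have "\<phi>0 \<in> ?B \<phi>0 h \<epsilon>" by (intro center \<phi>0 \<open>h > 0\<close> \<open>\<epsilon> > 0\<close>)
    moreover have "u \<phi> \<in> V" if "\<phi> \<in> ?B \<phi>0 h \<epsilon>" for \<phi>
    proof (rule e)
      have \<phi>: "\<phi> \<in> gs_space t s" "gs_seminorm t s h (\<lambda>x. \<phi> x - \<phi>0 x) < \<epsilon>" using that by auto
      have sn: "0 \<le> gs_seminorm t s h (\<lambda>x. \<phi> x - \<phi>0 x)"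
      proof -
        have "0 \<le> gs_quotient t s h (\<lambda>x. \<phi> x - \<phi>0 x) (\<lambda>_. 0, \<lambda>_. 0, 0)"
          using \<open>h > 0\<close> by (auto simp: gs_quotient_def)
        also have "\<dots> \<le> gs_seminorm t s h (\<lambda>x. \<phi> x - \<phi>0 x)"
          by (intro gs_quotient_le_seminorm sub \<phi> \<phi>0 \<open>h > 0\<close>)
        finally show ?thesis .
      qed
      have "cmod (u \<phi> - u \<phi>0) \<le> K * gs_seminorm t s h (\<lambda>x. \<phi> x - \<phi>0 x)"
        using bound[OF sub(1)[OF \<phi>(1) \<phi>0(1)]] sub(2)[OF \<phi>(1) \<phi>0(1)] by simp
      also have "\<dots> \<le> (\<bar>K\<bar> + 1) * gs_seminorm t s h (\<lambda>x. \<phi> x - \<phi>0 x)"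
        using sn by (intro mult_right_mono) auto
      also have "\<dots> < (\<bar>K\<bar> + 1) * \<epsilon>" using \<phi>(2) by (intro mult_strict_left_mono) auto
      also have "\<dots> = e" by (simp add: \<epsilon>_def)
      finally show "cmod (u \<phi> - u \<phi>0) < e" .
    qed
    ultimately show "\<exists>T. openin (gs_topology t s) T \<and> \<phi>0 \<in> T \<and> T \<subseteq> {\<phi> \<in> gs_space t s. u \<phi> \<in> V}"
      by blast
  qed
  then have "continuous_map (gs_topology t s) euclidean u"
    by (simp add: continuous_map_def top open_openin[symmetric])
  with lin show ?thesis by (auto simp: gs_dual_def)
qed


section \<open>Integration on \<open>\<real>\<^sup>d\<close>\<close>

lemma lborel_integral_affine_euclidean:
  fixes f :: "'a::euclidean_space \<Rightarrow> 'b::{banach, second_countable_topology}"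
  assumes [measurable]: "f \<in> borel_measurable borel" and "c \<noteq> 0"
  shows "(\<integral>x. f x \<partial>lborel) = \<bar>c\<bar> ^ DIM('a) *\<^sub>R (\<integral>x. f (a + c *\<^sub>R x) \<partial>lborel)"
proof -
  have "(\<integral>x. f x \<partial>lborel) = (\<integral>x. f x \<partial>density (distr lborel borel (\<lambda>x. a + c *\<^sub>R x)) (\<lambda>_. ennreal (\<bar>c\<bar> ^ DIM('a))))"
    by (rule arg_cong[where f = "\<lambda>M. integral\<^sup>L M f", OF lborel_affine[OF \<open>c \<noteq> 0\<close>]])
  also have "\<dots> = (\<integral>x. \<bar>c\<bar> ^ DIM('a) *\<^sub>R f (a + c *\<^sub>R x) \<partial>lborel)"
    by (simp add: integral_density integral_distr)
  finally show ?thesis by simp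
qed

lemma lborel_integrable_affine_euclidean:
  fixes f :: "'a::euclidean_space \<Rightarrow> 'b::{banach, second_countable_topology}"
  assumes f: "integrable lborel f" and "c \<noteq> 0"
  shows "integrable lborel (\<lambda>x. f (a + c *\<^sub>R x))"
proof -
  have [measurable]: "f \<in> borel_measurable borel" using f by auto
  have "integrable (density (distr lborel borel (\<lambda>x. a + c *\<^sub>R x)) (\<lambda>_. ennreal (\<bar>c\<bar> ^ DIM('a)))) f"
    using f lborel_affine[OF \<open>c \<noteq> 0\<close>, of a] by simp
  then have "integrable lborel (\<lambda>x. \<bar>c\<bar> ^ DIM('a) *\<^sub>R f (a + c *\<^sub>R x))"
    by (simp add: integrable_density integrable_distr_eq)
  from integrable_scaleR_right[OF this, of "1 / \<bar>c\<bar> ^ DIM('a)"] show ?thesis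
    using \<open>c \<noteq> 0\<close> by simp
qed

lemma lborel_integral_translate:
  fixes f :: "'a::euclidean_space \<Rightarrow> 'b::{banach, second_countable_topology}"
  assumes "f \<in> borel_measurable borel"
  shows "(\<integral>x. f (x + a) \<partial>lborel) = (\<integral>x. f x \<partial>lborel)"
  using lborel_integral_affine_euclidean[OF assms, of 1 a] by (simp add: add.commute)

lemma lborel_integrable_translate:
  fixes f :: "'a::euclidean_space \<Rightarrow> 'b::{banach, second_countable_topology}"
  assumes "integrable lborel f"
  shows "integrable lborel (\<lambda>x. f (x + a))"
  using lborel_integrable_affine_euclidean[OF assms, of 1 a] by (simp add: add.commute)

text \<open>Lebesgue measure is the image of a product measure indexed by basis vectors;
  \<open>k\<close> decodes a basis vector into its coordinate, which carries Fubini's theorem from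
  \<open>Basis\<close> to the index type.\<close>

lemma
  fixes f :: "'d::finite \<Rightarrow> real \<Rightarrow> 'b::{real_normed_field, banach, second_countable_topology}"
  assumes f: "\<And>i. integrable lborel (f i)"
  shows lborel_integrable_prod_cart: "integrable lborel (\<lambda>x::real^'d. \<Prod>i\<in>UNIV. f i (x $ i))"
    and lborel_integral_prod_cart:
      "(\<integral>x. (\<Prod>i\<in>UNIV. f i (x $ i)) \<partial>(lborel :: (real^'d) measure)) = (\<Prod>i\<in>UNIV. \<integral>x. f i x \<partial>lborel)"
proof -
  interpret P: product_sigma_finite "\<lambda>b::real^'d. lborel :: real measure" ..
  let ?T = "\<lambda>g. \<Sum>b\<in>Basis. g b *\<^sub>R b :: real^'d"
  define k where "k b = (SOME i. b = axis i (1::real))" for b :: "real^'d"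
  have k: "k (axis i 1) = i" for i
    by (auto simp: k_def axis_eq_axis intro!: some_equality)
  have Basis: "Basis = range (\<lambda>i. axis i (1::real) :: real^'d)"
    by (auto simp: Basis_vec_def)
  have inj: "inj (\<lambda>i. axis i (1::real) :: real^'d)"
    by (auto simp: inj_def axis_eq_axis)
  have comp: "?T g $ i = g (axis i 1)" for g i
  proof -
    have "?T g $ i = (\<Sum>b\<in>Basis. g b * b $ i)" by simp
    also have "\<dots> = (\<Sum>j\<in>UNIV. g (axis j 1) * (axis j 1 :: real^'d) $ i)"
      unfolding Basis by (subst sum.reindex[OF inj]) simp
    also have "\<dots> = (\<Sum>j\<in>UNIV. if j = i then g (axis i 1) else 0)"
    proof (rule sum.cong[OF refl])
      fix j
      have "(axis j 1 :: real^'d) $ i = (if j = i then 1 else 0)" by (simp add: axis_def)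
      then show "g (axis j 1) * (axis j 1 :: real^'d) $ i = (if j = i then g (axis i 1) else 0)" by auto
    qed
    finally show ?thesis by simp
  qed
  have eq: "(\<Prod>i\<in>UNIV. f i (?T g $ i)) = (\<Prod>b\<in>Basis. f (k b) (g b))" for g
    unfolding comp unfolding Basis by (subst prod.reindex[OF inj]) (simp add: k)
  have [measurable]: "f i \<in> borel_measurable borel" for i using f[of i] by auto
  have m: "(\<lambda>x::real^'d. \<Prod>i\<in>UNIV. f i (x $ i)) \<in> borel_measurable borel"
    by measurable
  have T: "?T \<in> (\<Pi>\<^sub>M b\<in>Basis. lborel) \<rightarrow>\<^sub>M borel" by measurable
  have "integrable (\<Pi>\<^sub>M b\<in>Basis. lborel) (\<lambda>g. \<Prod>b\<in>Basis. f (k b) (g b))"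
    by (intro P.product_integrable_prod f) auto
  then show "integrable lborel (\<lambda>x::real^'d. \<Prod>i\<in>UNIV. f i (x $ i))"
    by (subst lborel_eq, subst integrable_distr_eq[OF T m]) (simp only: eq)
  have "(\<integral>x. (\<Prod>i\<in>UNIV. f i (x $ i)) \<partial>(lborel :: (real^'d) measure)) =
      (\<integral>g. (\<Prod>b\<in>Basis. f (k b) (g b)) \<partial>(\<Pi>\<^sub>M b\<in>Basis. lborel))"
    by (subst lborel_eq, subst integral_distr[OF T m]) (simp only: eq)
  also have "\<dots> = (\<Prod>b\<in>(Basis::(real^'d) set). \<integral>x. f (k b) x \<partial>lborel)"
    by (intro P.product_integral_prod f) auto
  also have "\<dots> = (\<Prod>i\<in>UNIV. \<integral>x. f i x \<partial>lborel)"
    unfolding Basis by (subst prod.reindex[OF inj]) (simp add: k)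
  finally show "(\<integral>x. (\<Prod>i\<in>UNIV. f i (x $ i)) \<partial>(lborel :: (real^'d) measure)) = (\<Prod>i\<in>UNIV. \<integral>x. f i x \<partial>lborel)" .
qed

section \<open>An integrable comparison weight\<close>

text \<open>Up to the factor pi^d this is the density of independent Cauchy variables. It changes by
  a bounded factor under unit shifts, which an exponential weight with a power above one would not
  do.\<close>

definition cauchy_weight :: "real ^ 'd::finite \<Rightarrow> real" where
  "cauchy_weight x = (\<Prod>i\<in>UNIV. inverse (1 + (x $ i)\<^sup>2))"

lemma cauchy_weight_pos: "cauchy_weight x > 0"
  unfolding cauchy_weight_def by (intro prod_pos) (auto intro: add_pos_nonneg)

lemma integrable_cauchy_weight: "integrable lborel cauchy_weight"
proof -
  have "integrable lborel (\<lambda>x::real. inverse (1 + x\<^sup>2))"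
    using integrable_inverse_1_plus_square by (simp add: set_integrable_def)
  from lborel_integrable_prod_cart[OF this] show ?thesis
    by (simp add: cauchy_weight_def[abs_def])
qed

lemma cauchy_weight_shift:
  assumes "\<bar>s\<bar> \<le> 1"
  shows "cauchy_weight (y + s *\<^sub>R axis i 1) \<le> 3 * cauchy_weight y"
proof -
  have "inverse (1 + (y $ i + s)\<^sup>2) \<le> 3 * inverse (1 + (y $ i)\<^sup>2)"
  proof -
    have "s\<^sup>2 \<le> 1" using assms by (simp add: abs_square_le_1)
    \<comment> \<open>The first square is 2 (y $ i + s)^2 + 2 s^2 - (y $ i)^2 in disguise.\<close>
    moreover have "0 \<le> (y $ i + 2 * s)\<^sup>2" "0 \<le> (y $ i + s)\<^sup>2" by auto
    ultimately have "1 + (y $ i)\<^sup>2 \<le> 3 * (1 + (y $ i + s)\<^sup>2)"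
      by (simp add: power2_eq_square algebra_simps)
    moreover have "1 + (y $ i + s)\<^sup>2 > 0" "1 + (y $ i)\<^sup>2 > 0" by (auto intro: add_pos_nonneg)
    ultimately show ?thesis by (simp add: field_simps)
  qed
  moreover have "cauchy_weight (y + s *\<^sub>R axis i 1) = inverse (1 + (y $ i + s)\<^sup>2) * (\<Prod>j\<in>UNIV - {i}. inverse (1 + (y $ j)\<^sup>2))"
    unfolding cauchy_weight_def by (subst prod.remove[of _ i]) (auto intro!: prod.cong simp: axis_def)
  moreover have "cauchy_weight y = inverse (1 + (y $ i)\<^sup>2) * (\<Prod>j\<in>UNIV - {i}. inverse (1 + (y $ j)\<^sup>2))"
    unfolding cauchy_weight_def by (subst prod.remove[of _ i]) auto
  moreover have "0 \<le> (\<Prod>j\<in>UNIV - {i}. inverse (1 + (y $ j)\<^sup>2))" by (intro prod_nonneg) auto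
  ultimately show ?thesis by (simp only: mult.assoc[symmetric] mult_right_mono)
qed

lemma integrable_cauchy_bound:
  fixes f :: "real ^ 'd::finite \<Rightarrow> 'b::{banach, second_countable_topology}"
  assumes "f \<in> borel_measurable borel" "\<And>y. norm (f y) \<le> C * cauchy_weight y"
  shows "integrable lborel f"
  by (rule Bochner_Integration.integrable_bound[OF integrable_mult_right[OF integrable_cauchy_weight, of C]])
    (use assms order_trans[OF assms(2) abs_ge_self] in auto)

text \<open>1 / p is the rate of \<open>power_le_fact_powr_exp\<close> for h = 1, at which any power
  of the norm is absorbed. The comparison weights \<open>w\<close> below all use this rate.\<close>

lemma exp_decay_le_cauchy_weight:
  fixes p :: real
  assumes "p > 0"
  obtains C where "C > 0"
    "\<And>y::real^'d::finite. norm y ^ k * exp (- (1 / p * norm y powr p)) \<le> C * cauchy_weight y"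
proof -
  \<comment> \<open>Two powers per coordinate for the reciprocal of the weight, besides the moment
    of order \<open>k\<close>.\<close>
  define N where "N = k + 2 * CARD('d)"
  define C where "C = 2 ^ N * (1 + fact N powr (1 / p))"
  show ?thesis
  proof (rule that)
    show "C > 0" by (auto simp: C_def intro!: mult_pos_pos add_pos_nonneg)
    fix y :: "real^'d"
    let ?E = "exp (1 / p * norm y powr p)"
    have E: "?E \<ge> 1" using assms by simp
    have "inverse (cauchy_weight y) = (\<Prod>i\<in>UNIV. 1 + (y $ i)\<^sup>2)"
      unfolding cauchy_weight_def by (simp add: prod_inversef[symmetric])
    also have "\<dots> \<le> (\<Prod>i\<in>(UNIV::'d set). (1 + norm y)\<^sup>2)"
    proof (intro prod_mono conjI)
      fix i
      have "(y $ i)\<^sup>2 \<le> (norm y)\<^sup>2"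
        using power_mono[OF component_le_norm_cart[of y i], of 2] by simp
      then show "1 + (y $ i)\<^sup>2 \<le> (1 + norm y)\<^sup>2" 
      proof -
        have "(1 + norm y)\<^sup>2 = 1 + (norm y)\<^sup>2 + 2 * norm y" by (simp add: power2_sum)
        then show ?thesis using \<open>(y $ i)\<^sup>2 \<le> (norm y)\<^sup>2\<close> norm_ge_zero[of y] by linarith
      qed
    qed auto
    also have "\<dots> = (1 + norm y) ^ (2 * CARD('d))" by (simp add: power_mult)
    finally have 1: "inverse (cauchy_weight y) \<le> (1 + norm y) ^ (2 * CARD('d))" .
    have "norm y ^ k * inverse (cauchy_weight y) \<le> (1 + norm y) ^ k * (1 + norm y) ^ (2 * CARD('d))"
      by (intro mult_mono 1 power_mono) (auto simp: less_imp_le[OF cauchy_weight_pos])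
    also have "\<dots> = (1 + norm y) ^ N" by (simp add: N_def power_add)
    also have "\<dots> \<le> (2 * max 1 (norm y)) ^ N" by (intro power_mono) auto
    also have "\<dots> \<le> 2 ^ N * (1 + norm y ^ N)"
      by (auto simp: power_mult_distrib max_def)
    also have "norm y ^ N \<le> fact N powr (1 / p) * ?E"
      using power_le_fact_powr_exp[of "norm y" 1 "1 / p" N] assms by simp
    also have "2 ^ N * (1 + fact N powr (1 / p) * ?E) \<le> C * ?E"
      using E by (simp add: C_def algebra_simps)
    finally show "norm y ^ k * exp (- (1 / p * norm y powr p)) \<le> C * cauchy_weight y"
      using cauchy_weight_pos[of y] by (simp add: exp_minus field_simps)
  qed
qed

text \<open>By translation invariance every difference quotient has integral zero, and dominated
  convergence passes to the derivative. The mean value inequality bounds the quotients; steps of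
  length at most one keep the weight comparable.\<close>

lemma integral_partial_deriv_eq_0:
  fixes G :: "real ^ 'd::finite \<Rightarrow> complex"
  assumes G: "\<And>y. G differentiable (at y)"
    and G': "continuous_on UNIV (partial_deriv i G)"
    and bound: "\<And>y. cmod (G y) \<le> C * cauchy_weight y" "\<And>y. cmod (partial_deriv i G y) \<le> C * cauchy_weight y"
  shows "(\<integral>y. partial_deriv i G y \<partial>lborel) = 0"
proof -
  define h where "h n = 1 / real (Suc n)" for n
  have h: "h n > 0" "h n \<le> 1" for n by (auto simp: h_def)
  define q where "q n y = (1 / h n) *\<^sub>R (G (y + h n *\<^sub>R axis i 1) - G y)" for n y
  have contG: "continuous_on UNIV G"
    by (simp add: G continuous_at_imp_continuous_on differentiable_imp_continuous_within)
  have mG: "G \<in> borel_measurable borel" using contG by (rule borel_measurable_continuous_onI)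
  have mG': "partial_deriv i G \<in> borel_measurable borel" using G' by (rule borel_measurable_continuous_onI)
  have intG: "integrable lborel G" by (rule integrable_cauchy_bound[OF mG bound(1)])
  have q0: "(\<integral>y. q n y \<partial>lborel) = 0" for n
    unfolding q_def using intG mG
    by (simp add: lborel_integral_translate lborel_integrable_translate)
  have "(\<lambda>n. \<integral>y. q n y \<partial>lborel) \<longlonglongrightarrow> (\<integral>y. partial_deriv i G y \<partial>lborel)"
  proof (rule integral_dominated_convergence[where w = "\<lambda>y. (3 * C) * cauchy_weight y"])
    show "integrable lborel (\<lambda>y::real^'d. (3 * C) * cauchy_weight y)"
      by (intro integrable_mult_right integrable_cauchy_weight)
    show "q n \<in> borel_measurable lborel" for n
      unfolding q_def[abs_def] by (intro borel_measurable_integrable integrable_scaleR_right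
          Bochner_Integration.integrable_diff lborel_integrable_translate intG)
    show "AE y in lborel. (\<lambda>n. q n y) \<longlonglongrightarrow> partial_deriv i G y"
    proof (rule AE_I2)
      fix y
      have *: "((\<lambda>s. G (y + s *\<^sub>R axis i 1)) has_vector_derivative partial_deriv i G y) (at 0)"
        using has_vector_derivative_along_axis[OF G, of y i 0 UNIV] by simp
      have "((\<lambda>s. (1 / s) *\<^sub>R (G (y + s *\<^sub>R axis i 1) - G y)) \<longlongrightarrow> partial_deriv i G y) (at 0)"
      proof -
        have "((\<lambda>s. norm (G (y + s *\<^sub>R axis i 1) - G y - s *\<^sub>R partial_deriv i G y) / norm s) \<longlongrightarrow> 0) (at 0)"
          using * unfolding has_vector_derivative_def has_derivative_at by simp
        moreover have "norm (G (y + s *\<^sub>R axis i 1) - G y - s *\<^sub>R partial_deriv i G y) / norm s =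
            norm ((1 / s) *\<^sub>R (G (y + s *\<^sub>R axis i 1) - G y) - partial_deriv i G y)" if "s \<noteq> 0" for s
        proof -
          have "(1 / s) *\<^sub>R (G (y + s *\<^sub>R axis i 1) - G y) - partial_deriv i G y =
            (1 / s) *\<^sub>R (G (y + s *\<^sub>R axis i 1) - G y - s *\<^sub>R partial_deriv i G y)"
            using that by (simp add: scaleR_diff_right)
          then show ?thesis by (simp only: norm_scaleR) (simp add: divide_inverse mult.commute)
        qed
        ultimately have "((\<lambda>s. norm ((1 / s) *\<^sub>R (G (y + s *\<^sub>R axis i 1) - G y) - partial_deriv i G y)) \<longlongrightarrow> 0) (at 0)"
          by (elim Lim_transform_eventually) (simp add: eventually_at_filter)
        then have "((\<lambda>s. (1 / s) *\<^sub>R (G (y + s *\<^sub>R axis i 1) - G y) - partial_deriv i G y) \<longlongrightarrow> 0) (at 0)"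
          by (rule tendsto_norm_zero_cancel)
        then show ?thesis by (rule LIM_zero_cancel)
      qed
      moreover have "filterlim h (at 0) sequentially"
      proof -
        have "h \<longlonglongrightarrow> 0" unfolding h_def by (rule LIMSEQ_inverse_real_of_nat[unfolded inverse_eq_divide])
        then show ?thesis using h(1) by (auto simp: filterlim_at intro!: always_eventually) (metis less_irrefl)
      qed
      ultimately show "(\<lambda>n. q n y) \<longlonglongrightarrow> partial_deriv i G y"
        unfolding q_def by (rule filterlim_compose)
    qed
    show "AE y in lborel. norm (q n y) \<le> (3 * C) * cauchy_weight y" for n
    proof (rule AE_I2)
      fix y
      have C0: "0 \<le> C * cauchy_weight z" for z :: "real^'d"
        using order_trans[OF norm_ge_zero bound(1)[of z]] .
      have "C \<ge> 0"
      proof -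
        have "\<not> C < 0" using mult_neg_pos[OF _ cauchy_weight_pos[of y], of C] C0[of y] by (auto simp only: not_le[symmetric])
        then show ?thesis by simp
      qed
      have *: "norm (partial_deriv i G (y + s *\<^sub>R axis i 1)) \<le> (3 * C) * cauchy_weight y"
        if "s \<in> {0..h n}" for s
      proof -
        have "norm (partial_deriv i G (y + s *\<^sub>R axis i 1)) \<le> C * cauchy_weight (y + s *\<^sub>R axis i 1)"
          by (rule bound)
        also have "\<dots> \<le> C * (3 * cauchy_weight y)"
          using that h[of n] \<open>C \<ge> 0\<close> by (intro mult_left_mono cauchy_weight_shift) auto
        finally show ?thesis by simp
      qed
      have "norm (G (y + h n *\<^sub>R axis i 1) - G (y + 0 *\<^sub>R axis i 1)) \<le> (3 * C) * cauchy_weight y * norm (h n - 0)"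
      proof (rule differentiable_bound[where S = "{0..h n}" and f = "\<lambda>s. G (y + s *\<^sub>R axis i 1)"
          and f' = "\<lambda>s t. t *\<^sub>R partial_deriv i G (y + s *\<^sub>R axis i 1)"])
        show "onorm (\<lambda>t. t *\<^sub>R partial_deriv i G (y + s *\<^sub>R axis i 1)) \<le> (3 * C) * cauchy_weight y"
          if "s \<in> {0..h n}" for s
          using *[OF that] \<open>C \<ge> 0\<close> cauchy_weight_pos[of y]
          by (intro onorm_bound) (auto simp: mult.commute intro!: mult_left_mono)
        show "((\<lambda>s. G (y + s *\<^sub>R axis i 1)) has_derivative (\<lambda>t. t *\<^sub>R partial_deriv i G (y + s *\<^sub>R axis i 1))) (at s within {0..h n})" for s
          using has_vector_derivative_along_axis[OF G] unfolding has_vector_derivative_def .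
      qed (use h[of n] in auto)
      moreover have "norm (q n y) = norm (G (y + h n *\<^sub>R axis i 1) - G y) / h n"
        using h[of n] by (simp add: q_def del: scaleR_diff_right)
      ultimately show "norm (q n y) \<le> (3 * C) * cauchy_weight y"
        using h[of n] by (simp add: divide_le_eq)
    qed
  qed (use mG' in simp)
  then show ?thesis unfolding q0 using LIMSEQ_unique tendsto_const by blast
qed

section \<open>Fourier integrals and integration by parts\<close>

definition fourier_integral :: "(real ^ 'd::finite \<Rightarrow> complex) \<Rightarrow> real ^ 'd \<Rightarrow> complex" where
  "fourier_integral f \<xi> = (\<integral>y. f y * character (- \<xi>) y \<partial>lborel)"

lemma fourier_integral_partials:
  fixes G :: "real ^ 'd::finite \<Rightarrow> complex"
  assumes "smooth_fun G" and bound: "\<And>js. \<exists>C. \<forall>y. cmod (partials js G y) \<le> C * cauchy_weight y"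
  shows "fourier_integral (partials is G) \<xi> = \<i> ^ length is * mi_pow \<xi> (count_list is) * fourier_integral G \<xi>"
proof (induction "is")
  case (Cons i "is")
  define H where "H = partials is G"
  let ?e = "character (- \<xi>)"
  have H: "smooth_fun H" unfolding H_def by (intro smooth_fun_partials assms)
  obtain C0 where C0: "\<And>y. cmod (H y) \<le> C0 * cauchy_weight y" using bound[of "is"] by (auto simp: H_def)
  obtain C1 where C1: "\<And>y. cmod (partial_deriv i H y) \<le> C1 * cauchy_weight y"
    using bound[of "i # is"] by (auto simp: H_def)
  have e: "partial_deriv i ?e y = - \<i> * \<xi> $ i * ?e y" for y
    using partial_deriv_character[of i 1 "- \<xi>"] by (simp add: fun_eq_iff)
  have sm: "smooth_fun (\<lambda>y. H y * ?e y)" by (intro smooth_fun_mult H smooth_fun_character)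
  have D: "partial_deriv i (\<lambda>y. H y * ?e y) y = partial_deriv i H y * ?e y - \<i> * \<xi> $ i * (H y * ?e y)" for y
    by (subst partial_deriv_mult) (auto simp: e intro!: smooth_fun_differentiable H smooth_fun_character)
  \<comment> \<open>Dominates the product \<open>H y * ?e y\<close> and its partial derivative at
    once; the derivative of the character contributes the factor \<open>\<xi> $ i\<close>.\<close>
  define C where "C = C0 + C1 + \<bar>\<xi> $ i\<bar> * C0"
  have nn: "0 \<le> C0 * cauchy_weight y" "0 \<le> C1 * cauchy_weight y" for y :: "real^'d"
    using order_trans[OF norm_ge_zero C0[of y]] order_trans[OF norm_ge_zero C1[of y]] .
  have int0: "integrable lborel (\<lambda>y. H y * ?e y)"
    by (rule integrable_cauchy_bound[where C = C0], rule borel_measurable_continuous_onI, rule smooth_fun_continuous[OF sm])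
      (use C0 in \<open>simp add: norm_mult\<close>)
  have int1: "integrable lborel (\<lambda>y. partial_deriv i H y * ?e y)"
    by (rule integrable_cauchy_bound[where C = C1], rule borel_measurable_continuous_onI, rule smooth_fun_continuous)
      (use C1 H in \<open>auto simp add: norm_mult intro!: smooth_fun_mult smooth_fun_partial_deriv smooth_fun_character\<close>)
  have "(\<integral>y. partial_deriv i (\<lambda>y. H y * ?e y) y \<partial>lborel) = 0"
  proof (rule integral_partial_deriv_eq_0)
    show "cmod (H y * ?e y) \<le> C * cauchy_weight y" for y
    proof -
      have "cmod (H y * ?e y) \<le> C0 * cauchy_weight y" using C0[of y] by (simp add: norm_mult)
      also have "\<dots> \<le> C * cauchy_weight y"
        using nn[of y] mult_nonneg_nonneg[OF abs_ge_zero[of "\<xi> $ i"] nn(1)[of y]] by (simp add: C_def algebra_simps)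
      finally show ?thesis .
    qed
    show "cmod (partial_deriv i (\<lambda>y. H y * ?e y) y) \<le> C * cauchy_weight y" for y
    proof -
      have "cmod (partial_deriv i (\<lambda>y. H y * ?e y) y) \<le> cmod (partial_deriv i H y * ?e y) + cmod (\<i> * \<xi> $ i * (H y * ?e y))"
        unfolding D by (rule norm_triangle_ineq4)
      also have "\<dots> = cmod (partial_deriv i H y) + \<bar>\<xi> $ i\<bar> * cmod (H y)" by (simp add: norm_mult)
      also have "\<dots> \<le> C1 * cauchy_weight y + \<bar>\<xi> $ i\<bar> * (C0 * cauchy_weight y)"
        by (intro add_mono C1 mult_left_mono C0) auto
      also have "\<dots> \<le> C * cauchy_weight y" using nn[of y] by (simp add: C_def algebra_simps)
      finally show ?thesis .
    qed
  qed (use sm in \<open>auto intro: smooth_fun_differentiable smooth_fun_continuous smooth_fun_partial_deriv\<close>)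
  then have "(\<integral>y. partial_deriv i H y * ?e y \<partial>lborel) = (\<integral>y. \<i> * \<xi> $ i * (H y * ?e y) \<partial>lborel)"
    unfolding D using int0 int1 by simp
  then have "fourier_integral (partial_deriv i H) \<xi> = \<i> * \<xi> $ i * fourier_integral H \<xi>"
    unfolding fourier_integral_def by simp
  moreover have "mi_pow \<xi> (count_list (i # is)) = \<xi> $ i * mi_pow \<xi> (count_list is)"
    by (simp only: mi_pow_count_list list.map prod_list.Cons)
  ultimately show ?case using Cons.IH by (simp add: H_def[symmetric] mult_ac del: count_list.simps)
qed (simp add: mi_pow_def)


section \<open>Fourier inversion\<close>

lemma norm_lebesgue_integral_le:
  fixes f :: "'a \<Rightarrow> 'b::{banach, second_countable_topology}"
  assumes "integrable M f" "integrable M g" "\<And>x. norm (f x) \<le> g x"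
  shows "norm (\<integral>x. f x \<partial>M) \<le> (\<integral>x. g x \<partial>M)"
  using integral_norm_bound[of M f] integral_mono[OF integrable_norm[OF assms(1)] assms(2,3)]
  by (rule order_trans)

lemma char_std_normal_density:
  "(\<integral>x. complex_of_real (std_normal_density x) * iexp (a * x) \<partial>lborel) = complex_of_real (exp (- a\<^sup>2 / 2))"
proof -
  have "complex_of_real (exp (- a\<^sup>2 / 2)) = char std_normal_distribution a"
    by (simp add: char_std_normal_distribution)
  also have "\<dots> = (\<integral>x. std_normal_density x *\<^sub>R iexp (a * x) \<partial>lborel)"
    unfolding char_def by (subst integral_density) auto
  finally show ?thesis by (simp add: scaleR_conv_of_real)
qed

section \<open>The Gaussian and its transform\<close>

definition gauss_density :: "real ^ 'd::finite \<Rightarrow> real" where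
  "gauss_density x = (1 / sqrt (2 * pi)) ^ CARD('d) * exp (- (norm x)\<^sup>2 / 2)"

lemma norm_power2_vec: "(norm x)\<^sup>2 = (\<Sum>i\<in>UNIV. (x $ i)\<^sup>2)" for x :: "real ^ 'd::finite"
  unfolding power2_norm_eq_inner inner_vec_def by (simp add: power2_eq_square)

lemma gauss_density_eq_prod: "gauss_density x = (\<Prod>i\<in>UNIV. std_normal_density (x $ i))" for x :: "real ^ 'a::finite"
proof -
  have "(\<Prod>i\<in>UNIV. std_normal_density (x $ i)) = (\<Prod>i\<in>(UNIV::'a set). 1 / sqrt (2 * pi)) * (\<Prod>i\<in>UNIV. exp (- (x $ i)\<^sup>2 / 2))"
    by (simp only: std_normal_density_def prod.distrib)
  also have "(\<Prod>i\<in>UNIV. exp (- (x $ i)\<^sup>2 / 2)) = exp (- (norm x)\<^sup>2 / 2)"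
    by (simp add: norm_power2_vec exp_sum[symmetric] sum_negf sum_divide_distrib)
  finally show ?thesis by (simp add: gauss_density_def)
qed

lemma character_eq_prod: "character \<xi> x = (\<Prod>i\<in>UNIV. iexp (\<xi> $ i * x $ i))"
  by (simp add: character_def inner_vec_def exp_sum[symmetric] sum_distrib_left mult_ac)

lemma gauss_density_nonneg: "gauss_density x \<ge> 0"
  by (simp add: gauss_density_def)

lemma continuous_on_gauss_density: "continuous_on A gauss_density"
  unfolding gauss_density_def[abs_def] by (intro continuous_intros) auto

lemma measurable_gauss_density [measurable]: "gauss_density \<in> borel_measurable borel"
  by (intro borel_measurable_continuous_onI continuous_on_gauss_density)

lemma continuous_on_character: "continuous_on A (character \<xi>)"
  unfolding character_def[abs_def] by (intro continuous_intros)

lemma measurable_character [measurable]: "character \<xi> \<in> borel_measurable borel"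
  by (intro borel_measurable_continuous_onI continuous_on_character)

lemma measurable_character2 [measurable]:
  "f \<in> borel_measurable M \<Longrightarrow> g \<in> borel_measurable M \<Longrightarrow> (\<lambda>x. character (f x) (g x)) \<in> borel_measurable M"
  unfolding character_def by measurable

lemma integrable_gauss_density: "integrable lborel (gauss_density :: real ^ 'd::finite \<Rightarrow> real)"
  unfolding gauss_density_eq_prod[abs_def] by (rule lborel_integrable_prod_cart) auto

lemma integral_gauss_density: "(\<integral>x. gauss_density x \<partial>(lborel :: (real ^ 'd::finite) measure)) = 1"
  unfolding gauss_density_eq_prod by (subst lborel_integral_prod_cart) auto

lemma integral_gauss_character:
  "(\<integral>x. complex_of_real (gauss_density x) * character \<xi> x \<partial>lborel) = complex_of_real (exp (- (norm \<xi>)\<^sup>2 / 2))"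
proof -
  have int: "integrable lborel (\<lambda>x. complex_of_real (std_normal_density x) * iexp (a * x))" for a
    by (rule Bochner_Integration.integrable_bound[where f = std_normal_density])
      (auto simp: norm_mult)
  have "(\<integral>x. complex_of_real (gauss_density x) * character \<xi> x \<partial>lborel) =
      (\<integral>x. (\<Prod>i\<in>UNIV. complex_of_real (std_normal_density (x $ i)) * iexp (\<xi> $ i * x $ i)) \<partial>lborel)"
    by (simp add: gauss_density_eq_prod character_eq_prod prod.distrib)
  also have "\<dots> = (\<Prod>i\<in>UNIV. complex_of_real (exp (- (\<xi> $ i)\<^sup>2 / 2)))"
    by (subst lborel_integral_prod_cart[OF int]) (simp only: char_std_normal_density)
  also have "\<dots> = complex_of_real (exp (- (norm \<xi>)\<^sup>2 / 2))"
    by (simp add: norm_power2_vec exp_sum[symmetric] sum_negf sum_divide_distrib flip: of_real_prod)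
  finally show ?thesis .
qed

text \<open>The transform of a Gaussian cutoff at scale 1 / \<epsilon> is (2 pi)^d times the
  Gaussian approximate identity at scale \<epsilon>. The powers of 2 pi come from removing the
  normalisation of the Gaussian before the transform and restoring it afterwards.\<close>

lemma integral_gauss_scaled_character:
  fixes v :: "real ^ 'd::finite"
  assumes "\<epsilon> > 0"
  shows "(\<integral>\<xi>. complex_of_real (exp (- (norm (\<epsilon> *\<^sub>R \<xi>))\<^sup>2 / 2)) * character v \<xi> \<partial>lborel) =
    complex_of_real ((2 * pi) ^ CARD('d) * (gauss_density (v /\<^sub>R \<epsilon>) / \<epsilon> ^ CARD('d)))"
proof -
  define K where "K = (1 / sqrt (2 * pi)) ^ CARD('d)"
  have K: "K > 0" "K\<^sup>2 * (2 * pi) ^ CARD('d) = 1"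
    unfolding K_def by (simp_all add: power_mult[symmetric] mult.commute[of _ 2] power_divide power_mult)
  have e: "complex_of_real (exp (- (norm x)\<^sup>2 / 2)) = complex_of_real (gauss_density x) / K" for x :: "real ^ 'd"
    using K by (simp add: gauss_density_def K_def)
  let ?f = "\<lambda>\<xi>. complex_of_real (exp (- (norm (\<epsilon> *\<^sub>R \<xi>))\<^sup>2 / 2)) * character v \<xi>"
  have [measurable]: "?f \<in> borel_measurable borel" by measurable
  have ch: "character v (x /\<^sub>R \<epsilon>) = character (v /\<^sub>R \<epsilon>) x" for x
    by (simp add: character_def)
  have "(\<integral>\<xi>. ?f \<xi> \<partial>lborel) = \<bar>1 / \<epsilon>\<bar> ^ DIM(real ^ 'd) *\<^sub>R (\<integral>x. ?f (0 + (1 / \<epsilon>) *\<^sub>R x) \<partial>lborel)"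
    using assms by (intro lborel_integral_affine_euclidean) auto
  also have "(\<lambda>x. ?f (0 + (1 / \<epsilon>) *\<^sub>R x)) = (\<lambda>x. complex_of_real (gauss_density x) * character (v /\<^sub>R \<epsilon>) x / K)"
  proof
    fix x :: "real ^ 'd"
    have "\<epsilon> *\<^sub>R (0 + (1 / \<epsilon>) *\<^sub>R x) = x" "0 + (1 / \<epsilon>) *\<^sub>R x = x /\<^sub>R \<epsilon>"
      using assms by (simp_all add: divide_inverse)
    then show "?f (0 + (1 / \<epsilon>) *\<^sub>R x) = complex_of_real (gauss_density x) * character (v /\<^sub>R \<epsilon>) x / K"
      by (simp only: e ch) simp
  qed
  also have "(\<integral>x. complex_of_real (gauss_density x) * character (v /\<^sub>R \<epsilon>) x / K \<partial>lborel) =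
      complex_of_real (exp (- (norm (v /\<^sub>R \<epsilon>))\<^sup>2 / 2)) / K"
    by (simp add: integral_gauss_character)
  also have "\<dots> = complex_of_real (gauss_density (v /\<^sub>R \<epsilon>)) / K\<^sup>2"
    unfolding e by (simp add: power2_eq_square)
  also have "1 / K\<^sup>2 = (2 * pi) ^ CARD('d)"
    using K by (simp add: field_simps)
  then have "complex_of_real (gauss_density (v /\<^sub>R \<epsilon>)) / K\<^sup>2 = complex_of_real ((2 * pi) ^ CARD('d) * gauss_density (v /\<^sub>R \<epsilon>))"
    by (metis divide_inverse mult.commute mult_1 of_real_divide of_real_power)
  finally show ?thesis
    using assms by (simp add: scaleR_conv_of_real power_divide)
qed

text \<open>exp (- a) is at most n! / a^n, which for n the dimension is of order \<epsilon>^(2 n).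
  Half of this cancels the normalisation, and the other half still tends to zero.\<close>

lemma gauss_density_far:
  fixes v :: "real ^ 'd::finite"
  assumes "\<epsilon> > 0" "\<delta> > 0" "norm v \<ge> \<delta>"
  shows "gauss_density (v /\<^sub>R \<epsilon>) / \<epsilon> ^ CARD('d) \<le> (1 / sqrt (2 * pi)) ^ CARD('d) * fact CARD('d) * (2 / \<delta>\<^sup>2) ^ CARD('d) * \<epsilon> ^ CARD('d)"
proof -
  let ?n = "CARD('d)"
  define a where "a = (norm (v /\<^sub>R \<epsilon>))\<^sup>2 / 2"
  have "(\<delta> / \<epsilon>)\<^sup>2 \<le> (norm (v /\<^sub>R \<epsilon>))\<^sup>2"
    using assms by (intro power_mono) (auto simp: divide_inverse mult.commute)
  then have a: "\<delta>\<^sup>2 / (2 * \<epsilon>\<^sup>2) \<le> a" by (simp add: a_def power_divide field_simps)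
  have "(\<delta>\<^sup>2 / (2 * \<epsilon>\<^sup>2)) ^ ?n \<le> a ^ ?n" using a assms by (intro power_mono) auto
  also have "\<dots> \<le> fact ?n * exp a" by (intro power_le_fact_exp) (simp add: a_def)
  finally have "exp (- a) \<le> fact ?n * (2 * \<epsilon>\<^sup>2 / \<delta>\<^sup>2) ^ ?n"
    using assms by (simp add: exp_minus field_simps)
  then have "gauss_density (v /\<^sub>R \<epsilon>) \<le> (1 / sqrt (2 * pi)) ^ ?n * (fact ?n * (2 * \<epsilon>\<^sup>2 / \<delta>\<^sup>2) ^ ?n)"
    unfolding gauss_density_def a_def minus_divide_left by (intro mult_left_mono) auto
  also have "\<dots> = ((1 / sqrt (2 * pi)) ^ ?n * fact ?n * (2 / \<delta>\<^sup>2) ^ ?n * \<epsilon> ^ ?n) * \<epsilon> ^ ?n"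
    by (simp add: power_mult_distrib power_divide power2_eq_square)
  finally show ?thesis using assms by (simp add: divide_le_eq)
qed

text \<open>No bound on \<open>h\<close> away from \<open>y\<close> is available when the uniqueness of
  \<^const>\<open>fourier_fun\<close> is derived from this; far from \<open>y\<close> only the decay of the Gaussian is used.\<close>

lemma gauss_convolution_tendsto:
  fixes h :: "real ^ 'd::finite \<Rightarrow> complex"
  assumes h: "integrable lborel h" and cont: "isCont h y"
    and \<epsilon>: "\<And>n. \<epsilon> n > 0" "\<epsilon> \<longlonglongrightarrow> 0"
  shows "(\<lambda>n. \<integral>w. h w * complex_of_real (gauss_density ((y - w) /\<^sub>R \<epsilon> n) / \<epsilon> n ^ CARD('d)) \<partial>lborel) \<longlonglongrightarrow> h y"
proof -
  let ?N = "\<lambda>n w. gauss_density ((y - w) /\<^sub>R \<epsilon> n) / \<epsilon> n ^ CARD('d)"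
  have [measurable]: "h \<in> borel_measurable borel" using h by auto
  obtain \<delta> where "\<delta> > 0" and \<delta>: "\<And>w. dist w y < \<delta> \<Longrightarrow> dist (h w) (h y) < 1"
    using cont unfolding continuous_at_eps_delta by (meson zero_less_one)
  define M where "M = cmod (h y) + 1"
  have M: "cmod (h w) \<le> M" if "w \<in> ball y \<delta>" for w
  proof -
    have "dist (h w) (h y) < 1" using \<delta>[of w] that by (simp add: dist_commute)
    then show ?thesis using norm_triangle_sub[of "h w" "h y"] by (simp add: M_def dist_norm)
  qed
  \<comment> \<open>\<open>h1\<close> is bounded, so dominated convergence applies after rescaling;
    \<open>h2\<close> is merely integrable, but on its support the kernel is uniformly
    small.\<close>
  define h1 where "h1 w = (if w \<in> ball y \<delta> then h w else 0)" for w
  define h2 where "h2 w = (if w \<in> ball y \<delta> then 0 else h w)" for w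
  have [measurable]: "h1 \<in> borel_measurable borel" "h2 \<in> borel_measurable borel"
  proof -
    have "h1 = (\<lambda>w. indicator (ball y \<delta>) w *\<^sub>R h w)" "h2 = (\<lambda>w. indicator (- ball y \<delta>) w *\<^sub>R h w)"
      by (auto simp: h1_def h2_def fun_eq_iff indicator_def)
    then show "h1 \<in> borel_measurable borel" "h2 \<in> borel_measurable borel"
      by (auto intro!: borel_measurable_scaleR borel_measurable_indicator)
  qed
  have h1M: "cmod (h1 w) \<le> M" for w using M by (auto simp: h1_def M_def)
  have cont1: "isCont h1 y"
  proof -
    have "\<forall>\<^sub>F w in nhds y. h1 w = h w"
      using \<open>\<delta> > 0\<close> eventually_nhds_in_open[of "ball y \<delta>" y] by (auto simp: h1_def elim: eventually_mono)
    then show ?thesis using cont isCont_cong by blast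
  qed
  define B where "B = (1 / sqrt (2 * pi)) ^ CARD('d) * fact CARD('d) * (2 / \<delta>\<^sup>2) ^ CARD('d)"
  have B: "B \<ge> 0" by (simp add: B_def)
  have bound2: "cmod (h2 w * ?N n w) \<le> B * \<epsilon> n ^ CARD('d) * cmod (h w)" for n w
  proof (cases "w \<in> ball y \<delta>")
    case False
    then have "?N n w \<le> B * \<epsilon> n ^ CARD('d)"
      unfolding B_def by (intro gauss_density_far \<open>\<delta> > 0\<close> \<epsilon>) (auto simp: dist_norm)
    then have "cmod (h2 w) * ?N n w \<le> cmod (h2 w) * (B * \<epsilon> n ^ CARD('d))"
      by (intro mult_left_mono) auto
    then show ?thesis using \<epsilon>(1)[of n] False
      by (simp add: norm_mult norm_divide norm_power gauss_density_nonneg h2_def mult_ac)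
  qed (use B \<epsilon>(1)[of n] in \<open>simp add: h2_def\<close>)
  have bound1: "cmod (h1 w * ?N n w) \<le> M * \<bar>?N n w\<bar>" for n w
  proof -
    have "cmod (h1 w * ?N n w) = cmod (h1 w) * \<bar>?N n w\<bar>" by (simp only: norm_mult norm_of_real)
    also have "\<dots> \<le> M * \<bar>?N n w\<bar>" by (intro mult_right_mono h1M) auto
    finally show ?thesis .
  qed
  have intN: "integrable lborel (?N n)" for n
  proof -
    have "integrable lborel (\<lambda>w. gauss_density (y /\<^sub>R \<epsilon> n + (- 1 / \<epsilon> n) *\<^sub>R w))"
      using \<epsilon>(1)[of n] by (intro lborel_integrable_affine_euclidean integrable_gauss_density) auto
    also have "(\<lambda>w. gauss_density (y /\<^sub>R \<epsilon> n + (- 1 / \<epsilon> n) *\<^sub>R w)) = (\<lambda>w. gauss_density ((y - w) /\<^sub>R \<epsilon> n))"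
      by (simp add: scaleR_diff_right divide_inverse)
    finally show ?thesis by simp
  qed
  have int1: "integrable lborel (\<lambda>w. h1 w * ?N n w)" for n
  proof (rule Bochner_Integration.integrable_bound)
    show "integrable lborel (\<lambda>w. M * \<bar>?N n w\<bar>)" by (intro integrable_mult_right integrable_abs intN)
    show "(\<lambda>w. h1 w * ?N n w) \<in> borel_measurable lborel" by measurable
  qed (use bound1 order_trans[OF bound1 abs_ge_self] in auto)
  have int2: "integrable lborel (\<lambda>w. h2 w * ?N n w)" for n
  proof (rule Bochner_Integration.integrable_bound)
    show "integrable lborel (\<lambda>w. B * \<epsilon> n ^ CARD('d) * cmod (h w))" using h by auto
    show "(\<lambda>w. h2 w * ?N n w) \<in> borel_measurable lborel" by measurable
  qed (use order_trans[OF bound2 abs_ge_self] in auto)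
  have split: "(\<integral>w. h w * ?N n w \<partial>lborel) = (\<integral>w. h1 w * ?N n w \<partial>lborel) + (\<integral>w. h2 w * ?N n w \<partial>lborel)" for n
    unfolding Bochner_Integration.integral_add[OF int1 int2, symmetric]
    by (rule Bochner_Integration.integral_cong) (auto simp: h1_def h2_def)
  have "(\<lambda>n. \<integral>w. h2 w * ?N n w \<partial>lborel) \<longlonglongrightarrow> 0"
  proof (rule Lim_null_comparison)
    show "\<forall>\<^sub>F n in sequentially. norm (\<integral>w. h2 w * ?N n w \<partial>lborel) \<le> (B * (\<integral>w. cmod (h w) \<partial>lborel)) * \<epsilon> n ^ CARD('d)"
    proof (rule always_eventually, rule allI)
      fix n
      have "norm (\<integral>w. h2 w * ?N n w \<partial>lborel) \<le> (\<integral>w. B * \<epsilon> n ^ CARD('d) * cmod (h w) \<partial>lborel)"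
        by (rule norm_lebesgue_integral_le[OF int2]) (use h bound2 in auto)
      then show "norm (\<integral>w. h2 w * ?N n w \<partial>lborel) \<le> (B * (\<integral>w. cmod (h w) \<partial>lborel)) * \<epsilon> n ^ CARD('d)"
        by (simp add: mult_ac)
    qed
    have "(\<lambda>n. (B * (\<integral>w. cmod (h w) \<partial>lborel)) * \<epsilon> n ^ CARD('d)) \<longlonglongrightarrow> (B * (\<integral>w. cmod (h w) \<partial>lborel)) * 0 ^ CARD('d)"
      by (intro tendsto_intros \<epsilon>)
    moreover have "(0::real) ^ CARD('d) = 0" by (intro zero_power) simp
    ultimately show "(\<lambda>n. (B * (\<integral>w. cmod (h w) \<partial>lborel)) * \<epsilon> n ^ CARD('d)) \<longlonglongrightarrow> 0"
      by (simp only: mult_zero_right)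
  qed
  moreover have "(\<lambda>n. \<integral>w. h1 w * ?N n w \<partial>lborel) \<longlonglongrightarrow> h y"
  proof -
    have eq: "(\<integral>w. h1 w * ?N n w \<partial>lborel) = (\<integral>v. h1 (y + (- \<epsilon> n) *\<^sub>R v) * gauss_density v \<partial>lborel)" for n
    proof -
      have e: "(y - (y + (- \<epsilon> n) *\<^sub>R v)) /\<^sub>R \<epsilon> n = v" for v :: "real ^ 'd" using \<epsilon>(1)[of n] by simp
      have "(\<integral>w. h1 w * ?N n w \<partial>lborel) =
        \<bar>- \<epsilon> n\<bar> ^ DIM(real ^ 'd) *\<^sub>R (\<integral>v. h1 (y + (- \<epsilon> n) *\<^sub>R v) * ?N n (y + (- \<epsilon> n) *\<^sub>R v) \<partial>lborel)"
        using \<epsilon>(1)[of n] by (intro lborel_integral_affine_euclidean) auto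
      also have "\<dots> = (\<integral>v. h1 (y + (- \<epsilon> n) *\<^sub>R v) * gauss_density v \<partial>lborel)"
        unfolding e using \<epsilon>(1)[of n] by (simp add: scaleR_conv_of_real)
      finally show ?thesis .
    qed
    have "(\<lambda>n. \<integral>v. h1 (y + (- \<epsilon> n) *\<^sub>R v) * gauss_density v \<partial>lborel) \<longlonglongrightarrow> (\<integral>v. h y * complex_of_real (gauss_density (v :: real ^ 'd)) \<partial>lborel)"
    proof (rule integral_dominated_convergence[where w = "\<lambda>v. M * gauss_density (v :: real ^ 'd)"])
      show "AE v in lborel. (\<lambda>n. h1 (y + (- \<epsilon> n) *\<^sub>R v) * complex_of_real (gauss_density v)) \<longlonglongrightarrow> h y * complex_of_real (gauss_density v)"
      proof (intro AE_I2 tendsto_mult tendsto_const)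
        fix v :: "real ^ 'd"
        have "(\<lambda>n. y + (- \<epsilon> n) *\<^sub>R v) \<longlonglongrightarrow> y + (- 0) *\<^sub>R v" by (intro tendsto_intros \<epsilon>)
        then have "(\<lambda>n. h1 (y + (- \<epsilon> n) *\<^sub>R v)) \<longlonglongrightarrow> h1 y" by (intro isCont_tendsto_compose[OF cont1]) simp
        then show "(\<lambda>n. h1 (y + (- \<epsilon> n) *\<^sub>R v)) \<longlonglongrightarrow> h y" using \<open>\<delta> > 0\<close> by (simp add: h1_def)
      qed
      show "AE v in lborel. norm (h1 (y + (- \<epsilon> n) *\<^sub>R v) * complex_of_real (gauss_density v)) \<le> M * gauss_density v" for n
        by (auto simp: norm_mult gauss_density_nonneg intro!: mult_right_mono h1M)
    qed (auto intro: integrable_gauss_density)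
    then show ?thesis unfolding eq using integral_gauss_density[where 'd = 'd] by (simp add: integrable_gauss_density)
  qed
  ultimately show ?thesis unfolding split using tendsto_add by fastforce
qed

text \<open>The double integral is not absolutely convergent, so Fubini's theorem does not apply
  directly. A Gaussian factor in \<xi> repairs this and turns the integral into a convolution with
  an approximate identity.\<close>

theorem fourier_inversion:
  fixes h :: "real ^ 'd::finite \<Rightarrow> complex"
  assumes h: "integrable lborel h" and cont: "isCont h y" and h': "integrable lborel (fourier_integral h)"
  shows "(\<integral>\<xi>. fourier_integral h \<xi> * character y \<xi> \<partial>lborel) = (2 * pi) ^ CARD('d) * h y"
proof -
  define \<epsilon> where "\<epsilon> n = 1 / real (Suc n)" for n
  have \<epsilon>: "\<epsilon> n > 0" for n by (simp add: \<epsilon>_def)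
  have \<epsilon>0: "\<epsilon> \<longlonglongrightarrow> 0" unfolding \<epsilon>_def by (rule LIMSEQ_inverse_real_of_nat[unfolded inverse_eq_divide])
  define g where "g n \<xi> = exp (- (norm (\<epsilon> n *\<^sub>R \<xi>))\<^sup>2 / 2)" for n and \<xi> :: "real ^ 'd"
  have g: "0 \<le> g n \<xi>" "g n \<xi> \<le> 1" for n \<xi> by (auto simp: g_def)
  have [measurable]: "h \<in> borel_measurable borel" using h by auto
  have [measurable]: "fourier_integral h \<in> borel_measurable borel" using h' by auto
  have [measurable]: "g n \<in> borel_measurable borel" for n unfolding g_def[abs_def] by measurable
  have intg: "integrable lborel (g n)" for n
  proof -
    have "integrable lborel (\<lambda>\<xi>. sqrt (2 * pi) ^ CARD('d) * gauss_density (0 + \<epsilon> n *\<^sub>R \<xi> :: real ^ 'd))"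
      using \<epsilon>[of n] by (intro integrable_mult_right lborel_integrable_affine_euclidean integrable_gauss_density) auto
    then show ?thesis by (simp add: gauss_density_def g_def[abs_def] power_divide)
  qed
  let ?k = "\<lambda>n (w, \<xi>). h w * character (- \<xi>) w * (character y \<xi> * g n \<xi>)"
  have intk: "integrable (lborel \<Otimes>\<^sub>M lborel) (?k n)" for n
  proof (rule lborel_pair.Fubini_integrable)
    show "?k n \<in> borel_measurable (lborel \<Otimes>\<^sub>M lborel)" by measurable
    have "(\<lambda>w. \<integral>\<xi>. cmod (?k n (w, \<xi>)) \<partial>lborel) = (\<lambda>w. cmod (h w) * (\<integral>\<xi>. g n \<xi> \<partial>lborel))"
      by (simp add: norm_mult g)
    then show "integrable lborel (\<lambda>w. \<integral>\<xi>. cmod (?k n (w, \<xi>)) \<partial>lborel)" using h by simp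
    show "AE w in lborel. integrable lborel (\<lambda>\<xi>. ?k n (w, \<xi>))"
      by (rule AE_I2, rule Bochner_Integration.integrable_bound[OF integrable_mult_right[OF intg[of n]], of _ "cmod (h w)" for w])
        (auto simp: norm_mult g)
  qed
  have swap: "(\<integral>\<xi>. fourier_integral h \<xi> * (character y \<xi> * g n \<xi>) \<partial>lborel) =
      (2 * pi) ^ CARD('d) * (\<integral>w. h w * complex_of_real (gauss_density ((y - w) /\<^sub>R \<epsilon> n) / \<epsilon> n ^ CARD('d)) \<partial>lborel)" for n
  proof -
    have "(\<integral>\<xi>. fourier_integral h \<xi> * (character y \<xi> * g n \<xi>) \<partial>lborel) = (\<integral>\<xi>. (\<integral>w. ?k n (w, \<xi>) \<partial>lborel) \<partial>lborel)"
      unfolding fourier_integral_def by (simp flip: integral_mult_left_zero)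
    also have "\<dots> = (\<integral>w. (\<integral>\<xi>. ?k n (w, \<xi>) \<partial>lborel) \<partial>lborel)"
      using lborel_pair.Fubini_integral[of "\<lambda>w \<xi>. ?k n (w, \<xi>)"] intk[of n] by simp
    also have "\<dots> = (\<integral>w. h w * (\<integral>\<xi>. complex_of_real (g n \<xi>) * character (y - w) \<xi> \<partial>lborel) \<partial>lborel)"
    proof (rule Bochner_Integration.integral_cong[OF refl])
      fix w
      have "(\<integral>\<xi>. ?k n (w, \<xi>) \<partial>lborel) = (\<integral>\<xi>. h w * (complex_of_real (g n \<xi>) * character (y - w) \<xi>) \<partial>lborel)"
        using character_add[of y "- w"] by (simp add: character_commute[of "- _" w] character_minus_right mult_ac)
      then show "(\<integral>\<xi>. ?k n (w, \<xi>) \<partial>lborel) = h w * (\<integral>\<xi>. complex_of_real (g n \<xi>) * character (y - w) \<xi> \<partial>lborel)"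
        by simp
    qed
    also have "\<dots> = (\<integral>w. (2 * pi) ^ CARD('d) * (h w * complex_of_real (gauss_density ((y - w) /\<^sub>R \<epsilon> n) / \<epsilon> n ^ CARD('d))) \<partial>lborel)"
      unfolding g_def integral_gauss_scaled_character[OF \<epsilon>] by (simp add: mult_ac)
    finally show ?thesis by simp
  qed
  have "(\<lambda>n. \<integral>\<xi>. fourier_integral h \<xi> * (character y \<xi> * g n \<xi>) \<partial>lborel) \<longlonglongrightarrow> (\<integral>\<xi>. fourier_integral h \<xi> * character y \<xi> \<partial>lborel)"
  proof (rule integral_dominated_convergence[where w = "\<lambda>\<xi>. cmod (fourier_integral h \<xi>)"])
    show "AE \<xi> in lborel. (\<lambda>n. fourier_integral h \<xi> * (character y \<xi> * g n \<xi>)) \<longlonglongrightarrow> fourier_integral h \<xi> * character y \<xi>"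
    proof (rule AE_I2)
      fix \<xi>
      have "(\<lambda>n. fourier_integral h \<xi> * (character y \<xi> * complex_of_real (exp (- (norm (\<epsilon> n *\<^sub>R \<xi>))\<^sup>2 / 2)))) \<longlonglongrightarrow>
        fourier_integral h \<xi> * (character y \<xi> * complex_of_real (exp (- (norm (0 *\<^sub>R \<xi>))\<^sup>2 / 2)))"
        by (intro tendsto_intros \<epsilon>0) auto
      then show "(\<lambda>n. fourier_integral h \<xi> * (character y \<xi> * g n \<xi>)) \<longlonglongrightarrow> fourier_integral h \<xi> * character y \<xi>"
        by (simp add: g_def)
    qed
    show "AE \<xi> in lborel. norm (fourier_integral h \<xi> * (character y \<xi> * g n \<xi>)) \<le> cmod (fourier_integral h \<xi>)" for n
      using g by (auto simp: norm_mult intro!: mult_left_le)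
  qed (use h' in auto)
  moreover have "(\<lambda>n. \<integral>\<xi>. fourier_integral h \<xi> * (character y \<xi> * g n \<xi>) \<partial>lborel) \<longlonglongrightarrow> (2 * pi) ^ CARD('d) * h y"
    unfolding swap by (intro tendsto_mult tendsto_const gauss_convolution_tendsto h cont \<epsilon> \<epsilon>0)
  ultimately show ?thesis by (rule LIMSEQ_unique)
qed

section \<open>The inverse Fourier transform of rapidly decreasing functions\<close>

text \<open>Just what differentiation under the inverse transform needs, and stable under
  multiplication by coordinates, into which the transform converts a derivative.\<close>

definition rapid :: "(real ^ 'd::finite \<Rightarrow> complex) \<Rightarrow> bool" where
  "rapid \<phi> \<longleftrightarrow> continuous_on UNIV \<phi> \<and> (\<forall>k. \<exists>C. \<forall>\<xi>. norm \<xi> ^ k * cmod (\<phi> \<xi>) \<le> C * cauchy_weight \<xi>)"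

lemma rapid_integrable:
  assumes "rapid \<phi>" "continuous_on UNIV g" "\<And>\<xi>. cmod (g \<xi>) \<le> B * norm \<xi> ^ k"
  shows "integrable lborel (\<lambda>\<xi>. \<phi> \<xi> * g \<xi>)"
proof -
  obtain C where C: "\<And>\<xi>. norm \<xi> ^ k * cmod (\<phi> \<xi>) \<le> C * cauchy_weight \<xi>"
    using assms unfolding rapid_def by blast
  show ?thesis
  proof (rule integrable_cauchy_bound)
    show "(\<lambda>\<xi>. \<phi> \<xi> * g \<xi>) \<in> borel_measurable borel"
      using assms by (intro borel_measurable_continuous_onI continuous_intros) (auto simp: rapid_def)
    fix \<xi>
    have "norm (\<phi> \<xi> * g \<xi>) \<le> cmod (\<phi> \<xi>) * (\<bar>B\<bar> * norm \<xi> ^ k)"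
      unfolding norm_mult by (intro mult_left_mono order_trans[OF assms(3)] mult_right_mono) auto
    also have "\<dots> = \<bar>B\<bar> * (norm \<xi> ^ k * cmod (\<phi> \<xi>))" by simp
    also have "\<dots> \<le> \<bar>B\<bar> * (C * cauchy_weight \<xi>)" by (intro mult_left_mono C) auto
    finally show "norm (\<phi> \<xi> * g \<xi>) \<le> (\<bar>B\<bar> * C) * cauchy_weight \<xi>" by simp
  qed
qed

lemma rapid_mult_coord:
  assumes "rapid \<phi>"
  shows "rapid (\<lambda>\<xi>. \<i> * complex_of_real (\<xi> $ i) * \<phi> \<xi>)"
  unfolding rapid_def
proof (intro conjI allI)
  show "continuous_on UNIV (\<lambda>\<xi>. \<i> * complex_of_real (\<xi> $ i) * \<phi> \<xi>)"
    using assms by (intro continuous_intros) (auto simp: rapid_def)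
  fix k
  obtain C where C: "\<And>\<xi>. norm \<xi> ^ Suc k * cmod (\<phi> \<xi>) \<le> C * cauchy_weight \<xi>"
    using assms unfolding rapid_def by blast
  have "norm \<xi> ^ k * cmod (\<i> * complex_of_real (\<xi> $ i) * \<phi> \<xi>) \<le> C * cauchy_weight \<xi>" for \<xi>
  proof -
    have "norm \<xi> ^ k * cmod (\<i> * complex_of_real (\<xi> $ i) * \<phi> \<xi>) = norm \<xi> ^ k * (\<bar>\<xi> $ i\<bar> * cmod (\<phi> \<xi>))"
      by (simp add: norm_mult)
    also have "\<dots> \<le> norm \<xi> ^ k * (norm \<xi> * cmod (\<phi> \<xi>))"
      by (intro mult_left_mono mult_right_mono component_le_norm_cart) auto
    finally show ?thesis using C[of \<xi>] by (simp add: mult_ac)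
  qed
  then show "\<exists>C. \<forall>\<xi>. norm \<xi> ^ k * cmod (\<i> * complex_of_real (\<xi> $ i) * \<phi> \<xi>) \<le> C * cauchy_weight \<xi>" by blast
qed

lemma cmod_iexp_remainder: "cmod (iexp a - 1 - \<i> * a) \<le> a\<^sup>2"
proof -
  have "cmod (iexp a - 1 - \<i> * a) \<le> a\<^sup>2 / 2"
    using iexp_approx1[of a 1] by (simp add: diff_diff_eq power2_eq_square)
  then show ?thesis using zero_le_power2[of a] by linarith
qed

text \<open>The first-order Taylor remainder of the character is bounded by the square of the
  increment of its phase, so the second moment of \<open>\<phi>\<close> controls the error.\<close>

lemma has_derivative_inv_fourier:
  fixes \<phi> :: "real ^ 'd::finite \<Rightarrow> complex"
  assumes "rapid \<phi>"
  shows "((\<lambda>x. \<integral>\<xi>. \<phi> \<xi> * character \<xi> x \<partial>lborel) has_derivative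
    (\<lambda>h. \<integral>\<xi>. \<phi> \<xi> * (\<i> * complex_of_real (h \<bullet> \<xi>) * character \<xi> x) \<partial>lborel)) (at x)"
    (is "(?F has_derivative ?D) _")
proof -
  have char_cont: "continuous_on UNIV (\<lambda>\<xi>. character \<xi> x)" for x
    unfolding character_commute[of _ x] by (rule continuous_on_character)
  have i0: "integrable lborel (\<lambda>\<xi>. \<phi> \<xi> * character \<xi> x)" for x
    by (rule rapid_integrable[OF assms char_cont, where B = 1 and k = 0]) simp
  have i1: "integrable lborel (\<lambda>\<xi>. \<phi> \<xi> * (\<i> * complex_of_real (h \<bullet> \<xi>) * character \<xi> x))" for h x
    by (rule rapid_integrable[OF assms, where B = "norm h" and k = 1])
      (auto simp: norm_mult Cauchy_Schwarz_ineq2 intro!: continuous_intros char_cont)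
  have n1: "integrable lborel (\<lambda>\<xi>. norm \<xi> * cmod (\<phi> \<xi>))"
    using integrable_norm[OF rapid_integrable[OF assms, of "\<lambda>\<xi>. complex_of_real (norm \<xi>)" 1 1]]
    by (simp add: norm_mult mult.commute continuous_intros)
  have n2: "integrable lborel (\<lambda>\<xi>. (norm \<xi>)\<^sup>2 * cmod (\<phi> \<xi>))"
    using integrable_norm[OF rapid_integrable[OF assms, of "\<lambda>\<xi>. complex_of_real ((norm \<xi>)\<^sup>2)" 1 2]]
    by (simp add: norm_mult norm_power mult.commute continuous_intros)
  define K where "K = (\<integral>\<xi>. (norm \<xi>)\<^sup>2 * cmod (\<phi> \<xi>) \<partial>lborel)"
  have "K \<ge> 0" unfolding K_def by (intro integral_nonneg_AE) auto
  have "bounded_linear ?D"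
  proof (rule bounded_linear_intro)
    show "?D (a + b) = ?D a + ?D b" for a b
      unfolding Bochner_Integration.integral_add[OF i1 i1, symmetric]
      by (simp add: inner_add_left algebra_simps)
    show "?D (r *\<^sub>R a) = r *\<^sub>R ?D a" for r a
      unfolding integral_scaleR_right[symmetric] by (simp add: scaleR_conv_of_real[where 'a = complex] mult_ac)
    show "norm (?D h) \<le> norm h * (\<integral>\<xi>. norm \<xi> * cmod (\<phi> \<xi>) \<partial>lborel)" for h
    proof -
      have "norm (?D h) \<le> (\<integral>\<xi>. norm h * (norm \<xi> * cmod (\<phi> \<xi>)) \<partial>lborel)"
      proof (rule norm_lebesgue_integral_le[OF i1])
        show "integrable lborel (\<lambda>\<xi>. norm h * (norm \<xi> * cmod (\<phi> \<xi>)))" using n1 by simp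
        fix \<xi>
        have "norm (\<phi> \<xi> * (\<i> * complex_of_real (h \<bullet> \<xi>) * character \<xi> x)) = cmod (\<phi> \<xi>) * \<bar>h \<bullet> \<xi>\<bar>"
          by (simp add: norm_mult)
        also have "\<dots> \<le> cmod (\<phi> \<xi>) * (norm h * norm \<xi>)"
          by (intro mult_left_mono Cauchy_Schwarz_ineq2) auto
        finally show "norm (\<phi> \<xi> * (\<i> * complex_of_real (h \<bullet> \<xi>) * character \<xi> x)) \<le> norm h * (norm \<xi> * cmod (\<phi> \<xi>))"
          by (simp add: mult_ac)
      qed
      then show ?thesis by simp
    qed
  qed
  moreover have rem: "norm (?F y - ?F x - ?D (y - x)) \<le> K * (norm (y - x))\<^sup>2" for y
  proof -
    define h where "h = y - x"
    have "?F y - ?F x - ?D (y - x) = (\<integral>\<xi>. \<phi> \<xi> * character \<xi> y - \<phi> \<xi> * character \<xi> x - \<phi> \<xi> * (\<i> * complex_of_real (h \<bullet> \<xi>) * character \<xi> x) \<partial>lborel)"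
      using i0 i1 by (simp add: h_def)
    also have "norm \<dots> \<le> (\<integral>\<xi>. (norm h)\<^sup>2 * ((norm \<xi>)\<^sup>2 * cmod (\<phi> \<xi>)) \<partial>lborel)"
    proof (rule norm_lebesgue_integral_le)
      show "integrable lborel (\<lambda>\<xi>. (norm h)\<^sup>2 * ((norm \<xi>)\<^sup>2 * cmod (\<phi> \<xi>)))" using n2 by simp
      fix \<xi>
      have "character \<xi> y = character \<xi> x * iexp (h \<bullet> \<xi>)"
        using character_add_right[of \<xi> x h] by (simp add: h_def character_def)
      then have "norm (\<phi> \<xi> * character \<xi> y - \<phi> \<xi> * character \<xi> x - \<phi> \<xi> * (\<i> * complex_of_real (h \<bullet> \<xi>) * character \<xi> x)) =
        norm (\<phi> \<xi> * character \<xi> x * (iexp (h \<bullet> \<xi>) - 1 - \<i> * complex_of_real (h \<bullet> \<xi>)))"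
        by (simp add: algebra_simps)
      also have "\<dots> = cmod (\<phi> \<xi>) * cmod (iexp (h \<bullet> \<xi>) - 1 - \<i> * complex_of_real (h \<bullet> \<xi>))"
        by (simp add: norm_mult)
      also have "\<dots> \<le> cmod (\<phi> \<xi>) * (h \<bullet> \<xi>)\<^sup>2"
        by (intro mult_left_mono cmod_iexp_remainder) auto
      also have "\<dots> \<le> cmod (\<phi> \<xi>) * (norm h * norm \<xi>)\<^sup>2"
        using power_mono[OF Cauchy_Schwarz_ineq2[of h \<xi>], of 2] by (intro mult_left_mono) auto
      finally show "norm (\<phi> \<xi> * character \<xi> y - \<phi> \<xi> * character \<xi> x - \<phi> \<xi> * (\<i> * complex_of_real (h \<bullet> \<xi>) * character \<xi> x)) \<le> (norm h)\<^sup>2 * ((norm \<xi>)\<^sup>2 * cmod (\<phi> \<xi>))"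
        by (simp add: power_mult_distrib mult_ac)
    qed (use i0 i1 in auto)
    finally show ?thesis by (simp add: h_def K_def mult.commute)
  qed
  have "\<exists>d>0. \<forall>y. norm (y - x) < d \<longrightarrow> norm (?F y - ?F x - ?D (y - x)) \<le> e * norm (y - x)" if "e > 0" for e
  proof (intro exI[of _ "e / (K + 1)"] conjI allI impI)
    show "0 < e / (K + 1)" using that \<open>K \<ge> 0\<close> by simp
    fix y assume y: "norm (y - x) < e / (K + 1)"
    have "K * norm (y - x) \<le> (K + 1) * norm (y - x)" by (simp add: algebra_simps)
    also have "\<dots> \<le> e" using y \<open>K \<ge> 0\<close> by (simp add: pos_less_divide_eq mult.commute)
    finally have "K * norm (y - x) * norm (y - x) \<le> e * norm (y - x)" by (intro mult_right_mono) auto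
    then show "norm (?F y - ?F x - ?D (y - x)) \<le> e * norm (y - x)"
      using rem[of y] by (simp add: power2_eq_square mult.assoc)
  qed
  ultimately show ?thesis unfolding has_derivative_at_alt by blast
qed

lemma inv_fourier_eq:
  "inv_fourier \<phi> x = complex_of_real ((2 * pi) powr (- real CARD('d) / 2)) * (\<integral>\<xi>. \<phi> \<xi> * character \<xi> x \<partial>lborel)"
  for x :: "real ^ 'd::finite"
  by (simp add: inv_fourier_def character_def)

lemma
  fixes \<phi> :: "real ^ 'd::finite \<Rightarrow> complex"
  assumes "rapid \<phi>"
  shows partial_deriv_inv_fourier:
      "partial_deriv i (inv_fourier \<phi>) = inv_fourier (\<lambda>\<xi>. \<i> * complex_of_real (\<xi> $ i) * \<phi> \<xi>)"
    and differentiable_inv_fourier: "inv_fourier \<phi> differentiable (at x)"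
proof -
  have D: "(inv_fourier \<phi> has_derivative (\<lambda>h. complex_of_real ((2 * pi) powr (- real CARD('d) / 2)) *
    (\<integral>\<xi>. \<phi> \<xi> * (\<i> * complex_of_real (h \<bullet> \<xi>) * character \<xi> x) \<partial>lborel))) (at x)" for x
    unfolding inv_fourier_eq[abs_def] by (intro has_derivative_mult_right has_derivative_inv_fourier assms)
  then show "inv_fourier \<phi> differentiable (at x)" unfolding differentiable_def by blast
  show "partial_deriv i (inv_fourier \<phi>) = inv_fourier (\<lambda>\<xi>. \<i> * complex_of_real (\<xi> $ i) * \<phi> \<xi>)"
    by (rule ext, subst partial_deriv_eqI[OF D]) (simp add: inv_fourier_eq inner_axis' mult_ac)
qed

lemma smooth_fun_inv_fourier:
  assumes "rapid \<phi>"
  shows "smooth_fun (inv_fourier \<phi>)"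
proof (rule smooth_fun_coinduct[where P = "\<lambda>h. \<exists>\<phi>. rapid \<phi> \<and> h = inv_fourier \<phi>"])
  fix g :: "real ^ 'a \<Rightarrow> complex" and i
  assume "\<exists>\<phi>. rapid \<phi> \<and> g = inv_fourier \<phi>"
  then show "\<exists>\<phi>. rapid \<phi> \<and> partial_deriv i g = inv_fourier \<phi>"
    using partial_deriv_inv_fourier rapid_mult_coord by metis
qed (use assms differentiable_inv_fourier in auto)

lemma partials_inv_fourier:
  assumes "rapid \<phi>"
  shows "partials is (inv_fourier \<phi>) = inv_fourier (\<lambda>\<xi>. \<i> ^ length is * mi_pow \<xi> (count_list is) * \<phi> \<xi>)"
proof -
  \<comment> \<open>Rapid decay is carried through the induction because the derivative rule asks
    for it at every stage.\<close>
  have "rapid (\<lambda>\<xi>. \<i> ^ length is * mi_pow \<xi> (count_list is) * \<phi> \<xi>) \<and>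
    partials is (inv_fourier \<phi>) = inv_fourier (\<lambda>\<xi>. \<i> ^ length is * mi_pow \<xi> (count_list is) * \<phi> \<xi>)"
  proof (induction "is")
    case (Cons i "is")
    let ?\<phi> = "\<lambda>\<xi>. \<i> ^ length is * mi_pow \<xi> (count_list is) * \<phi> \<xi>"
    have "mi_pow \<xi> (count_list (i # is)) = \<xi> $ i * mi_pow \<xi> (count_list is)" for \<xi>
      by (simp only: mi_pow_count_list list.map prod_list.Cons)
    then have "(\<lambda>\<xi>. \<i> ^ length (i # is) * mi_pow \<xi> (count_list (i # is)) * \<phi> \<xi>) = (\<lambda>\<xi>. \<i> * complex_of_real (\<xi> $ i) * ?\<phi> \<xi>)"
      by (simp add: mult_ac del: count_list.simps)
    then show ?case
      using Cons rapid_mult_coord[of ?\<phi> i] partial_deriv_inv_fourier[of ?\<phi> i]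
      by (simp only: foldr.simps o_apply)
  qed (use assms in \<open>simp add: mi_pow_def\<close>)
  then show ?thesis ..
qed

text \<open>At the origin all characters equal 1, so derivatives of an inverse transform become
  moments. This is what turns a series of derivatives of the Dirac distribution into a power
  series.\<close>

lemma mi_D_inv_fourier_0:
  fixes \<phi> :: "real ^ 'd::finite \<Rightarrow> complex"
  assumes "rapid \<phi>"
  shows "mi_D \<alpha> (inv_fourier \<phi>) 0 =
    complex_of_real ((2 * pi) powr (- real CARD('d) / 2)) * (\<integral>\<xi>. mi_pow \<xi> \<alpha> * \<phi> \<xi> \<partial>lborel)"
proof -
  obtain "is" where \<alpha>: "count_list is = \<alpha>" by (rule ex_list_of_mi)
  have 1: "(- \<i>) ^ length is * (C * (\<i> ^ length is * X)) = C * X" for C X :: complex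
  proof -
    have "(- \<i>) ^ length is * \<i> ^ length is = (1::complex)"
      by (simp flip: power_mult_distrib)
    then have "((- \<i>) ^ length is * \<i> ^ length is) * (C * X) = C * X" by simp
    then show ?thesis by (simp only: mult_ac)
  qed
  show ?thesis
    unfolding \<alpha>[symmetric] mi_D_count_list[OF smooth_fun_inv_fourier[OF assms]] partials_inv_fourier[OF assms] inv_fourier_eq
    by (simp only: character_def inner_zero_left of_real_0 mult_zero_right exp_zero mult_1_right mult.assoc integral_mult_right_zero 1)
qed


section \<open>Exponentially decaying functions\<close>

text \<open>An unordered sum over a countable index type is a limit along the finite sets of indices
  with code below n, and dominated convergence applies to this sequence.\<close>

lemma
  fixes F :: "'i::countable \<Rightarrow> 'a \<Rightarrow> complex"
  assumes meas: "\<And>i. F i \<in> borel_measurable M" and g: "integrable M g"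
    and a: "a summable_on UNIV" and bound: "\<And>i x. cmod (F i x) \<le> a i * g x"
  shows integral_infsum: "(\<integral>x. (\<Sum>\<^sub>\<infinity>i. F i x) \<partial>M) = (\<Sum>\<^sub>\<infinity>i. \<integral>x. F i x \<partial>M)"
    and integrable_infsum: "integrable M (\<lambda>x. \<Sum>\<^sub>\<infinity>i. F i x)"
proof -
  define S where "S n = {i :: 'i. to_nat i < n}" for n
  have fin: "finite (S n)" for n
    unfolding S_def by (rule finite_imageD[of to_nat]) (auto intro: finite_subset[of _ "{..<n}"] simp: inj_on_def)
  have lim: "filterlim S (finite_subsets_at_top UNIV) sequentially"
    unfolding filterlim_finite_subsets_at_top
  proof (intro allI impI)
    fix X :: "'i set" assume "finite X \<and> X \<subseteq> UNIV"
    then have "\<forall>\<^sub>F n in sequentially. \<forall>i\<in>X. to_nat i < n"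
      by (intro eventually_ball_finite) (auto intro: eventually_gt_at_top)
    then show "\<forall>\<^sub>F n in sequentially. finite (S n) \<and> X \<subseteq> S n \<and> S n \<subseteq> UNIV"
      by eventually_elim (auto simp: fin, auto simp: S_def)
  qed
  \<comment> \<open>Only the products \<open>a i * g x\<close> are bounded from below by assumption;
    absolute values make the two factors usable separately.\<close>
  define A where "A = (\<Sum>\<^sub>\<infinity>i. \<bar>a i\<bar>)"
  have a': "(\<lambda>i. \<bar>a i\<bar>) summable_on UNIV"
    using a summable_on_iff_abs_summable_on_real[of a UNIV] by (simp only: real_norm_def)
  have bound': "cmod (F i x) \<le> \<bar>a i\<bar> * \<bar>g x\<bar>" for i x
    using order_trans[OF bound[of i x] abs_ge_self] by (simp only: abs_mult)
  have absF: "(\<lambda>i. cmod (F i x)) summable_on UNIV" for x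
    by (rule summable_on_comparison_test[OF summable_on_cmult_left[OF a', of "\<bar>g x\<bar>"]]) (use bound' in auto)
  have sumF: "((\<lambda>i. F i x) has_sum (\<Sum>\<^sub>\<infinity>i. F i x)) UNIV" for x
    by (rule has_sum_infsum[OF abs_summable_summable[OF absF]])
  have intF: "integrable M (F i)" for i
    by (rule Bochner_Integration.integrable_bound[OF integrable_mult_right[OF integrable_abs[OF g], of "\<bar>a i\<bar>"]])
      (use meas bound' in \<open>auto simp: abs_mult\<close>)
  have norm_int: "cmod (\<integral>x. F i x \<partial>M) \<le> \<bar>a i\<bar> * (\<integral>x. \<bar>g x\<bar> \<partial>M)" for i
    using norm_lebesgue_integral_le[OF intF integrable_mult_right[OF integrable_abs[OF g], of "\<bar>a i\<bar>"] bound']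
    by simp
  have "(\<lambda>i. cmod (\<integral>x. F i x \<partial>M)) summable_on UNIV"
    by (rule summable_on_comparison_test[OF summable_on_cmult_left[OF a']]) (use norm_int in auto)
  then have "((\<lambda>i. \<integral>x. F i x \<partial>M) has_sum (\<Sum>\<^sub>\<infinity>i. \<integral>x. F i x \<partial>M)) UNIV"
    by (rule has_sum_infsum[OF abs_summable_summable])
  then have lim1: "(\<lambda>n. \<Sum>i\<in>S n. \<integral>x. F i x \<partial>M) \<longlonglongrightarrow> (\<Sum>\<^sub>\<infinity>i. \<integral>x. F i x \<partial>M)"
    unfolding has_sum_def using lim by (rule filterlim_compose)
  have pw: "(\<lambda>n. \<Sum>i\<in>S n. F i x) \<longlonglongrightarrow> (\<Sum>\<^sub>\<infinity>i. F i x)" for x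
    using sumF[of x] unfolding has_sum_def using lim by (rule filterlim_compose)
  have m: "(\<lambda>x. \<Sum>\<^sub>\<infinity>i. F i x) \<in> borel_measurable M"
    by (rule borel_measurable_LIMSEQ_metric[OF _ pw]) (use meas in auto)
  have dom: "cmod (\<Sum>i\<in>S n. F i x) \<le> A * \<bar>g x\<bar>" for n x
  proof -
    have "cmod (\<Sum>i\<in>S n. F i x) \<le> (\<Sum>i\<in>S n. \<bar>a i\<bar> * \<bar>g x\<bar>)"
      by (rule order_trans[OF norm_sum sum_mono]) (rule bound')
    also have "\<dots> = (\<Sum>i\<in>S n. \<bar>a i\<bar>) * \<bar>g x\<bar>" by (simp add: sum_distrib_right)
    also have "\<dots> \<le> A * \<bar>g x\<bar>"
      unfolding A_def by (intro mult_right_mono finite_sum_le_infsum a' fin) auto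
    finally show ?thesis .
  qed
  have "(\<lambda>n. \<integral>x. (\<Sum>i\<in>S n. F i x) \<partial>M) \<longlonglongrightarrow> (\<integral>x. (\<Sum>\<^sub>\<infinity>i. F i x) \<partial>M)"
    by (rule integral_dominated_convergence[where w = "\<lambda>x. A * \<bar>g x\<bar>"])
      (use m meas g pw dom in auto)
  also have "(\<lambda>n. \<integral>x. (\<Sum>i\<in>S n. F i x) \<partial>M) = (\<lambda>n. \<Sum>i\<in>S n. \<integral>x. F i x \<partial>M)"
    using intF by simp
  finally show "(\<integral>x. (\<Sum>\<^sub>\<infinity>i. F i x) \<partial>M) = (\<Sum>\<^sub>\<infinity>i. \<integral>x. F i x \<partial>M)"
    using lim1 LIMSEQ_unique by blast
  have "cmod (\<Sum>\<^sub>\<infinity>i. F i x) \<le> A * \<bar>g x\<bar>" for x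
    by (rule LIMSEQ_le_const2[OF tendsto_norm[OF pw]]) (use dom in auto)
  then have "norm (\<Sum>\<^sub>\<infinity>i. F i x) \<le> norm (A * \<bar>g x\<bar>)" for x
    by (simp only: real_norm_def) (rule order_trans[OF _ abs_ge_self])
  then show "integrable M (\<lambda>x. \<Sum>\<^sub>\<infinity>i. F i x)"
    by (intro Bochner_Integration.integrable_bound[OF integrable_mult_right[OF integrable_abs[OF g], of A]] m AE_I2)
qed

text \<open>A moment of the transform is the transform of an iterated derivative. \<open>J\<close>
  secures the decay for integration by parts but stays out of the resulting bound, so it may later
  depend on the position of the window.\<close>

lemma fourier_integral_moments:
  fixes G :: "real ^ 'd::finite \<Rightarrow> complex" and A H t :: real
  assumes G: "smooth_fun G" and w: "integrable lborel w" "\<And>y. w y \<le> J * cauchy_weight y"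
    and "A \<ge> 0" "H > 0"
    and bound: "\<And>js y. cmod (partials js G y) \<le> A * H ^ length js * fact (length js) powr t * w y"
  shows "\<bar>\<xi> $ k\<bar> ^ m * cmod (fourier_integral G \<xi>) \<le> A * (\<integral>y. w y \<partial>lborel) * H ^ m * fact m powr t"
proof -
  let ?js = "replicate m k"
  have wJ: "cmod (partials js G y) \<le> (A * H ^ length js * fact (length js) powr t * J) * cauchy_weight y" for js y
    using order_trans[OF bound mult_left_mono[OF w(2)]] \<open>A \<ge> 0\<close> \<open>H > 0\<close> by (simp add: mult.assoc)
  have "\<bar>\<xi> $ k\<bar> ^ m * cmod (fourier_integral G \<xi>) = cmod (fourier_integral (partials ?js G) \<xi>)"
    by (subst fourier_integral_partials[OF G]) (use wJ in \<open>auto simp: mi_pow_count_list norm_mult norm_power prod_list_replicate\<close>)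
  also have "\<dots> \<le> (\<integral>y. A * H ^ m * fact m powr t * w y \<partial>lborel)"
    unfolding fourier_integral_def
  proof (rule norm_lebesgue_integral_le)
    have "(\<lambda>y. partials ?js G y * character (- \<xi>) y) \<in> borel_measurable borel"
      by (intro borel_measurable_continuous_onI smooth_fun_continuous smooth_fun_mult smooth_fun_partials G smooth_fun_character)
    then show "integrable lborel (\<lambda>y. partials ?js G y * character (- \<xi>) y)"
      by (rule integrable_cauchy_bound) (use wJ[of ?js] in \<open>simp only: norm_mult cmod_character mult_1_right\<close>)
    show "norm (partials ?js G y * character (- \<xi>) y) \<le> A * H ^ m * fact m powr t * w y" for y
      using bound[of ?js y] by (simp add: norm_mult)
  qed (use w in simp)
  also have "\<dots> = A * (\<integral>y. w y \<partial>lborel) * H ^ m * fact m powr t" by simp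
  finally show ?thesis .
qed

definition exp_decaying :: "real \<Rightarrow> (real ^ 'd::finite \<Rightarrow> complex) \<Rightarrow> bool" where
  "exp_decaying p \<phi> \<longleftrightarrow> continuous_on UNIV \<phi> \<and> (\<forall>R>0. \<exists>C>0. \<forall>y. cmod (\<phi> y) \<le> C * exp (- (R * norm y powr p)))"

lemma exp_decaying_rapid:
  fixes \<phi> :: "real ^ 'd::finite \<Rightarrow> complex"
  assumes "exp_decaying p \<phi>" "p > 0"
  shows "rapid \<phi>"
  unfolding rapid_def
proof (intro conjI allI)
  fix k
  obtain C where "C > 0" and C: "\<And>y. cmod (\<phi> y) \<le> C * exp (- (1 / p * norm y powr p))"
    using assms unfolding exp_decaying_def by (meson zero_less_divide_1_iff)
  obtain D where D: "\<And>y::real^'d. norm y ^ k * exp (- (1 / p * norm y powr p)) \<le> D * cauchy_weight y"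
    using exp_decay_le_cauchy_weight[OF assms(2)] by blast
  have "norm y ^ k * cmod (\<phi> y) \<le> (C * D) * cauchy_weight y" for y
  proof -
    have "norm y ^ k * cmod (\<phi> y) \<le> norm y ^ k * (C * exp (- (1 / p * norm y powr p)))"
      by (intro mult_left_mono C) auto
    also have "\<dots> = C * (norm y ^ k * exp (- (1 / p * norm y powr p)))" by simp
    also have "\<dots> \<le> C * (D * cauchy_weight y)" using \<open>C > 0\<close> by (intro mult_left_mono D) auto
    finally show ?thesis by simp
  qed
  then show "\<exists>C. \<forall>y. norm y ^ k * cmod (\<phi> y) \<le> C * cauchy_weight y" by blast
qed (use assms in \<open>simp add: exp_decaying_def\<close>)

lemma gs_space_exp_decaying:
  assumes "\<phi> \<in> gs_space t s" "t > 0" "s \<ge> 0"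
  shows "exp_decaying (1 / t) \<phi>"
  unfolding exp_decaying_def
proof (intro conjI allI impI)
  show "continuous_on UNIV \<phi>" using assms by (intro smooth_fun_continuous gs_space_smooth)
  fix R :: real assume "R > 0"
  from gs_space_decay[OF assms zero_less_one this] obtain C where "C > 0"
    and C: "\<And>is x. cmod (partials is \<phi> x) \<le> C * 1 ^ length is * fact (length is) powr s * exp (- (R * norm x powr (1 / t)))"
    by blast
  have "cmod (\<phi> x) \<le> C * exp (- (R * norm x powr (1 / t)))" for x using C[of "[]" x] by simp
  then show "\<exists>C>0. \<forall>y. cmod (\<phi> y) \<le> C * exp (- (R * norm y powr (1 / t)))" using \<open>C > 0\<close> by blast
qed

lemma norm_powr_le_add:
  fixes x y :: "'a::real_normed_vector"
  assumes "0 < p" "p \<le> 1"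
  shows "norm y powr p \<le> norm (y - x) powr p + norm x powr p"
proof -
  have "norm y \<le> norm (y - x) + norm x" using norm_triangle_sub[of y x] by simp
  then have "norm y powr p \<le> (norm (y - x) + norm x) powr p"
    using assms by (intro powr_mono2) auto
  also have "\<dots> \<le> norm (y - x) powr p + norm x powr p"
    using assms by (intro powr_add_le) auto
  finally show ?thesis .
qed

lemma integrable_exp_decay:
  assumes "p > 0"
  shows "integrable lborel (\<lambda>y::real^'d::finite. exp (- (1 / p * norm y powr p)))"
proof -
  obtain D where D: "\<And>y::real^'d. norm y ^ 0 * exp (- (1 / p * norm y powr p)) \<le> D * cauchy_weight y"
    using exp_decay_le_cauchy_weight[OF assms] by blast
  show ?thesis by (rule integrable_cauchy_bound[where C = D]) (use D in auto)
qed

lemma exp_decaying_translate_modulate: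
  assumes "exp_decaying p \<phi>" "0 < p" "p \<le> 1"
  shows "exp_decaying p (\<lambda>y. \<phi> (y - a) * character \<xi> (y - b))"
  unfolding exp_decaying_def
proof (intro conjI allI impI)
  have c: "continuous_on UNIV \<phi>" using assms by (simp add: exp_decaying_def)
  show "continuous_on UNIV (\<lambda>y. \<phi> (y - a) * character \<xi> (y - b))"
    unfolding character_def by (intro continuous_intros continuous_on_compose2[OF c]) auto
  fix R :: real assume "R > 0"
  then obtain C where "C > 0" and C: "\<And>y. cmod (\<phi> y) \<le> C * exp (- (R * norm y powr p))"
    using assms by (auto simp: exp_decaying_def)
  have "cmod (\<phi> (y - a) * character \<xi> (y - b)) \<le> (C * exp (R * norm a powr p)) * exp (- (R * norm y powr p))" for y
  proof -
    have "R * norm y powr p \<le> R * (norm (y - a) powr p + norm a powr p)"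
      using \<open>R > 0\<close> assms by (intro mult_left_mono norm_powr_le_add) auto
    then have "exp (- (R * norm (y - a) powr p)) \<le> exp (R * norm a powr p) * exp (- (R * norm y powr p))"
      by (simp add: exp_add[symmetric] algebra_simps)
    then have "C * exp (- (R * norm (y - a) powr p)) \<le> C * (exp (R * norm a powr p) * exp (- (R * norm y powr p)))"
      using \<open>C > 0\<close> by (intro mult_left_mono) auto
    with C[of "y - a"] show ?thesis by (simp add: norm_mult mult_ac)
  qed
  then show "\<exists>C>0. \<forall>y. cmod (\<phi> (y - a) * character \<xi> (y - b)) \<le> C * exp (- (R * norm y powr p))"
    using \<open>C > 0\<close> by (intro exI[of _ "C * exp (R * norm a powr p)"]) auto
qed

section \<open>The ultradistribution and its Fourier transform\<close>

locale rapid_coeffs =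
  fixes s :: real and c :: "('d::finite \<Rightarrow> nat) \<Rightarrow> complex"
  assumes s: "s > 1"
    and summable_coeffs: "r > 0 \<Longrightarrow> (\<lambda>\<alpha>. cmod (c \<alpha>) * r ^ mi_abs \<alpha> * mi_fact \<alpha> powr s) summable_on UNIV"
begin

definition F :: "real ^ 'd \<Rightarrow> complex" where
  "F x = (\<Sum>\<^sub>\<infinity>\<alpha>. c \<alpha> * complex_of_real (mi_pow x \<alpha>))"

definition u :: "'d distr" where
  "u \<phi> = (\<Sum>\<^sub>\<infinity>\<alpha>. c \<alpha> * distr_D \<alpha> delta0 \<phi>)"

lemma summable_coeffs_fact:
  assumes "r > 0"
  shows "(\<lambda>\<alpha>. cmod (c \<alpha>) * (r ^ mi_abs \<alpha> * fact (mi_abs \<alpha>) powr s)) summable_on UNIV"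
proof (rule summable_on_comparison_test)
  show "(\<lambda>\<alpha>. cmod (c \<alpha>) * (r * (2 ^ CARD('d)) powr s) ^ mi_abs \<alpha> * mi_fact \<alpha> powr s) summable_on UNIV"
    using assms by (intro summable_coeffs) auto
  show "cmod (c \<alpha>) * (r ^ mi_abs \<alpha> * fact (mi_abs \<alpha>) powr s) \<le> cmod (c \<alpha>) * (r * (2 ^ CARD('d)) powr s) ^ mi_abs \<alpha> * mi_fact \<alpha> powr s" for \<alpha>
  proof -
    have "cmod (c \<alpha>) * r ^ mi_abs \<alpha> * fact (mi_abs \<alpha>) powr s \<le>
        cmod (c \<alpha>) * r ^ mi_abs \<alpha> * (((2 ^ CARD('d)) powr s) ^ mi_abs \<alpha> * mi_fact \<alpha> powr s)"
      using assms s by (intro mult_left_mono fact_powr_le_mi_fact) auto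
    then show ?thesis by (simp add: power_mult_distrib mult_ac)
  qed
qed (use assms in auto)

text \<open>The ratio (s / r) powr s is the h that solves s * (1 / h) powr (1 / s) = r, so the
  exponential comes out with rate exactly r.\<close>

lemma mi_pow_le_exp:
  assumes "r > 0"
  shows "\<bar>mi_pow y \<alpha>\<bar> \<le> ((s / r) powr s) ^ mi_abs \<alpha> * fact (mi_abs \<alpha>) powr s * exp (r * norm y powr (1 / s))"
proof -
  have h: "(s / r) powr s > 0" using s assms by simp
  have "\<bar>mi_pow y \<alpha>\<bar> \<le> norm y ^ mi_abs \<alpha>" by (rule abs_mi_pow_le)
  also have "\<dots> \<le> ((s / r) powr s) ^ mi_abs \<alpha> * fact (mi_abs \<alpha>) powr s * exp (s * (norm y / (s / r) powr s) powr (1 / s))"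
    using h s by (intro power_le_fact_powr_exp) auto
  also have "s * (norm y / (s / r) powr s) powr (1 / s) = r * norm y powr (1 / s)"
    using s assms by (simp add: powr_divide powr_powr powr_mult)
  finally show ?thesis .
qed

definition coeff_sum :: "real \<Rightarrow> real" where
  "coeff_sum r = (\<Sum>\<^sub>\<infinity>\<alpha>. cmod (c \<alpha>) * (((s / r) powr s) ^ mi_abs \<alpha> * fact (mi_abs \<alpha>) powr s))"

lemma F_term_bound:
  assumes "r > 0"
  shows "cmod (c \<alpha> * complex_of_real (mi_pow y \<alpha>)) \<le>
    cmod (c \<alpha>) * (((s / r) powr s) ^ mi_abs \<alpha> * fact (mi_abs \<alpha>) powr s) * exp (r * norm y powr (1 / s))"
  using mult_left_mono[OF mi_pow_le_exp[OF assms, of y \<alpha>], of "cmod (c \<alpha>)"] by (simp add: norm_mult mult_ac)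

lemma summable_F_bound: "r > 0 \<Longrightarrow> (\<lambda>\<alpha>. cmod (c \<alpha>) * (((s / r) powr s) ^ mi_abs \<alpha> * fact (mi_abs \<alpha>) powr s)) summable_on UNIV"
  using s by (intro summable_coeffs_fact) auto

lemma F_growth:
  assumes "r > 0"
  shows "cmod (F y) \<le> coeff_sum r * exp (r * norm y powr (1 / s))"
proof -
  let ?a = "\<lambda>\<alpha>. cmod (c \<alpha>) * (((s / r) powr s) ^ mi_abs \<alpha> * fact (mi_abs \<alpha>) powr s) * exp (r * norm y powr (1 / s))"
  have a: "?a summable_on UNIV"
    by (rule summable_on_cmult_left[OF summable_F_bound[OF assms]])
  have "(\<lambda>\<alpha>. cmod (c \<alpha> * complex_of_real (mi_pow y \<alpha>))) summable_on UNIV"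
    by (rule summable_on_comparison_test[OF a F_term_bound[OF assms] norm_ge_zero])
  then have b: "(\<lambda>\<alpha>. c \<alpha> * complex_of_real (mi_pow y \<alpha>)) summable_on UNIV"
    by (rule abs_summable_summable)
  have "cmod (F y) \<le> (\<Sum>\<^sub>\<infinity>\<alpha>. ?a \<alpha>)"
    unfolding F_def by (rule norm_infsum_le[OF has_sum_infsum[OF b] has_sum_infsum[OF a] F_term_bound[OF assms]])
  then show ?thesis by (simp add: coeff_sum_def infsum_cmult_left')
qed

lemma coeff_sum_nonneg: "coeff_sum r \<ge> 0"
  unfolding coeff_sum_def by (intro infsum_nonneg) auto

lemma continuous_on_F: "continuous_on UNIV F"
proof (rule continuous_at_imp_continuous_on, rule ballI)
  fix x :: "real ^ 'd"
  define B where "B = ball (0::real^'d) (norm x + 1)"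
  define M where "M \<alpha> = cmod (c \<alpha>) * (((s / 1) powr s) ^ mi_abs \<alpha> * fact (mi_abs \<alpha>) powr s) * exp ((norm x + 1) powr (1 / s))" for \<alpha>
  have "uniform_limit B (\<lambda>X y. \<Sum>\<alpha>\<in>X. c \<alpha> * complex_of_real (mi_pow y \<alpha>)) (\<lambda>y. \<Sum>\<^sub>\<infinity>\<alpha>. c \<alpha> * complex_of_real (mi_pow y \<alpha>)) (finite_subsets_at_top UNIV)"
  proof (rule Weierstrass_m_test_general)
    show "M summable_on UNIV" unfolding M_def by (intro summable_on_cmult_left summable_F_bound) simp
    fix \<alpha> y assume "y \<in> B"
    then have "norm y powr (1 / s) \<le> (norm x + 1) powr (1 / s)" using s by (intro powr_mono2) (auto simp: B_def)
    then show "norm (c \<alpha> * complex_of_real (mi_pow y \<alpha>)) \<le> M \<alpha>"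
      unfolding M_def using order_trans[OF F_term_bound[of 1 \<alpha> y] mult_left_mono] by auto
  qed
  then have "continuous_on B F"
    unfolding F_def[abs_def]
  proof (rule uniform_limit_theorem[rotated])
    show "\<forall>\<^sub>F X in finite_subsets_at_top UNIV. continuous_on B (\<lambda>y. \<Sum>\<alpha>\<in>X. c \<alpha> * complex_of_real (mi_pow y \<alpha>))"
      by (intro always_eventually allI continuous_intros smooth_fun_continuous smooth_fun_mi_pow)
  qed simp
  moreover have "x \<in> B" "open B" by (auto simp: B_def)
  ultimately show "isCont F x" using continuous_on_eq_continuous_at by blast
qed

lemma integrable_exp_times_decaying:
  assumes "exp_decaying (1 / s) \<phi>"
  shows "integrable lborel (\<lambda>y::real^'d. exp (norm y powr (1 / s)) * cmod (\<phi> y))"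
proof -
  have [measurable]: "\<phi> \<in> borel_measurable borel"
    using assms by (intro borel_measurable_continuous_onI) (auto simp: exp_decaying_def)
  \<comment> \<open>Of the rate 1 + s, one unit cancels the growing factor, and s = 1 / (1 / s) is
    left for integrability.\<close>
  obtain C where "C > 0" and C: "\<And>y. cmod (\<phi> y) \<le> C * exp (- ((1 + s) * norm y powr (1 / s)))"
    using assms s unfolding exp_decaying_def by (metis add_pos_pos less_trans zero_less_one)
  have "integrable lborel (\<lambda>y::real^'d. C * exp (- (1 / (1 / s) * norm y powr (1 / s))))"
    using s by (intro integrable_mult_right integrable_exp_decay) auto
  then show ?thesis
  proof (rule Bochner_Integration.integrable_bound)
    have "exp (norm y powr (1 / s)) * cmod (\<phi> y) \<le> C * exp (- (s * norm y powr (1 / s)))" for y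
    proof -
      have "exp (norm y powr (1 / s)) * cmod (\<phi> y) \<le> exp (norm y powr (1 / s)) * (C * exp (- ((1 + s) * norm y powr (1 / s))))"
        by (intro mult_left_mono C) auto
      also have "\<dots> = C * exp (- (s * norm y powr (1 / s)))"
        by (simp add: exp_add[symmetric] algebra_simps flip: mult.assoc)
      finally show ?thesis .
    qed
    then show "AE y in lborel. norm (exp (norm y powr (1 / s)) * cmod (\<phi> y)) \<le> norm (C * exp (- (1 / (1 / s) * norm y powr (1 / s))))"
      using \<open>C > 0\<close> by (auto simp: abs_mult)
  qed auto
qed

text \<open>Growth at rate 1 gives one majorant for all terms of the series. The bounded factor
  \<open>g\<close> is the constant 1 in the pairing and a character in the short-time Fourier
  transform.\<close>

lemma
  assumes "exp_decaying (1 / s) \<phi>" "continuous_on UNIV g" "\<And>y. cmod (g y) \<le> 1"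
  shows integral_F: "(\<integral>y. F y * (cnj (\<phi> y) * g y) \<partial>lborel) =
      (\<Sum>\<^sub>\<infinity>\<alpha>. c \<alpha> * (\<integral>y. complex_of_real (mi_pow y \<alpha>) * (cnj (\<phi> y) * g y) \<partial>lborel))"
    and integrable_F: "integrable lborel (\<lambda>y. F y * (cnj (\<phi> y) * g y))"
proof -
  have c: "continuous_on UNIV \<phi>" using assms(1) by (simp add: exp_decaying_def)
  let ?T = "\<lambda>\<alpha> y. c \<alpha> * complex_of_real (mi_pow y \<alpha>) * (cnj (\<phi> y) * g y)"
  have meas: "?T \<alpha> \<in> borel_measurable lborel" for \<alpha>
    using smooth_fun_continuous[OF smooth_fun_mi_pow]
    by (simp, intro borel_measurable_continuous_onI continuous_intros c assms(2))
  have bound: "cmod (?T \<alpha> y) \<le> (cmod (c \<alpha>) * (((s / 1) powr s) ^ mi_abs \<alpha> * fact (mi_abs \<alpha>) powr s)) * (exp (norm y powr (1 / s)) * cmod (\<phi> y))" for \<alpha> y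
  proof -
    have "cmod (?T \<alpha> y) = cmod (c \<alpha> * complex_of_real (mi_pow y \<alpha>)) * (cmod (\<phi> y) * cmod (g y))"
      by (simp add: norm_mult)
    also have "\<dots> \<le> (cmod (c \<alpha>) * (((s / 1) powr s) ^ mi_abs \<alpha> * fact (mi_abs \<alpha>) powr s) * exp (1 * norm y powr (1 / s))) * (cmod (\<phi> y) * 1)"
      by (intro mult_mono F_term_bound assms(3)) auto
    finally show ?thesis by (simp add: mult_ac)
  qed
  have eq: "(\<lambda>y. F y * (cnj (\<phi> y) * g y)) = (\<lambda>y. \<Sum>\<^sub>\<infinity>\<alpha>. ?T \<alpha> y)"
    unfolding F_def by (simp add: infsum_cmult_left')
  show "integrable lborel (\<lambda>y. F y * (cnj (\<phi> y) * g y))"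
    unfolding eq by (rule integrable_infsum[OF meas integrable_exp_times_decaying[OF assms(1)] summable_F_bound bound]) simp
  have "(\<integral>y. F y * (cnj (\<phi> y) * g y) \<partial>lborel) = (\<Sum>\<^sub>\<infinity>\<alpha>. \<integral>y. ?T \<alpha> y \<partial>lborel)"
    unfolding eq by (rule integral_infsum[OF meas integrable_exp_times_decaying[OF assms(1)] summable_F_bound bound]) simp
  then show "(\<integral>y. F y * (cnj (\<phi> y) * g y) \<partial>lborel) =
      (\<Sum>\<^sub>\<infinity>\<alpha>. c \<alpha> * (\<integral>y. complex_of_real (mi_pow y \<alpha>) * (cnj (\<phi> y) * g y) \<partial>lborel))"
    by (simp add: mult.assoc)
qed

lemma integrable_F_cnj: "exp_decaying (1 / s) \<phi> \<Longrightarrow> integrable lborel (\<lambda>y. F y * cnj (\<phi> y))"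
  using integrable_F[of \<phi> "\<lambda>_. 1"] by simp

text \<open>Only decay of \<open>\<phi>\<close> is asked for, so that the formula also covers
  translates and modulates of \<open>\<kappa>\<close>, for which no derivative bounds are at
  hand.\<close>

lemma u_inv_fourier:
  assumes "exp_decaying (1 / s) \<phi>"
  shows "u (inv_fourier \<phi>) = complex_of_real ((2 * pi) powr (- real CARD('d) / 2)) * fun_distr F \<phi>"
    (is "_ = complex_of_real ?K * _")
proof -
  have r: "rapid \<phi>" using assms s by (intro exp_decaying_rapid) auto
  have "u (inv_fourier \<phi>) = (\<Sum>\<^sub>\<infinity>\<alpha>. complex_of_real ?K * (c \<alpha> * (\<integral>y. complex_of_real (mi_pow y \<alpha>) * (cnj (\<phi> y) * 1) \<partial>lborel)))"
    unfolding u_def distr_D_def delta0_def mi_D_inv_fourier_0[OF r]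
    by (simp add: mult_ac flip: Bochner_Integration.integral_cnj)
  also have "\<dots> = complex_of_real ?K * fun_distr F \<phi>"
    unfolding fun_distr_def using integral_F[OF assms, of "\<lambda>_. 1"] by (simp add: infsum_cmult_right')
  finally show ?thesis .
qed

lemma u_bound:
  assumes \<phi>: "\<And>\<alpha>. cmod (mi_D \<alpha> \<phi> 0) \<le> B * (r ^ mi_abs \<alpha> * fact (mi_abs \<alpha>) powr s)" and "r > 0"
  shows "cmod (u \<phi>) \<le> B * (\<Sum>\<^sub>\<infinity>\<alpha>. cmod (c \<alpha>) * (r ^ mi_abs \<alpha> * fact (mi_abs \<alpha>) powr s))"
    and "(\<lambda>\<alpha>. c \<alpha> * distr_D \<alpha> delta0 \<phi>) summable_on UNIV"
proof -
  have b: "cmod (c \<alpha> * distr_D \<alpha> delta0 \<phi>) \<le> B * (cmod (c \<alpha>) * (r ^ mi_abs \<alpha> * fact (mi_abs \<alpha>) powr s))" for \<alpha>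
    using mult_left_mono[OF \<phi>[of \<alpha>], of "cmod (c \<alpha>)"] by (simp add: norm_mult distr_D_def delta0_def mult_ac)
  have sm: "(\<lambda>\<alpha>. B * (cmod (c \<alpha>) * (r ^ mi_abs \<alpha> * fact (mi_abs \<alpha>) powr s))) summable_on UNIV"
    by (intro summable_on_cmult_right summable_coeffs_fact assms)
  show *: "(\<lambda>\<alpha>. c \<alpha> * distr_D \<alpha> delta0 \<phi>) summable_on UNIV"
    by (rule abs_summable_summable, rule summable_on_comparison_test[OF sm b norm_ge_zero])
  have "cmod (u \<phi>) \<le> (\<Sum>\<^sub>\<infinity>\<alpha>. B * (cmod (c \<alpha>) * (r ^ mi_abs \<alpha> * fact (mi_abs \<alpha>) powr s)))"
    unfolding u_def
    by (rule norm_infsum_le[OF has_sum_infsum[OF *] has_sum_infsum[OF sm] b])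
  then show "cmod (u \<phi>) \<le> B * (\<Sum>\<^sub>\<infinity>\<alpha>. cmod (c \<alpha>) * (r ^ mi_abs \<alpha> * fact (mi_abs \<alpha>) powr s))"
    by (simp add: infsum_cmult_right')
qed

text \<open>The quotient is evaluated at the origin with the trivial monomial. The power of 1 puts
  the bound into the shape that \<open>u_bound\<close> takes.\<close>

lemma cmod_mi_D_0_le_seminorm:
  assumes "\<phi> \<in> gs_space t s"
  shows "cmod (mi_D \<alpha> \<phi> 0) \<le> gs_seminorm t s 1 \<phi> * (1 ^ mi_abs \<alpha> * fact (mi_abs \<alpha>) powr s)"
proof -
  have "cmod (mi_D \<alpha> \<phi> 0) / mi_fact \<alpha> powr s \<le> gs_seminorm t s 1 \<phi>"
    using gs_quotient_le_seminorm[OF assms zero_less_one, of "(\<lambda>_. 0, \<alpha>, 0)"]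
    by (simp add: gs_quotient_def mi_pow_def mi_fact_def)
  moreover from this have "0 \<le> gs_seminorm t s 1 \<phi>"
    by (rule order_trans[rotated]) auto
  ultimately have "cmod (mi_D \<alpha> \<phi> 0) \<le> gs_seminorm t s 1 \<phi> * mi_fact \<alpha> powr s" "0 \<le> gs_seminorm t s 1 \<phi>"
    using mi_fact_pos[of \<alpha>] by (auto simp: divide_le_eq)
  then show ?thesis
    using mult_left_mono[OF mi_fact_powr_le[of s \<alpha>]] s by (fastforce elim: order_trans)
qed

lemma u_in_dual:
  assumes "t > 0"
  shows "u \<in> gs_dual t s"
proof (rule gs_dualI)
  fix \<phi> :: "real ^ 'd \<Rightarrow> complex" assume \<phi>: "\<phi> \<in> gs_space t s"
  show "cmod (u \<phi>) \<le> (\<Sum>\<^sub>\<infinity>\<alpha>. cmod (c \<alpha>) * (1 ^ mi_abs \<alpha> * fact (mi_abs \<alpha>) powr s)) * gs_seminorm t s 1 \<phi>"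
    using u_bound(1)[OF cmod_mi_D_0_le_seminorm[OF \<phi>] zero_less_one] by (simp add: mult.commute)
  fix \<theta> :: "real ^ 'd \<Rightarrow> complex" and a b assume \<theta>: "\<theta> \<in> gs_space t s"
  note sm = u_bound(2)[OF cmod_mi_D_0_le_seminorm[OF \<phi>] zero_less_one] u_bound(2)[OF cmod_mi_D_0_le_seminorm[OF \<theta>] zero_less_one]
  have "u (\<lambda>x. a * \<phi> x + b * \<theta> x) = (\<Sum>\<^sub>\<infinity>\<alpha>. cnj a * (c \<alpha> * distr_D \<alpha> delta0 \<phi>) + cnj b * (c \<alpha> * distr_D \<alpha> delta0 \<theta>))"
    unfolding u_def distr_D_def delta0_def mi_D_lincomb[OF gs_space_smooth[OF \<phi>] gs_space_smooth[OF \<theta>]]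
    by (simp add: algebra_simps)
  also have "\<dots> = cnj a * u \<phi> + cnj b * u \<theta>"
    unfolding u_def using sm by (subst infsum_add) (auto intro: summable_on_cmult_right simp: infsum_cmult_right')
  finally show "u (\<lambda>x. a * \<phi> x + b * \<theta> x) = cnj a * u \<phi> + cnj b * u \<theta>" .
qed (use assms s in auto)

lemma fun_distr_F_in_dual:
  assumes "t > 0"
  shows "fun_distr F \<in> gs_dual s t"
proof -
  \<comment> \<open>Gives test functions the decay rate 1 + s: one unit against the growth of
    \<open>F\<close>, s units for integrability.\<close>
  define h where "h = (s / (2 * (1 + s))) powr s / CARD('d)"
  have h: "h > 0" "s / (2 * (CARD('d) * h) powr (1 / s)) = 1 + s"
    using s by (auto simp: h_def powr_powr)
  have dec: "exp_decaying (1 / s) \<phi>" if "\<phi> \<in> gs_space s t" for \<phi> :: "real ^ 'd \<Rightarrow> complex"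
    using that s assms by (intro gs_space_exp_decaying) auto
  define L where "L = 2 powr s * (coeff_sum 1 * (\<integral>y. exp (- (1 / (1 / s) * norm y powr (1 / s))) \<partial>(lborel :: (real ^ 'd) measure)))"
  show ?thesis
  proof (rule gs_dualI)
    fix \<phi> :: "real ^ 'd \<Rightarrow> complex" assume \<phi>: "\<phi> \<in> gs_space s t"
    let ?N = "gs_seminorm s t h \<phi>"
    have b: "cmod (\<phi> y) \<le> 2 powr s * ?N * exp (- ((1 + s) * norm y powr (1 / s)))" for y
    proof -
      have "\<phi> y = mi_D (count_list []) \<phi> y" by (subst mi_D_count_list) (use gs_space_smooth[OF \<phi>] in auto)
      moreover have "count_list [] = (\<lambda>_ :: 'd. 0 :: nat)" by (simp add: fun_eq_iff)
      ultimately have "cmod (\<phi> y) = cmod (mi_D (\<lambda>_. 0) \<phi> y)" by simp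
      also have "\<dots> \<le> (2 powr s * ?N * (h ^ mi_abs (\<lambda>_::'d. 0) * mi_fact (\<lambda>_::'d. 0) powr t)) * exp (- (s / (2 * (CARD('d) * h) powr (1 / s)) * norm y powr (1 / s)))"
        using s h \<phi> by (intro cmod_mi_D_le_exp_decay gs_quotient_le_seminorm) auto
      finally show ?thesis unfolding h by (simp add: mi_abs_def mi_fact_def)
    qed
    have "cmod (fun_distr F \<phi>) \<le> (\<integral>y. coeff_sum 1 * (2 powr s * ?N) * exp (- (1 / (1 / s) * norm y powr (1 / s))) \<partial>(lborel :: (real ^ 'd) measure))"
      unfolding fun_distr_def
    proof (rule norm_lebesgue_integral_le[OF integrable_F_cnj[OF dec[OF \<phi>]]])
      show "integrable lborel (\<lambda>y::real^'d. coeff_sum 1 * (2 powr s * ?N) * exp (- (1 / (1 / s) * norm y powr (1 / s))))"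
        using s by (intro integrable_mult_right integrable_exp_decay) auto
      fix y
      have "cmod (F y * cnj (\<phi> y)) \<le> (coeff_sum 1 * exp (1 * norm y powr (1 / s))) * (2 powr s * ?N * exp (- ((1 + s) * norm y powr (1 / s))))"
        unfolding norm_mult complex_mod_cnj by (intro mult_mono F_growth b mult_nonneg_nonneg coeff_sum_nonneg) auto
      also have "\<dots> = coeff_sum 1 * (2 powr s * ?N) * (exp (norm y powr (1 / s)) * exp (- ((1 + s) * norm y powr (1 / s))))"
        by simp
      also have "exp (norm y powr (1 / s)) * exp (- ((1 + s) * norm y powr (1 / s))) = exp (- (1 / (1 / s) * norm y powr (1 / s)))"
        by (simp add: exp_add[symmetric] algebra_simps)
      finally show "cmod (F y * cnj (\<phi> y)) \<le> coeff_sum 1 * (2 powr s * ?N) * exp (- (1 / (1 / s) * norm y powr (1 / s)))" .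
    qed
    then show "cmod (fun_distr F \<phi>) \<le> L * ?N" by (simp add: L_def mult_ac)
    fix \<theta> :: "real ^ 'd \<Rightarrow> complex" and a b assume \<theta>: "\<theta> \<in> gs_space s t"
    have "fun_distr F (\<lambda>x. a * \<phi> x + b * \<theta> x) = (\<integral>y. cnj a * (F y * cnj (\<phi> y)) + cnj b * (F y * cnj (\<theta> y)) \<partial>lborel)"
      unfolding fun_distr_def by (simp add: algebra_simps)
    also have "\<dots> = cnj a * fun_distr F \<phi> + cnj b * fun_distr F \<theta>"
      unfolding fun_distr_def using integrable_F_cnj[OF dec[OF \<phi>]] integrable_F_cnj[OF dec[OF \<theta>]] by simp
    finally show "fun_distr F (\<lambda>x. a * \<phi> x + b * \<theta> x) = cnj a * fun_distr F \<phi> + cnj b * fun_distr F \<theta>" .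
  qed (use assms s h in auto)
qed


subsection \<open>Bounds for the short-time Fourier transforms\<close>

text \<open>The gain comes from \<open>s > 1\<close>: an \<open>n\<close>-fold derivative of a monomial of degree \<open>N\<close> costs
  \<open>N! / (N - n)!\<close>, and bounding \<open>\<bar>y\<bar> ^ (N - n)\<close> by \<open>(N - n)!\<close> to the power \<open>s\<close> leaves \<open>N!\<close> to the
  power \<open>s\<close> times \<open>n!\<close> to the power \<open>1 - s\<close>.\<close>

lemma partials_mi_pow_bound:
  assumes "h > 0" "t > 0"
  obtains D Q where "D > 0" "Q > 0" "\<And>js \<alpha> y. cmod (partials js (\<lambda>x. complex_of_real (mi_pow x \<alpha>)) (y :: real ^ 'd)) \<le>
    (D * (Q ^ mi_abs \<alpha> * fact (mi_abs \<alpha>) powr s) * exp (norm y powr (1 / s))) * h ^ length js * fact (length js) powr t"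
proof
  \<comment> \<open>Splits \<open>fact k powr (1 - s)\<close> into \<open>fact k powr t\<close> and
    \<open>fact k powr (- \<sigma>)\<close>; as \<sigma> > 0, the latter is at most a constant
    \<open>D\<close> times \<open>h ^ k\<close>, however small \<open>h\<close> is.\<close>
  define \<sigma> where "\<sigma> = s + t - 1"
  have \<sigma>: "\<sigma> > 0" using s assms by (simp add: \<sigma>_def)
  define D where "D = exp (\<sigma> * (1 / h) powr (1 / \<sigma>))"
  define q where "q = (s / 1) powr s"
  \<comment> \<open>At least 1, so that \<open>q ^ ?M\<close> is dominated by \<open>Q ^ ?N\<close>
    for the larger degree \<open>?N\<close>.\<close>
  define Q where "Q = max 1 q"
  show "D > 0" "Q > 0" by (auto simp: D_def Q_def)
  fix js :: "'d list" and \<alpha> :: "'d \<Rightarrow> nat" and y :: "real ^ 'd"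
  let ?k = "length js" and ?N = "mi_abs \<alpha>" and ?E = "exp (norm y powr (1 / s))"
  obtain a \<beta> where eq: "partials js (\<lambda>x. complex_of_real (mi_pow x \<alpha>)) = (\<lambda>x. of_real a * complex_of_real (mi_pow x \<beta>))"
    and a: "0 \<le> a" "a * fact (mi_abs \<beta>) \<le> fact ?N" "a = 0 \<or> mi_abs \<beta> + ?k = ?N"
    using partials_mi_pow[of js \<alpha>] by blast
  let ?M = "mi_abs \<beta>"
  have q: "q > 0" using s by (simp add: q_def)
  have k: "1 \<le> h ^ ?k * fact ?k powr \<sigma> * D"
    using power_le_fact_powr_exp[of 1 h \<sigma> ?k] assms \<sigma> by (simp add: D_def)
  have *: "a * fact ?M powr s \<le> fact ?N powr s * (D * (h ^ ?k * fact ?k powr t))"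
    if "a \<noteq> 0"
  proof -
    have N: "?M + ?k = ?N" using a that by simp
    then have NM: "?N - ?k = ?M" "?k \<le> ?N" by auto
    have f: "fact ?k * fact ?M \<le> (fact ?N :: real)"
      using fact_mult_le_fact[OF NM(2)] by (simp only: NM(1))
    have "a * fact ?M powr s = (a * fact ?M) * fact ?M powr (s - 1)"
      by (simp add: powr_diff)
    also have "\<dots> \<le> fact ?N * fact ?M powr (s - 1)"
      using a by (intro mult_right_mono) auto
    also have "\<dots> \<le> fact ?N * (fact ?N / fact ?k) powr (s - 1)"
      using f s by (intro mult_left_mono powr_mono2) (auto simp: field_simps)
    also have "\<dots> = fact ?N powr s * fact ?k powr (1 - s)"
      by (simp add: powr_divide powr_diff field_simps)
    also have "\<dots> \<le> fact ?N powr s * (fact ?k powr (1 - s) * (h ^ ?k * fact ?k powr \<sigma> * D))"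
      using k by (intro mult_left_mono) (auto simp: mult_le_cancel_left1)
    also have "fact ?k powr (1 - s) * (h ^ ?k * fact ?k powr \<sigma> * D) = D * (h ^ ?k * (fact ?k powr (1 - s) * fact ?k powr \<sigma>))"
      by simp
    also have "fact ?k powr (1 - s) * fact ?k powr \<sigma> = (fact ?k powr t :: real)"
      by (simp add: powr_add[symmetric] \<sigma>_def)
    finally show ?thesis .
  qed
  have "cmod (partials js (\<lambda>x. complex_of_real (mi_pow x \<alpha>)) y) = a * \<bar>mi_pow y \<beta>\<bar>"
    using a by (simp add: eq norm_mult)
  also have "\<dots> \<le> a * (q ^ ?M * fact ?M powr s * exp (1 * norm y powr (1 / s)))"
    unfolding q_def using a by (intro mult_left_mono mi_pow_le_exp) auto
  also have "\<dots> = q ^ ?M * (a * fact ?M powr s) * ?E" by simp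
  also have "\<dots> \<le> Q ^ ?N * (fact ?N powr s * (D * (h ^ ?k * fact ?k powr t))) * ?E"
  proof (cases "a = 0")
    case True
    then show ?thesis using assms by (simp add: Q_def D_def)
  next
    case False
    then have "?M \<le> ?N" using a by linarith
    have "q ^ ?M \<le> Q ^ ?M" using q by (intro power_mono) (auto simp: Q_def)
    also have "\<dots> \<le> Q ^ ?N" using \<open>?M \<le> ?N\<close> by (intro power_increasing) (auto simp: Q_def)
    finally show ?thesis
      using a by (intro mult_right_mono mult_mono[OF _ *[OF False]]) (auto simp: Q_def)
  qed
  finally show "cmod (partials js (\<lambda>x. complex_of_real (mi_pow x \<alpha>)) y) \<le>
    (D * (Q ^ ?N * fact ?N powr s) * ?E) * h ^ ?k * fact ?k powr t"
    by (simp add: mult_ac)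
qed

definition V :: "(real ^ 'd \<Rightarrow> complex) \<Rightarrow> real ^ 'd \<Rightarrow> real ^ 'd \<Rightarrow> complex" where
  "V \<theta> x \<xi> = (\<integral>y. F y * (cnj (\<theta> (y - x)) * character (- \<xi>) y) \<partial>lborel)"

lemma exp_decaying_shift:
  assumes "exp_decaying (1 / s) \<theta>"
  shows "exp_decaying (1 / s) (\<lambda>y. \<theta> (y - x))"
  using exp_decaying_translate_modulate[OF assms, of x 0 0] s by (simp add: character_def)

text \<open>Moments in \<xi> are, term by term, integrals of derivatives of a monomial times the
  window, and both factors satisfy Gevrey bounds of order t at every ratio. The growth of the
  monomials is compared with that at \<open>x\<close>, which leaves the exponential in
  \<open>norm x\<close>.\<close>

lemma V_decay:
  fixes \<theta> :: "real ^ 'd \<Rightarrow> complex"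
  assumes \<theta>: "\<theta> \<in> gs_space s t" and "t > 0" "R > 0"
  obtains C where "C > 0" "\<And>x \<xi>. cmod (V \<theta> x \<xi>) \<le> C * exp (norm x powr (1 / s) - R * norm \<xi> powr (1 / t))"
proof -
  \<comment> \<open>Solves for the rate \<open>R\<close> in the moment bound; monomial and window
    each receive half of \<open>H\<close>.\<close>
  define H where "H = (t / (2 * R)) powr t / CARD('d)"
  have H: "H > 0" "t / (2 * (CARD('d) * H) powr (1 / t)) = R"
    using assms by (auto simp: H_def powr_powr)
  have h: "H / 2 > 0" using H by simp
  obtain D Q where "D > 0" "Q > 0" and mono: "\<And>js \<alpha> y. cmod (partials js (\<lambda>x. complex_of_real (mi_pow x \<alpha>)) (y :: real ^ 'd)) \<le>
    (D * (Q ^ mi_abs \<alpha> * fact (mi_abs \<alpha>) powr s) * exp (norm y powr (1 / s))) * (H / 2) ^ length js * fact (length js) powr t"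
    using partials_mi_pow_bound[OF h \<open>t > 0\<close>] by blast
  \<comment> \<open>One unit of decay moves the growth of the monomials from y to x, s units form
    \<open>w\<close>, and the rest is slack.\<close>
  have "s > 0" "2 + s > 0" using s by auto
  from gs_space_decay[OF \<theta> this(1) less_imp_le[OF \<open>t > 0\<close>] h this(2)] obtain B where "B > 0" and B:
    "\<And>js y. cmod (partials js \<theta> y) \<le> B * (H / 2) ^ length js * fact (length js) powr t * exp (- ((2 + s) * norm y powr (1 / s)))"
    by blast
  have sm\<theta>: "smooth_fun \<theta>" using \<theta> by (rule gs_space_smooth)
  have dec: "exp_decaying (1 / s) (\<lambda>y. \<theta> (y - x))" for x
    using gs_space_exp_decaying[OF \<theta> _ less_imp_le[OF \<open>t > 0\<close>]] s by (intro exp_decaying_shift) auto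
  define w where "w y = exp (- (1 / (1 / s) * norm y powr (1 / s)))" for y :: "real ^ 'd"
  have intw: "integrable lborel w" unfolding w_def[abs_def] using s by (intro integrable_exp_decay) auto
  define I where "I = (\<integral>y. w y \<partial>lborel)"
  have "I \<ge> 0" unfolding I_def by (intro integral_nonneg_AE) (auto simp: w_def)
  obtain J where J: "\<And>y. w y \<le> J * cauchy_weight y"
    using exp_decay_le_cauchy_weight[of "1 / s" 0] s unfolding w_def by auto
  define G where "G \<alpha> x y = complex_of_real (mi_pow y \<alpha>) * cnj (\<theta> (y - x))" for \<alpha> x y
  define A where "A \<alpha> = D * (Q ^ mi_abs \<alpha> * fact (mi_abs \<alpha>) powr s) * B" for \<alpha> :: "'d \<Rightarrow> nat"
  have A: "A \<alpha> \<ge> 0" for \<alpha> using \<open>D > 0\<close> \<open>Q > 0\<close> \<open>B > 0\<close> by (simp add: A_def)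
  have smt: "smooth_fun (\<lambda>y. cnj (\<theta> (y - x)))" for x
    using smooth_fun_cnj[OF smooth_fun_translate[OF sm\<theta>, of x]] by (simp add: translate_def)
  have smG: "smooth_fun (G \<alpha> x)" for \<alpha> x
    unfolding G_def by (intro smooth_fun_mult smooth_fun_mi_pow smt)
  have pG: "cmod (partials js (G \<alpha> x) y) \<le> A \<alpha> * H ^ length js * fact (length js) powr t * exp (norm y powr (1 / s) - (2 + s) * norm (y - x) powr (1 / s))"
    for js \<alpha> x y
  proof -
    have "cmod (partials js (G \<alpha> x) y) \<le> ((D * (Q ^ mi_abs \<alpha> * fact (mi_abs \<alpha>) powr s) * exp (norm y powr (1 / s))) *
       (B * exp (- ((2 + s) * norm (y - x) powr (1 / s))))) * (H / 2 + H / 2) ^ length js * fact (length js) powr t"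
      unfolding G_def
    proof (rule partials_mult_fact_bound)
      fix js
      have "partials js (\<lambda>y. cnj (\<theta> (y - x))) y = cnj (partials js \<theta> (y - x))"
        using partials_cnj[OF smooth_fun_translate[OF sm\<theta>, of x], of js] partials_translate[OF sm\<theta>, of js x]
        by (simp add: translate_def[abs_def] fun_eq_iff)
      then show "cmod (partials js (\<lambda>y. cnj (\<theta> (y - x))) y) \<le>
        B * exp (- ((2 + s) * norm (y - x) powr (1 / s))) * (H / 2) ^ length js * fact (length js) powr t"
        using B[of js "y - x"] by (simp add: mult_ac)
    qed (use H assms mono smt smooth_fun_mi_pow in auto)
    then show ?thesis by (simp add: A_def exp_diff exp_minus exp_add field_simps)
  qed
  have ew: "exp (norm y powr (1 / s) - (2 + s) * norm (y - x) powr (1 / s)) \<le> exp (norm x powr (1 / s)) * w (y - x)" for x y :: "real ^ 'd"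
  proof -
    have "norm y powr (1 / s) \<le> norm (y - x) powr (1 / s) + norm x powr (1 / s)"
      using s by (intro norm_powr_le_add) auto
    moreover have "norm (y - x) powr (1 / s) \<ge> 0" by simp
    ultimately have "norm y powr (1 / s) - (2 + s) * norm (y - x) powr (1 / s) \<le> norm x powr (1 / s) - s * norm (y - x) powr (1 / s)"
      unfolding distrib_right by linarith
    then show ?thesis by (simp add: w_def exp_add[symmetric])
  qed
  \<comment> \<open>This comparison, with its constant depending on x, only licenses the integration
    by parts; the integral of the shifted weight is independent of x.\<close>
  have ew2: "w (y - x) \<le> exp (s * norm x powr (1 / s)) * w y" for x y :: "real ^ 'd"
  proof -
    have "s * norm y powr (1 / s) \<le> s * (norm (y - x) powr (1 / s) + norm x powr (1 / s))"
      using s by (intro mult_left_mono norm_powr_le_add) auto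
    then show ?thesis by (simp add: w_def exp_add[symmetric] algebra_simps)
  qed
  have pG': "cmod (partials js (G \<alpha> x) y) \<le> A \<alpha> * H ^ length js * fact (length js) powr t * (exp (norm x powr (1 / s)) * w (y - x))"
    for js \<alpha> x y
    using H A[of \<alpha>] by (intro order_trans[OF pG] mult_left_mono ew) auto
  have FG: "\<bar>\<xi> $ k\<bar> ^ m * cmod (fourier_integral (G \<alpha> x) \<xi>) \<le> A \<alpha> * (H ^ m * fact m powr t * exp (norm x powr (1 / s)) * I)" for \<alpha> x \<xi> k m
  proof -
    have "w (y - x) \<le> exp (s * norm x powr (1 / s)) * (J * cauchy_weight y)" for y
      by (intro order_trans[OF ew2] mult_left_mono J) auto
    then have "exp (norm x powr (1 / s)) * w (y - x) \<le> (exp (norm x powr (1 / s)) * (exp (s * norm x powr (1 / s)) * J)) * cauchy_weight y" for y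
      by (simp add: mult.assoc)
    from fourier_integral_moments[OF smG _ this A H(1) pG', of \<xi> k m]
    show ?thesis
      using lborel_integrable_translate[OF intw, of "- x"] lborel_integral_translate[of w "- x"] intw
      by (simp add: I_def mult_ac)
  qed
  define S where "S = (\<Sum>\<^sub>\<infinity>\<alpha>. cmod (c \<alpha>) * (Q ^ mi_abs \<alpha> * fact (mi_abs \<alpha>) powr s))"
  have "S \<ge> 0" unfolding S_def using \<open>Q > 0\<close> by (intro infsum_nonneg) auto
  have VF: "V \<theta> x \<xi> = (\<Sum>\<^sub>\<infinity>\<alpha>. c \<alpha> * fourier_integral (G \<alpha> x) \<xi>)" for x \<xi>
    unfolding V_def fourier_integral_def G_def
    by (subst integral_F[OF dec continuous_on_character]) (simp_all add: mult.assoc)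
  define L where "L = D * B * S * I"
  have moments: "\<bar>\<xi> $ k\<bar> ^ m * cmod (V \<theta> x \<xi>) \<le> (L * exp (norm x powr (1 / s))) * H ^ m * fact m powr t" for x \<xi> k m
  proof -
    let ?X = "H ^ m * fact m powr t * exp (norm x powr (1 / s)) * I"
    let ?b = "\<lambda>\<alpha>. (D * B * ?X) * (cmod (c \<alpha>) * (Q ^ mi_abs \<alpha> * fact (mi_abs \<alpha>) powr s))"
    have sb: "?b summable_on UNIV"
      by (intro summable_on_cmult_right summable_coeffs_fact \<open>Q > 0\<close>)
    let ?f = "\<lambda>\<alpha>. complex_of_real (\<bar>\<xi> $ k\<bar> ^ m) * (c \<alpha> * fourier_integral (G \<alpha> x) \<xi>)"
    have fb: "cmod (?f \<alpha>) \<le> ?b \<alpha>" for \<alpha>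
    proof -
      have "cmod (?f \<alpha>) = cmod (c \<alpha>) * (\<bar>\<xi> $ k\<bar> ^ m * cmod (fourier_integral (G \<alpha> x) \<xi>))"
        by (simp add: norm_mult norm_power)
      also have "\<dots> \<le> cmod (c \<alpha>) * (A \<alpha> * ?X)" by (intro mult_left_mono FG) auto
      also have "\<dots> = ?b \<alpha>" by (simp add: A_def)
      finally show ?thesis .
    qed
    have sf: "?f summable_on UNIV"
      by (rule abs_summable_summable, rule summable_on_comparison_test[OF sb fb norm_ge_zero])
    have "\<bar>\<xi> $ k\<bar> ^ m * cmod (V \<theta> x \<xi>) = cmod (complex_of_real (\<bar>\<xi> $ k\<bar> ^ m) * V \<theta> x \<xi>)"
      by (simp add: norm_mult norm_power)
    also have "complex_of_real (\<bar>\<xi> $ k\<bar> ^ m) * V \<theta> x \<xi> = (\<Sum>\<^sub>\<infinity>\<alpha>. ?f \<alpha>)"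
      unfolding VF by (simp only: infsum_cmult_right')
    also have "cmod \<dots> \<le> (\<Sum>\<^sub>\<infinity>\<alpha>. ?b \<alpha>)"
      by (rule norm_infsum_le[OF has_sum_infsum[OF sf] has_sum_infsum[OF sb] fb])
    also have "\<dots> = (D * B * ?X) * S" unfolding S_def by (rule infsum_cmult_right')
    finally show ?thesis by (simp add: L_def mult_ac)
  qed
  have "L \<ge> 0" using \<open>D > 0\<close> \<open>B > 0\<close> \<open>S \<ge> 0\<close> \<open>I \<ge> 0\<close> by (simp add: L_def)
  have "cmod (V \<theta> x \<xi>) \<le> (2 powr t * L + 1) * exp (norm x powr (1 / s) - R * norm \<xi> powr (1 / t))" for x \<xi>
  proof -
    have "cmod (V \<theta> x \<xi>) \<le> 2 powr t * (L * exp (norm x powr (1 / s))) * exp (- (t / (2 * (CARD('d) * H) powr (1 / t)) * norm \<xi> powr (1 / t)))"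
      using \<open>L \<ge> 0\<close> H assms moments by (intro exp_decay_of_component_moments) auto
    also have "\<dots> = (2 powr t * L) * exp (norm x powr (1 / s) - R * norm \<xi> powr (1 / t))"
      unfolding H by (simp add: exp_diff exp_minus field_simps)
    finally show ?thesis by (simp add: distrib_right add_increasing2)
  qed
  moreover have "2 powr t * L + 1 > 0" using \<open>L \<ge> 0\<close> by (simp add: add_nonneg_pos)
  ultimately show ?thesis using that by blast
qed

text \<open>The pairing with \<open>u\<close> sees derivatives at the origin only. There the window
  is evaluated at - x, whence the decay in x, and the derivatives of the character produce the
  growth in \<xi>. No weight has to be translated, so every t > 0 is covered.\<close>

lemma u_stft_decay:
  fixes \<psi> :: "real ^ 'd \<Rightarrow> complex"
  assumes \<psi>: "\<psi> \<in> gs_space t s" and "t > 0" "R > 0"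
  obtains C where "C > 0" "\<And>x \<xi>. cmod (u (modulate \<xi> (translate x \<psi>))) \<le> C * exp (s * norm \<xi> powr (1 / s) - R * norm x powr (1 / t))"
proof -
  have sm: "smooth_fun \<psi>" using \<psi> by (rule gs_space_smooth)
  have "s \<ge> 0" using s by simp
  from gs_space_decay[OF \<psi> \<open>t > 0\<close> this zero_less_one \<open>R > 0\<close>] obtain B where "B > 0" and B:
    "\<And>js y. cmod (partials js \<psi> y) \<le> B * 1 ^ length js * fact (length js) powr s * exp (- (R * norm y powr (1 / t)))"
    by blast
  define S where "S = (\<Sum>\<^sub>\<infinity>\<alpha>. cmod (c \<alpha>) * (2 ^ mi_abs \<alpha> * fact (mi_abs \<alpha>) powr s))"
  have "S \<ge> 0" unfolding S_def by (intro infsum_nonneg) auto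
  have "cmod (u (modulate \<xi> (translate x \<psi>))) \<le> (B * S + 1) * exp (s * norm \<xi> powr (1 / s) - R * norm x powr (1 / t))" for x \<xi>
  proof -
    have eq: "modulate \<xi> (translate x \<psi>) = (\<lambda>y. character \<xi> y * translate x \<psi> y)"
      by (simp add: modulate_def[abs_def] character_def)
    have smt: "smooth_fun (translate x \<psi>)" by (intro smooth_fun_translate sm)
    have smp: "smooth_fun (\<lambda>y. character \<xi> y * translate x \<psi> y)"
      by (intro smooth_fun_mult smooth_fun_character smt)
    let ?B = "exp (s * norm \<xi> powr (1 / s)) * (B * exp (- (R * norm x powr (1 / t))))"
    have "cmod (mi_D \<alpha> (modulate \<xi> (translate x \<psi>)) 0) \<le> ?B * (2 ^ mi_abs \<alpha> * fact (mi_abs \<alpha>) powr s)" for \<alpha>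
    proof -
      obtain js where js: "count_list js = \<alpha>" by (rule ex_list_of_mi)
      have "cmod (mi_D \<alpha> (modulate \<xi> (translate x \<psi>)) 0) = cmod (partials js (\<lambda>y. character \<xi> y * translate x \<psi> y) 0)"
        unfolding js[symmetric] eq by (rule cmod_mi_D[OF smp])
      also have "\<dots> \<le> ?B * (1 + 1) ^ length js * fact (length js) powr s"
      proof (rule partials_mult_fact_bound[OF smooth_fun_character smt])
        show "cmod (partials js (character \<xi>) 0) \<le> exp (s * norm \<xi> powr (1 / s)) * 1 ^ length js * fact (length js) powr s" for js
          using partials_character_bound[of 1 s js \<xi> 0] s by simp
        show "cmod (partials js (translate x \<psi>) 0) \<le> B * exp (- (R * norm x powr (1 / t))) * 1 ^ length js * fact (length js) powr s" for js
          using B[of js "- x"] by (simp add: partials_translate[OF sm] translate_def mult_ac)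
      qed (use s in auto)
      finally show ?thesis by (simp add: js[symmetric] mi_abs_count_list)
    qed
    from u_bound(1)[OF this] have "cmod (u (modulate \<xi> (translate x \<psi>))) \<le> ?B * S" by (simp add: S_def)
    also have "\<dots> = (B * S) * exp (s * norm \<xi> powr (1 / s) - R * norm x powr (1 / t))"
      by (simp add: exp_diff exp_minus field_simps)
    finally show ?thesis by (simp add: distrib_right add_increasing2)
  qed
  moreover have "B * S + 1 > 0" using \<open>B > 0\<close> \<open>S \<ge> 0\<close> by (simp add: add_nonneg_pos)
  ultimately show ?thesis using that by blast
qed

end


section \<open>The wave front sets\<close>

lemma fourier_const_power2: "((2 * pi) powr (- real n / 2))\<^sup>2 * (2 * pi) ^ n = 1"
proof -
  have "((2 * pi) powr (- real n / 2))\<^sup>2 = (2 * pi) powr (- real n)"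
    by (simp only: power2_eq_square powr_add[symmetric]) simp
  moreover have "(2 * pi) ^ n = (2 * pi) powr real n" by (simp add: powr_realpow)
  ultimately show ?thesis by (simp only: powr_add[symmetric]) simp
qed

lemma inv_fourier_minus:
  "inv_fourier \<psi> (- \<xi>) = complex_of_real ((2 * pi) powr (- real CARD('d) / 2)) * fourier_integral \<psi> \<xi>"
  for \<xi> :: "real ^ 'd::finite"
  unfolding inv_fourier_eq fourier_integral_def
  by (simp only: character_minus_right character_commute[of _ \<xi>] character_commute[of "- _" \<xi>])

text \<open>Derivative bounds on \<open>\<psi>\<close> give moment bounds on its transform and thus
  decay, which in turn provides the integrability that inversion demands. The reflected inverse
  transform serves as the forward one.\<close>

lemma
  fixes \<psi> :: "real ^ 'd::finite \<Rightarrow> complex"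
  assumes \<psi>: "\<psi> \<in> gs_space t s" and "t > 0" "s > 0"
  shows exp_decaying_fourier: "exp_decaying (1 / s) (\<lambda>\<xi>. inv_fourier \<psi> (- \<xi>))"
    and inv_fourier_fourier: "inv_fourier (\<lambda>\<xi>. inv_fourier \<psi> (- \<xi>)) = \<psi>"
proof -
  let ?K = "(2 * pi) powr (- real CARD('d) / 2)"
  have sm: "smooth_fun \<psi>" using \<psi> by (rule gs_space_smooth)
  have e: "exp_decaying (1 / t) \<psi>" using assms by (intro gs_space_exp_decaying) auto
  have r: "rapid \<psi>" by (rule exp_decaying_rapid[OF e]) (use assms in simp)
  define w where "w y = exp (- (1 / (1 / t) * norm y powr (1 / t)))" for y :: "real ^ 'd"
  have intw: "integrable lborel w" unfolding w_def[abs_def] using assms by (intro integrable_exp_decay) auto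
  define I where "I = (\<integral>y. w y \<partial>lborel)"
  have "I \<ge> 0" unfolding I_def by (intro integral_nonneg_AE) (auto simp: w_def)
  obtain J where J: "\<And>y. w y \<le> J * cauchy_weight y"
    using exp_decay_le_cauchy_weight[of "1 / t" 0] assms unfolding w_def by auto
  show dec: "exp_decaying (1 / s) (\<lambda>\<xi>. inv_fourier \<psi> (- \<xi>))"
    unfolding exp_decaying_def
  proof (intro conjI allI impI)
    show "continuous_on UNIV (\<lambda>\<xi>. inv_fourier \<psi> (- \<xi>))"
      by (rule continuous_on_compose2[OF smooth_fun_continuous[OF smooth_fun_inv_fourier[OF r], of UNIV]])
        (auto intro!: continuous_intros)
    fix R :: real assume "R > 0"
    define H where "H = (s / (2 * R)) powr s / CARD('d)"
    have H: "H > 0" "s / (2 * (CARD('d) * H) powr (1 / s)) = R"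
      using assms \<open>R > 0\<close> by (auto simp: H_def powr_powr)
    obtain B where "B > 0" and B0: "\<And>is x. cmod (partials is \<psi> x) \<le>
      B * H ^ length is * fact (length is) powr s * exp (- (t * norm x powr (1 / t)))"
      using gs_space_decay[OF \<psi> \<open>t > 0\<close> less_imp_le[OF \<open>s > 0\<close>] H(1) \<open>t > 0\<close>] by blast
    then have B: "cmod (partials is \<psi> x) \<le> B * H ^ length is * fact (length is) powr s * w x" for "is" x
      by (simp add: w_def)
    have moments: "\<bar>\<xi> $ k\<bar> ^ m * cmod (fourier_integral \<psi> \<xi>) \<le> (B * I) * H ^ m * fact m powr s" for k m \<xi>
      unfolding I_def using \<open>B > 0\<close> by (intro fourier_integral_moments[OF sm intw J _ H(1)] B) auto
    have "cmod (inv_fourier \<psi> (- \<xi>)) \<le> (?K * (2 powr s * (B * I)) + 1) * exp (- (R * norm \<xi> powr (1 / s)))" for \<xi>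
    proof -
      have "cmod (fourier_integral \<psi> \<xi>) \<le> 2 powr s * (B * I) * exp (- (s / (2 * (CARD('d) * H) powr (1 / s)) * norm \<xi> powr (1 / s)))"
        using \<open>B > 0\<close> \<open>I \<ge> 0\<close> H assms moments by (intro exp_decay_of_component_moments) auto
      then have "?K * cmod (fourier_integral \<psi> \<xi>) \<le> ?K * (2 powr s * (B * I) * exp (- (R * norm \<xi> powr (1 / s))))"
        unfolding H by (intro mult_left_mono) auto
      moreover have "cmod (inv_fourier \<psi> (- \<xi>)) = ?K * cmod (fourier_integral \<psi> \<xi>)"
        by (simp add: inv_fourier_minus norm_mult)
      ultimately have "cmod (inv_fourier \<psi> (- \<xi>)) \<le> (?K * (2 powr s * (B * I))) * exp (- (R * norm \<xi> powr (1 / s)))"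
        by (simp only: mult.assoc)
      also have "\<dots> \<le> (?K * (2 powr s * (B * I)) + 1) * exp (- (R * norm \<xi> powr (1 / s)))"
        by (intro mult_right_mono) auto
      finally show ?thesis .
    qed
    moreover have "?K * (2 powr s * (B * I)) + 1 > 0" using \<open>B > 0\<close> \<open>I \<ge> 0\<close> by (simp add: add_nonneg_pos)
    ultimately show "\<exists>C>0. \<forall>\<xi>. cmod (inv_fourier \<psi> (- \<xi>)) \<le> C * exp (- (R * norm \<xi> powr (1 / s)))" by blast
  qed
  have r': "rapid (\<lambda>\<xi>. inv_fourier \<psi> (- \<xi>))" by (rule exp_decaying_rapid[OF dec]) (use assms in simp)
  have int: "integrable lborel \<psi>"
    using rapid_integrable[OF r, of "\<lambda>_. 1" 1 0] by simp
  have "integrable lborel (\<lambda>\<xi>. inv_fourier \<psi> (- \<xi>))"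
    using rapid_integrable[OF r', of "\<lambda>_. 1" 1 0] by simp
  from integrable_mult_right[OF this, of "1 / complex_of_real ?K"]
  have int': "integrable lborel (fourier_integral \<psi>)"
    unfolding inv_fourier_minus by simp
  have "inv_fourier (\<lambda>\<xi>. inv_fourier \<psi> (- \<xi>)) y = \<psi> y" for y
  proof -
    have cont: "isCont \<psi> y" using smooth_fun_continuous[OF sm, of UNIV] by (simp add: continuous_on_eq_continuous_at)
    have "inv_fourier (\<lambda>\<xi>. inv_fourier \<psi> (- \<xi>)) y = complex_of_real ?K * (complex_of_real ?K * (\<integral>\<xi>. fourier_integral \<psi> \<xi> * character y \<xi> \<partial>lborel))"
      unfolding inv_fourier_minus inv_fourier_eq[of _ y] by (simp add: character_commute[of _ y] mult.assoc)
    also have "\<dots> = complex_of_real (?K\<^sup>2 * (2 * pi) ^ CARD('d)) * \<psi> y"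
      unfolding fourier_inversion[OF int cont int'] by (simp add: power2_eq_square)
    finally show ?thesis unfolding fourier_const_power2 by simp
  qed
  then show "inv_fourier (\<lambda>\<xi>. inv_fourier \<psi> (- \<xi>)) = \<psi>" by blast
qed

lemma norm_dilation_powr:
  assumes "\<mu> > 0" "s > 0"
  shows "norm ((\<mu> powr s) *\<^sub>R x) powr (1 / s) = \<mu> * norm x powr (1 / s)"
  using assms by (simp add: powr_mult powr_powr)

context rapid_coeffs
begin

lemma V_eq_fourier_integral: "V \<theta> x \<xi> = fourier_integral (\<lambda>y. F y * cnj (\<theta> (y - x))) \<xi>"
  by (simp add: V_def fourier_integral_def mult.assoc)

lemma stft_F: "stft \<theta> (fun_distr F) x \<xi> = complex_of_real ((2 * pi) powr (- real CARD('d) / 2)) * V \<theta> x \<xi>"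
proof -
  have "cnj (modulate \<xi> (translate x \<theta>) y) = cnj (\<theta> (y - x)) * character (- \<xi>) y" for y
    using cnj_character[of \<xi> y] by (simp add: modulate_def translate_def character_def mult_ac)
  then show ?thesis by (simp only: stft_def fun_distr_def V_def)
qed

text \<open>Up to a unimodular factor, the Fourier transform rotates the time-frequency plane.\<close>

lemma cmod_u_modulate_translate:
  assumes "exp_decaying (1 / s) \<kappa>"
  shows "cmod (u (modulate \<xi> (translate x (inv_fourier \<kappa>)))) = (2 * pi) powr (- real CARD('d) / 2) * cmod (V \<kappa> \<xi> (- x))"
proof -
  let ?K = "(2 * pi) powr (- real CARD('d) / 2)"
  \<comment> \<open>Centring the character at \<xi>, like the window, makes the phase
    \<open>character \<xi> y\<close> factor out after the shift.\<close>
  define \<phi> where "\<phi> \<eta> = \<kappa> (\<eta> - \<xi>) * character (- x) (\<eta> - \<xi>)" for \<eta>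
  have [measurable]: "\<kappa> \<in> borel_measurable borel"
    using assms by (intro borel_measurable_continuous_onI) (auto simp: exp_decaying_def)
  have dec: "exp_decaying (1 / s) \<phi>"
    unfolding \<phi>_def[abs_def] using s by (intro exp_decaying_translate_modulate assms) auto
  have "modulate \<xi> (translate x (inv_fourier \<kappa>)) = inv_fourier \<phi>"
  proof
    fix y
    have "(\<integral>\<eta>. \<phi> \<eta> * character \<eta> y \<partial>lborel) = (\<integral>\<eta>. \<phi> (\<eta> + \<xi>) * character (\<eta> + \<xi>) y \<partial>lborel)"
      unfolding \<phi>_def by (subst lborel_integral_translate[of _ \<xi>, symmetric]) auto
    also have "\<dots> = (\<integral>\<eta>. character \<xi> y * (\<kappa> \<eta> * character \<eta> (y - x)) \<partial>lborel)"
    proof (rule Bochner_Integration.integral_cong[OF refl])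
      fix \<eta>
      have "character \<eta> (y - x) = character \<eta> y * character (- x) \<eta>"
        using character_add_right[of \<eta> y "- x"] by (simp add: character_commute[of \<eta> "- x"])
      then show "\<phi> (\<eta> + \<xi>) * character (\<eta> + \<xi>) y = character \<xi> y * (\<kappa> \<eta> * character \<eta> (y - x))"
        by (simp add: \<phi>_def character_add mult_ac)
    qed
    also have "\<dots> = character \<xi> y * (\<integral>\<eta>. \<kappa> \<eta> * character \<eta> (y - x) \<partial>lborel)" by simp
    finally show "modulate \<xi> (translate x (inv_fourier \<kappa>)) y = inv_fourier \<phi> y"
      by (simp add: modulate_def translate_def inv_fourier_eq character_def[of \<xi> y] mult_ac)
  qed
  then have "u (modulate \<xi> (translate x (inv_fourier \<kappa>))) = ?K * fun_distr F \<phi>"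
    using u_inv_fourier[OF dec] by simp
  also have "fun_distr F \<phi> = (\<integral>\<eta>. character x (- \<xi>) * (F \<eta> * (cnj (\<kappa> (\<eta> - \<xi>)) * character (- (- x)) \<eta>)) \<partial>lborel)"
    unfolding fun_distr_def
  proof (rule Bochner_Integration.integral_cong[OF refl])
    fix \<eta>
    have "cnj (character (- x) (\<eta> - \<xi>)) = character x \<eta> * character x (- \<xi>)"
      using character_add_right[of x \<eta> "- \<xi>"] by (simp add: cnj_character)
    then show "F \<eta> * cnj (\<phi> \<eta>) = character x (- \<xi>) * (F \<eta> * (cnj (\<kappa> (\<eta> - \<xi>)) * character (- (- x)) \<eta>))"
      by (simp add: \<phi>_def mult_ac)
  qed
  also have "\<dots> = character x (- \<xi>) * V \<kappa> \<xi> (- x)" by (simp add: V_def)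
  finally show ?thesis by (simp add: norm_mult)
qed

section \<open>Decay of F in cones against regularity of V\<close>

text \<open>The directions that \<open>V_set\<close> excludes, written with \<open>F\<close> in
  place of \<open>fourier_fun\<close>, from which it differs by a positive constant.\<close>

definition decay_directions :: "(real ^ 'd) set" where
  "decay_directions = {\<eta>. \<exists>\<Gamma>. open \<Gamma> \<and> \<Gamma> \<subseteq> - {0} \<and> (\<forall>\<xi>\<in>\<Gamma>. \<forall>\<mu>>0. \<mu> *\<^sub>R \<xi> \<in> \<Gamma>) \<and> \<eta> \<in> \<Gamma> \<and>
    (\<forall>r>0. \<exists>C. \<forall>\<xi>\<in>\<Gamma>. exp (r * norm \<xi> powr (1 / s)) * cmod (F \<xi>) \<le> C)}"

text \<open>Oriented as for \<open>F\<close>: position is dilated with exponent s and frequency with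
  t. The case of \<open>u\<close> is brought to this form by a rotation.\<close>

definition regular_on :: "(real ^ 'd \<Rightarrow> complex) \<Rightarrow> real \<Rightarrow> ((real ^ 'd) \<times> (real ^ 'd)) set \<Rightarrow> bool" where
  "regular_on \<theta> t U \<longleftrightarrow> (\<forall>r>0. \<exists>C. \<forall>\<mu> x \<xi>. \<mu> > 0 \<longrightarrow> (x, \<xi>) \<in> U \<longrightarrow>
    exp (r * \<mu>) * cmod (V \<theta> ((\<mu> powr s) *\<^sub>R x) ((\<mu> powr t) *\<^sub>R \<xi>)) \<le> C)"

text \<open>The order of quantifiers matters: the rate \<open>a\<close> of growth in position is
  fixed before the rate \<open>R\<close> of decay in frequency, which can then be taken as large as
  required.\<close>

definition V_bounded :: "(real ^ 'd \<Rightarrow> complex) \<Rightarrow> real \<Rightarrow> bool" where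
  "V_bounded \<theta> t \<longleftrightarrow> (\<exists>a>0. \<forall>R>0. \<exists>C>0. \<forall>x \<xi>. cmod (V \<theta> x \<xi>) \<le> C * exp (a * norm x powr (1 / s) - R * norm \<xi> powr (1 / t)))"

lemma regular_on_off_axis:
  assumes "V_bounded \<theta> t" "t > 0" "\<xi>0 \<noteq> 0"
  shows "\<exists>U. open U \<and> U \<subseteq> - {0} \<and> (x0, \<xi>0) \<in> U \<and> regular_on \<theta> t U"
proof (intro exI[of _ "ball x0 1 \<times> ball \<xi>0 (norm \<xi>0 / 2)"] conjI)
  obtain a where "a > 0" and a: "\<And>R. R > 0 \<Longrightarrow> \<exists>C>0. \<forall>x \<xi>. cmod (V \<theta> x \<xi>) \<le> C * exp (a * norm x powr (1 / s) - R * norm \<xi> powr (1 / t))"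
    using assms by (auto simp: V_bounded_def)
  define X where "X = (norm x0 + 1) powr (1 / s)"
  define e where "e = (norm \<xi>0 / 2) powr (1 / t)"
  have e: "e > 0" using assms by (simp add: e_def)
  show "regular_on \<theta> t (ball x0 1 \<times> ball \<xi>0 (norm \<xi>0 / 2))"
    unfolding regular_on_def
  proof (intro allI impI)
    fix r :: real assume "r > 0"
    \<comment> \<open>Large enough for decay in \<xi> to outweigh the prescribed rate
      \<open>r\<close> and the growth \<open>a * X\<close> on the ball; by homogeneity the balance
      persists under dilations.\<close>
    define R where "R = (r + a * X) / e"
    have "R > 0" using \<open>r > 0\<close> \<open>a > 0\<close> e by (auto simp: R_def X_def intro!: divide_pos_pos add_pos_nonneg)
    then obtain C where "C > 0" and C: "\<And>x \<xi>. cmod (V \<theta> x \<xi>) \<le> C * exp (a * norm x powr (1 / s) - R * norm \<xi> powr (1 / t))"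
      using a by blast
    have "exp (r * \<mu>) * cmod (V \<theta> ((\<mu> powr s) *\<^sub>R x) ((\<mu> powr t) *\<^sub>R \<xi>)) \<le> C"
      if "\<mu> > 0" and x: "(x, \<xi>) \<in> ball x0 1 \<times> ball \<xi>0 (norm \<xi>0 / 2)" for \<mu> x \<xi>
    proof -
      have "norm x \<le> norm x0 + 1"
        using x norm_triangle_sub[of x x0] by (auto simp: dist_norm norm_minus_commute)
      then have 1: "norm x powr (1 / s) \<le> X" unfolding X_def using s by (intro powr_mono2) auto
      have "norm \<xi>0 / 2 \<le> norm \<xi>"
        using x norm_triangle_sub[of \<xi>0 \<xi>] by (auto simp: dist_norm)
      then have 2: "e \<le> norm \<xi> powr (1 / t)" unfolding e_def using assms by (intro powr_mono2) auto
      have "r + a * norm x powr (1 / s) \<le> r + a * X" using 1 \<open>a > 0\<close> by simp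
      also have "\<dots> = R * e" using e by (simp add: R_def)
      also have "\<dots> \<le> R * norm \<xi> powr (1 / t)" using 2 \<open>R > 0\<close> by simp
      finally have "\<mu> * (r + a * norm x powr (1 / s) - R * norm \<xi> powr (1 / t)) \<le> 0"
        using \<open>\<mu> > 0\<close> by (intro mult_nonneg_nonpos) auto
      then have 3: "exp (r * \<mu> + (a * (\<mu> * norm x powr (1 / s)) - R * (\<mu> * norm \<xi> powr (1 / t)))) \<le> 1"
        by (simp add: algebra_simps)
      have "exp (r * \<mu>) * cmod (V \<theta> ((\<mu> powr s) *\<^sub>R x) ((\<mu> powr t) *\<^sub>R \<xi>)) \<le>
        exp (r * \<mu>) * (C * exp (a * (\<mu> * norm x powr (1 / s)) - R * (\<mu> * norm \<xi> powr (1 / t))))"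
      proof (rule mult_left_mono)
        have "0 < s" using s by simp
        show "cmod (V \<theta> ((\<mu> powr s) *\<^sub>R x) ((\<mu> powr t) *\<^sub>R \<xi>)) \<le> C * exp (a * (\<mu> * norm x powr (1 / s)) - R * (\<mu> * norm \<xi> powr (1 / t)))"
          using C[of "(\<mu> powr s) *\<^sub>R x" "(\<mu> powr t) *\<^sub>R \<xi>"]
          unfolding norm_dilation_powr[OF \<open>\<mu> > 0\<close> \<open>0 < s\<close>] norm_dilation_powr[OF \<open>\<mu> > 0\<close> \<open>t > 0\<close>] .
      qed simp
      also have "\<dots> = C * exp (r * \<mu> + (a * (\<mu> * norm x powr (1 / s)) - R * (\<mu> * norm \<xi> powr (1 / t))))"
        by (simp add: exp_add)
      also have "\<dots> \<le> C * 1" using \<open>C > 0\<close> 3 by (intro mult_left_mono) auto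
      finally show ?thesis by simp
    qed
    then show "\<exists>C. \<forall>\<mu> x \<xi>. \<mu> > 0 \<longrightarrow> (x, \<xi>) \<in> ball x0 1 \<times> ball \<xi>0 (norm \<xi>0 / 2) \<longrightarrow>
      exp (r * \<mu>) * cmod (V \<theta> ((\<mu> powr s) *\<^sub>R x) ((\<mu> powr t) *\<^sub>R \<xi>)) \<le> C" by blast
  qed
  show "ball x0 1 \<times> ball \<xi>0 (norm \<xi>0 / 2) \<subseteq> - {0}"
    using assms by (auto simp: zero_prod_def)
qed (use assms in \<open>auto intro: open_Times\<close>)

lemma integrable_V_integrand:
  assumes "exp_decaying (1 / s) \<theta>"
  shows "integrable lborel (\<lambda>y. F y * (cnj (\<theta> (y - x)) * character (- \<xi>) y))"
  by (rule integrable_F[OF exp_decaying_shift[OF assms] continuous_on_character]) simp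

text \<open>In the integral defining \<open>V \<theta> x\<close>, the decay of \<open>F\<close> in the cone controls the points within
  distance \<open>\<epsilon> \<bar>x\<bar>\<close> of \<open>x\<close> (up to constants), and the decay of \<open>\<theta>\<close> beats the growth of \<open>F\<close> elsewhere.\<close>

lemma regular_on_decay_directions:
  assumes \<theta>: "exp_decaying (1 / s) \<theta>" and x0: "x0 \<in> decay_directions"
  shows "\<exists>U. open U \<and> U \<subseteq> - {0} \<and> (x0, 0) \<in> U \<and> regular_on \<theta> t U"
proof -
  obtain \<Gamma> where \<Gamma>: "open \<Gamma>" "\<Gamma> \<subseteq> - {0}" "\<And>\<xi> \<mu>. \<xi> \<in> \<Gamma> \<Longrightarrow> \<mu> > 0 \<Longrightarrow> \<mu> *\<^sub>R \<xi> \<in> \<Gamma>" "x0 \<in> \<Gamma>"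
    and dec: "\<And>r. r > 0 \<Longrightarrow> \<exists>C. \<forall>\<xi>\<in>\<Gamma>. exp (r * norm \<xi> powr (1 / s)) * cmod (F \<xi>) \<le> C"
    using x0 by (auto simp: decay_directions_def)
  have "x0 \<noteq> 0" using \<Gamma> by auto
  obtain \<delta> where "\<delta> > 0" and \<delta>: "ball x0 \<delta> \<subseteq> \<Gamma>" using \<Gamma> open_contains_ball by blast
  \<comment> \<open>Twice \<epsilon> is room for a point near x, with x near \<open>x0\<close>, to
    remain in the cone; the quarter of \<open>norm x0\<close> keeps the norms of such points
    comparable to it.\<close>
  define \<epsilon> where "\<epsilon> = min (\<delta> / 2) (norm x0 / 4)"
  have \<epsilon>: "\<epsilon> > 0" "2 * \<epsilon> \<le> \<delta>" "\<epsilon> \<le> norm x0 / 4" using \<open>\<delta> > 0\<close> \<open>x0 \<noteq> 0\<close> by (auto simp: \<epsilon>_def)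
  define p where "p = 1 / s"
  have p: "0 < p" "p \<le> 1" using s by (auto simp: p_def)
  define w where "w y = exp (- (1 / p * norm y powr p))" for y :: "real ^ 'd"
  have intw: "integrable lborel w" unfolding w_def[abs_def] using p by (intro integrable_exp_decay) auto
  define I where "I = (\<integral>y. w y \<partial>lborel)"
  define X where "X = (2 * norm x0) powr p"
  show ?thesis
  proof (intro exI[of _ "ball x0 \<epsilon> \<times> UNIV"] conjI)
    show "ball x0 \<epsilon> \<times> UNIV \<subseteq> - {0}"
    proof -
      have "(0::real^'d) \<notin> ball x0 \<epsilon>" using \<epsilon> \<open>x0 \<noteq> 0\<close> by auto
      then show ?thesis by (auto simp: zero_prod_def)
    qed
    show "regular_on \<theta> t (ball x0 \<epsilon> \<times> UNIV)"
      unfolding regular_on_def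
    proof (intro allI impI)
      fix r :: real assume "r > 0"
      \<comment> \<open>Near the dilated x the weight of a point is at least \<mu> * (norm x0 / 2)
        powr p, so rate \<open>r1\<close> in the weight is rate \<open>r\<close> in \<mu>.\<close>
      define r1 where "r1 = r / (norm x0 / 2) powr p"
      have r1: "r1 > 0" "r1 * (norm x0 / 2) powr p = r" using \<open>r > 0\<close> \<open>x0 \<noteq> 0\<close> by (auto simp: r1_def)
      obtain C1 where C1: "\<And>\<xi>. \<xi> \<in> \<Gamma> \<Longrightarrow> exp (r1 * norm \<xi> powr p) * cmod (F \<xi>) \<le> C1"
        using dec[OF r1(1)] by (auto simp: p_def)
      have "0 \<le> C1" by (rule order_trans[OF _ C1[OF \<Gamma>(4)]]) auto
      \<comment> \<open>At distance \<mu>^s \<epsilon> or more, the first summand yields exp (- (r +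
        X) \<mu>); the summand 1 pays for the growth of \<open>F\<close> away from the centre, and 1
        / p keeps \<open>w\<close> for the integration.\<close>
      define R where "R = (r + X) / \<epsilon> powr p + 1 + 1 / p"
      have rX: "(r + X) / \<epsilon> powr p > 0" using \<open>r > 0\<close> \<epsilon> by (auto simp: X_def intro!: divide_pos_pos add_pos_nonneg)
      then have "R > 0" using p by (simp add: R_def add_pos_pos)
      then obtain C2 where "C2 > 0" and C2: "\<And>y. cmod (\<theta> y) \<le> C2 * exp (- (R * norm y powr p))"
        using \<theta> by (auto simp: exp_decaying_def p_def)
      define C where "C = (C1 + coeff_sum 1) * C2"
      have C: "C1 * C2 \<le> C" "coeff_sum 1 * C2 \<le> C"
        using \<open>0 \<le> C1\<close> \<open>C2 > 0\<close> coeff_sum_nonneg[of 1] by (auto simp: C_def distrib_right)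
      have "exp (r * \<mu>) * cmod (V \<theta> ((\<mu> powr s) *\<^sub>R x) ((\<mu> powr t) *\<^sub>R \<xi>)) \<le> C * I"
        if "\<mu> > 0" and x: "x \<in> ball x0 \<epsilon>" for \<mu> x \<xi>
      proof -
        let ?x = "(\<mu> powr s) *\<^sub>R x"
        have \<mu>s: "\<mu> powr s > 0" using \<open>\<mu> > 0\<close> by simp
        have dil: "norm ((\<mu> powr s) *\<^sub>R v) powr p = \<mu> * norm v powr p" for v :: "real ^ 'd"
          unfolding p_def using \<open>\<mu> > 0\<close> s by (intro norm_dilation_powr) auto
        have pt: "cmod (F y) * cmod (\<theta> (y - ?x)) \<le> C * exp (- (r * \<mu>)) * w (y - ?x)" for y
        proof -
          define z where "z = norm (y - ?x) powr p"
          have z: "z \<ge> 0" by (simp add: z_def)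
          have w: "w (y - ?x) = exp (- (1 / p * z))" by (simp add: w_def z_def)
          show ?thesis
          proof (cases "norm (y - ?x) < \<mu> powr s * \<epsilon>")
            case True
            define y' where "y' = y /\<^sub>R (\<mu> powr s)"
            have y: "y = (\<mu> powr s) *\<^sub>R y'" using \<mu>s by (simp add: y'_def)
            have "norm (y - ?x) = \<mu> powr s * norm (y' - x)" unfolding y using \<mu>s by (simp flip: scaleR_diff_right)
            then have "norm (y' - x) < \<epsilon>" using True \<mu>s by simp
            then have d: "dist x0 y' < 2 * \<epsilon>"
              using x dist_triangle[of x0 y' x] by (simp add: dist_norm norm_minus_commute)
            then have "y' \<in> \<Gamma>" using \<epsilon> \<delta> by auto
            then have "y \<in> \<Gamma>" unfolding y using \<mu>s by (intro \<Gamma>)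
            have "norm x0 / 2 \<le> norm y'"
              using d \<epsilon> norm_triangle_sub[of x0 y'] by (simp add: dist_norm)
            then have "(norm x0 / 2) powr p \<le> norm y' powr p" using p by (intro powr_mono2) auto
            then have "r1 * \<mu> * (norm x0 / 2) powr p \<le> r1 * \<mu> * norm y' powr p"
              using r1 \<open>\<mu> > 0\<close> by (intro mult_left_mono) auto
            then have "r * \<mu> \<le> r1 * norm y powr p"
              unfolding y dil r1(2)[symmetric] by (simp add: mult_ac)
            then have "exp (r * \<mu>) * cmod (F y) \<le> exp (r1 * norm y powr p) * cmod (F y)"
              by (intro mult_right_mono) auto
            also have "\<dots> \<le> C1" using \<open>y \<in> \<Gamma>\<close> by (rule C1)
            finally have 1: "cmod (F y) \<le> C1 * exp (- (r * \<mu>))" by (simp add: exp_minus field_simps)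
            have "1 / p * z \<le> R * z" using rX z by (intro mult_right_mono) (auto simp: R_def)
            then have "C2 * exp (- (R * z)) \<le> C2 * exp (- (1 / p * z))" using \<open>C2 > 0\<close> by simp
            then have 2: "cmod (\<theta> (y - ?x)) \<le> C2 * w (y - ?x)"
              unfolding w using C2[of "y - ?x"] by (simp add: z_def)
            have "cmod (F y) * cmod (\<theta> (y - ?x)) \<le> (C1 * exp (- (r * \<mu>))) * (C2 * w (y - ?x))"
              using 1 2 \<open>0 \<le> C1\<close> by (intro mult_mono) auto
            also have "\<dots> = (C1 * C2) * (exp (- (r * \<mu>)) * w (y - ?x))" by simp
            also have "\<dots> \<le> C * (exp (- (r * \<mu>)) * w (y - ?x))"
              using C by (intro mult_right_mono) (auto simp: w_def)
            finally show ?thesis by (simp add: mult_ac)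
          next
            case False
            then have "(\<mu> powr s * \<epsilon>) powr p \<le> z" unfolding z_def using p \<mu>s \<epsilon> by (intro powr_mono2) auto
            moreover have "(\<mu> powr s * \<epsilon>) powr p = \<mu> * \<epsilon> powr p"
              using s \<epsilon> \<open>\<mu> > 0\<close> by (simp add: powr_mult powr_powr p_def)
            ultimately have z1: "\<mu> * \<epsilon> powr p \<le> z" by simp
            have "norm x \<le> 2 * norm x0"
              using x \<epsilon> norm_triangle_sub[of x x0] by (simp add: dist_norm norm_minus_commute)
            then have "norm x powr p \<le> X" unfolding X_def using p by (intro powr_mono2) auto
            then have "\<mu> * norm x powr p \<le> \<mu> * X" using \<open>\<mu> > 0\<close> by simp
            then have "norm ?x powr p \<le> \<mu> * X" unfolding dil .
            moreover have "norm y powr p \<le> z + norm ?x powr p" unfolding z_def using p by (intro norm_powr_le_add) auto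
            ultimately have y: "norm y powr p \<le> z + \<mu> * X" by simp
            have "(r + X) * \<mu> = (r + X) / \<epsilon> powr p * (\<mu> * \<epsilon> powr p)" using \<epsilon> by simp
            also have "\<dots> \<le> (r + X) / \<epsilon> powr p * z" using rX z1 by (intro mult_left_mono) auto
            finally have "R * z \<ge> (r + X) * \<mu> + z + 1 / p * z" by (simp add: R_def distrib_right)
            then have ex: "norm y powr p - R * z \<le> - (r * \<mu>) - 1 / p * z" using y by (simp add: algebra_simps)
            have "cmod (F y) * cmod (\<theta> (y - ?x)) \<le> (coeff_sum 1 * exp (1 * norm y powr p)) * (C2 * exp (- (R * z)))"
              using F_growth[of 1 y] C2[of "y - ?x"] coeff_sum_nonneg[of 1]
              by (intro mult_mono) (auto simp: z_def p_def)
            also have "\<dots> = (coeff_sum 1 * C2) * exp (norm y powr p - R * z)"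
              by (simp add: exp_diff exp_minus field_simps)
            also have "\<dots> \<le> C * exp (- (r * \<mu>) - 1 / p * z)"
              using C ex coeff_sum_nonneg[of 1] \<open>C2 > 0\<close> \<open>0 \<le> C1\<close> by (intro mult_mono) (auto simp: C_def)
            finally show ?thesis unfolding w by (simp add: exp_diff exp_minus field_simps)
          qed
        qed
        have "cmod (V \<theta> ?x ((\<mu> powr t) *\<^sub>R \<xi>)) \<le> (\<integral>y. C * exp (- (r * \<mu>)) * w (y - ?x) \<partial>lborel)"
          unfolding V_def
        proof (rule norm_lebesgue_integral_le[OF integrable_V_integrand[OF \<theta>]])
          show "integrable lborel (\<lambda>y. C * exp (- (r * \<mu>)) * w (y - ?x))"
            using lborel_integrable_translate[OF intw, of "- ?x"] by simp
        qed (use pt in \<open>simp add: norm_mult\<close>)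
        also have "\<dots> = C * exp (- (r * \<mu>)) * I"
          using lborel_integral_translate[of w "- ?x"] intw by (simp add: I_def)
        finally show ?thesis by (simp add: exp_minus field_simps)
      qed
      then show "\<exists>C. \<forall>\<mu> x \<xi>. \<mu> > 0 \<longrightarrow> (x, \<xi>) \<in> ball x0 \<epsilon> \<times> UNIV \<longrightarrow>
        exp (r * \<mu>) * cmod (V \<theta> ((\<mu> powr s) *\<^sub>R x) ((\<mu> powr t) *\<^sub>R \<xi>)) \<le> C" by blast
    qed
  qed (use \<epsilon> in \<open>auto intro: open_Times\<close>)
qed


lemma exp_mult_le_imp: "exp b * v \<le> C \<Longrightarrow> v \<le> C * exp (- b)" for b v C :: real
  by (simp add: exp_minus divide_inverse[symmetric] pos_le_divide_eq mult.commute)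

text \<open>Fourier inversion in \<open>\<xi>\<close> recovers \<open>F y * cnj (\<theta> z)\<close> from \<open>V \<theta> (y - z)\<close>. Regularity
  controls only small \<open>\<xi>\<close>; for large \<open>\<xi>\<close> the global bound takes over.\<close>

lemma decay_directions_of_regular:
  assumes \<theta>: "exp_decaying (1 / s) \<theta>" and z: "\<theta> z \<noteq> 0" and Vb: "V_bounded \<theta> t" and "t > 0"
    and "x0 \<noteq> 0" and U: "open U" "(x0, 0) \<in> U" "regular_on \<theta> t U"
  shows "x0 \<in> decay_directions"
proof -
  have "s > 0" using s by simp
  have mz: "\<theta> \<in> borel_measurable borel"
    using \<theta> by (intro borel_measurable_continuous_onI) (auto simp: exp_decaying_def)
  note [measurable] = mz
  obtain A B where "open A" "open B" "(x0, 0) \<in> A \<times> B" "A \<times> B \<subseteq> U"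
    by (rule open_prod_elim[OF U(1,2)])
  then have AB: "open A" "open B" "x0 \<in> A" "0 \<in> B" "A \<times> B \<subseteq> U" by auto
  obtain eA where "eA > 0" "ball x0 eA \<subseteq> A" using openE[OF AB(1,3)] .
  obtain eB where "eB > 0" "ball 0 eB \<subseteq> B" using openE[OF AB(2,4)] .
  \<comment> \<open>The ball of twice this radius is still regular, which leaves room for the
    displacement of x by z / \<mu>^s.\<close>
  define \<epsilon> where "\<epsilon> = min (min (eA / 2) (eB / 2)) (norm x0 / 4)"
  have \<epsilon>: "\<epsilon> > 0" "2 * \<epsilon> \<le> eA" "2 * \<epsilon> \<le> eB" "\<epsilon> \<le> norm x0 / 4"
    using \<open>eA > 0\<close> \<open>eB > 0\<close> \<open>x0 \<noteq> 0\<close> by (auto simp: \<epsilon>_def)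
  have sub: "ball x0 (2 * \<epsilon>) \<times> ball 0 (2 * \<epsilon>) \<subseteq> U"
  proof -
    have "ball x0 (2 * \<epsilon>) \<subseteq> A" using \<epsilon>(2) \<open>ball x0 eA \<subseteq> A\<close> by (meson order_trans subset_ball)
    moreover have "ball 0 (2 * \<epsilon>) \<subseteq> B" using \<epsilon>(3) \<open>ball 0 eB \<subseteq> B\<close> by (meson order_trans subset_ball)
    ultimately show ?thesis using AB(5) by blast
  qed
  define \<Gamma> where "\<Gamma> = (\<Union>\<mu>\<in>{0<..}. (\<lambda>x. \<mu> *\<^sub>R x) ` ball x0 \<epsilon>)"
  have near: "norm x0 / 2 \<le> norm x \<and> norm x \<le> 2 * norm x0" if "x \<in> ball x0 (2 * \<epsilon>)" for x
    using that \<epsilon> norm_triangle_sub[of x0 x] norm_triangle_sub[of x x0] by (simp add: dist_norm norm_minus_commute)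
  have \<Gamma>: "open \<Gamma>" "x0 \<in> \<Gamma>" "\<And>\<xi> \<mu>. \<xi> \<in> \<Gamma> \<Longrightarrow> \<mu> > 0 \<Longrightarrow> \<mu> *\<^sub>R \<xi> \<in> \<Gamma>" "\<Gamma> \<subseteq> - {0}"
  proof -
    show "open \<Gamma>" unfolding \<Gamma>_def by (intro open_UN ballI open_scaling) auto
    have "1 *\<^sub>R x0 \<in> (\<lambda>x. 1 *\<^sub>R x) ` ball x0 \<epsilon>" using \<epsilon> by (intro imageI) simp
    then show "x0 \<in> \<Gamma>" unfolding \<Gamma>_def by (intro UN_I[of 1]) auto
    show "\<mu> *\<^sub>R \<xi> \<in> \<Gamma>" if "\<xi> \<in> \<Gamma>" "\<mu> > 0" for \<xi> \<mu>
    proof -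
      obtain l x where l: "l > 0" "x \<in> ball x0 \<epsilon>" "\<xi> = l *\<^sub>R x" using \<open>\<xi> \<in> \<Gamma>\<close> by (auto simp: \<Gamma>_def)
      have "\<mu> *\<^sub>R \<xi> = (\<mu> * l) *\<^sub>R x" using l by simp
      then show ?thesis unfolding \<Gamma>_def using l that by (intro UN_I[of "\<mu> * l"]) auto
    qed
    show "\<Gamma> \<subseteq> - {0}"
    proof
      fix y assume "y \<in> \<Gamma>"
      then obtain l x where l: "l > 0" "x \<in> ball x0 \<epsilon>" "y = l *\<^sub>R x" by (auto simp: \<Gamma>_def)
      then have "norm x0 / 2 \<le> norm x" using near[of x] \<epsilon> by auto
      then have "x \<noteq> 0" using \<open>x0 \<noteq> 0\<close> by auto
      then show "y \<in> - {0}" using l by simp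
    qed
  qed
  define p where "p = 1 / s"
  have p: "0 < p" "p \<le> 1" using s by (auto simp: p_def)
  define q where "q = 1 / t"
  have q: "q > 0" using \<open>t > 0\<close> by (simp add: q_def)
  define w where "w \<xi> = exp (- (1 / q * norm \<xi> powr q))" for \<xi> :: "real ^ 'd"
  have intw: "integrable lborel w" unfolding w_def[abs_def] using q by (intro integrable_exp_decay)
  define I where "I = (\<integral>y. w y \<partial>lborel)"
  have "I \<ge> 0" unfolding I_def by (intro integral_nonneg_AE) (auto simp: w_def)
  define X where "X = (2 * norm x0) powr p"
  have X: "X > 0" using \<open>x0 \<noteq> 0\<close> by (simp add: X_def)
  have Xle: "norm x powr p \<le> X" if "x \<in> ball x0 (2 * \<epsilon>)" for x
    unfolding X_def using near[OF that] p by (intro powr_mono2) auto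
  define E where "E = (2 * \<epsilon>) powr q"
  have E: "E > 0" using \<epsilon> by (simp add: E_def)
  obtain a where "a > 0" and a: "\<And>R. R > 0 \<Longrightarrow> \<exists>C>0. \<forall>x \<xi>. cmod (V \<theta> x \<xi>) \<le> C * exp (a * norm x powr p - R * norm \<xi> powr q)"
    using Vb by (auto simp: V_bounded_def p_def q_def)
  \<comment> \<open>From this dilation on, the fixed vector \<open>z\<close>, scaled back by
    \<mu>^s, has norm at most \<epsilon>; the summand 1 keeps \<mu> positive when z = 0.\<close>
  define \<mu>0 where "\<mu>0 = (norm z / \<epsilon>) powr (1 / s) + 1"
  have dil: "norm ((\<mu> powr s) *\<^sub>R v) powr p = \<mu> * norm v powr p" if "\<mu> > 0" for v :: "real ^ 'd" and \<mu>
    unfolding p_def using that \<open>s > 0\<close> by (rule norm_dilation_powr)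
  have dilt: "norm ((\<mu> powr t) *\<^sub>R v) powr q = \<mu> * norm v powr q" if "\<mu> > 0" for v :: "real ^ 'd" and \<mu>
    unfolding q_def using that \<open>t > 0\<close> by (rule norm_dilation_powr)
  have bound: "\<exists>C. \<forall>y\<in>\<Gamma>. exp (r * norm y powr p) * cmod (F y) \<le> C" if "r > 0" for r
  proof -
    \<comment> \<open>On the cone the weight of y is at most \<mu> * X, so decay at rate \<rho> in
      \<mu> gives rate \<open>r\<close> in the weight.\<close>
    define \<rho> where "\<rho> = r * X"
    have \<rho>: "\<rho> > 0" using that X by (simp add: \<rho>_def)
    \<comment> \<open>The additional E / q restores the integrable factor \<open>w\<close> at the
      frequencies with norm \<xi> powr q at most \<mu> * E.\<close>
    have "\<rho> + E / q > 0" using \<rho> E q by (simp add: add_pos_pos)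
    then obtain C1 where C1: "\<And>\<mu> x \<xi>. \<mu> > 0 \<Longrightarrow> (x, \<xi>) \<in> U \<Longrightarrow>
      exp ((\<rho> + E / q) * \<mu>) * cmod (V \<theta> ((\<mu> powr s) *\<^sub>R x) ((\<mu> powr t) *\<^sub>R \<xi>)) \<le> C1"
      using U(3) unfolding regular_on_def by blast
    have "0 \<le> C1" by (rule order_trans[OF _ C1[OF zero_less_one U(2)]]) auto
    \<comment> \<open>At the remaining frequencies the first summand beats the growth in position
      and gives rate \<rho>, while 1 / q leaves the factor \<open>w\<close>.\<close>
    define R where "R = (\<rho> + a * X) / E + 1 / q"
    have "(\<rho> + a * X) / E > 0" using \<rho> \<open>a > 0\<close> X E by (simp add: add_pos_pos)
    then have "R > 0" using q by (simp add: R_def add_pos_pos)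
    then obtain C2 where "C2 > 0" and C2: "\<And>x \<xi>. cmod (V \<theta> x \<xi>) \<le> C2 * exp (a * norm x powr p - R * norm \<xi> powr q)"
      using a by blast
    define C where "C = C1 + C2"
    have large: "cmod (F y) * cmod (\<theta> z) * (2 * pi) ^ CARD('d) \<le> C * I * exp (- (\<rho> * \<mu>))"
      if \<mu>: "\<mu> \<ge> \<mu>0" and x: "x \<in> ball x0 \<epsilon>" and y: "y = (\<mu> powr s) *\<^sub>R x" for \<mu> x y
    proof -
      have "\<mu>0 \<ge> 1" by (simp add: \<mu>0_def)
      then have "\<mu> > 0" using \<mu> by linarith
      have \<mu>s: "\<mu> powr s > 0" using \<open>\<mu> > 0\<close> by simp
      define x' where "x' = x - z /\<^sub>R (\<mu> powr s)"
      have yz: "y - z = (\<mu> powr s) *\<^sub>R x'" using \<mu>s by (simp add: x'_def y scaleR_diff_right)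
      have "norm z / \<epsilon> \<le> \<mu> powr s"
      proof -
        have "norm z / \<epsilon> = ((norm z / \<epsilon>) powr (1 / s)) powr s" using s \<epsilon> by (simp add: powr_powr)
        also have "\<dots> \<le> \<mu> powr s" using \<mu> s by (intro powr_mono2) (auto simp: \<mu>0_def)
        finally show ?thesis .
      qed
      then have "norm (z /\<^sub>R (\<mu> powr s)) \<le> \<epsilon>" using \<mu>s \<epsilon> by (simp add: field_simps)
      then have x': "x' \<in> ball x0 (2 * \<epsilon>)"
        using x norm_triangle_ineq[of "x0 - x" "z /\<^sub>R (\<mu> powr s)"] by (simp add: x'_def dist_norm algebra_simps)
      have Vx: "cmod (V \<theta> (y - z) \<xi>) \<le> C * exp (- (\<rho> * \<mu>)) * w \<xi>" for \<xi>
      proof -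
        define \<xi>' where "\<xi>' = \<xi> /\<^sub>R (\<mu> powr t)"
        have \<xi>: "\<xi> = (\<mu> powr t) *\<^sub>R \<xi>'" using \<open>\<mu> > 0\<close> by (simp add: \<xi>'_def)
        have n\<xi>: "norm \<xi> powr q = \<mu> * norm \<xi>' powr q" unfolding \<xi> by (rule dilt[OF \<open>\<mu> > 0\<close>])
        show ?thesis
        proof (cases "\<xi>' \<in> ball 0 (2 * \<epsilon>)")
          case True
          then have "norm \<xi>' powr q \<le> E" unfolding E_def using q by (intro powr_mono2) auto
          then have "\<mu> * norm \<xi>' powr q \<le> \<mu> * E" using \<open>\<mu> > 0\<close> by simp
          then have le: "norm \<xi> powr q / q \<le> \<mu> * E / q" unfolding n\<xi> using q by (intro divide_right_mono) auto
          have "exp ((\<rho> + E / q) * \<mu>) * cmod (V \<theta> (y - z) \<xi>) \<le> C1"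
            unfolding yz \<xi> using x' True sub by (intro C1 \<open>\<mu> > 0\<close>) auto
          then have "cmod (V \<theta> (y - z) \<xi>) \<le> C1 * exp (- ((\<rho> + E / q) * \<mu>))"
            by (rule exp_mult_le_imp)
          also have "\<dots> \<le> C * exp (- (\<rho> * \<mu>) - norm \<xi> powr q / q)"
            using le \<open>0 \<le> C1\<close> \<open>C2 > 0\<close> by (intro mult_mono) (auto simp: C_def algebra_simps)
          finally show ?thesis by (simp add: w_def exp_diff exp_minus field_simps)
        next
          case False
          then have "E \<le> norm \<xi>' powr q" unfolding E_def using q \<epsilon> by (intro powr_mono2) auto
          then have "\<mu> * E \<le> norm \<xi> powr q" unfolding n\<xi> using \<open>\<mu> > 0\<close> by simp
          then have "(\<rho> + a * X) / E * (\<mu> * E) \<le> (\<rho> + a * X) / E * norm \<xi> powr q"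
            using \<open>(\<rho> + a * X) / E > 0\<close> by (intro mult_left_mono) auto
          moreover have "(\<rho> + a * X) / E * (\<mu> * E) = (\<rho> + a * X) * \<mu>" using E by simp
          ultimately have 1: "(\<rho> + a * X) * \<mu> + norm \<xi> powr q / q \<le> R * norm \<xi> powr q"
            unfolding R_def distrib_right[of "(\<rho> + a * X) / E"] by simp
          have "\<mu> * norm x' powr p \<le> \<mu> * X" using Xle[OF x'] \<open>\<mu> > 0\<close> by simp
          then have "a * norm (y - z) powr p \<le> a * (\<mu> * X)"
            unfolding yz dil[OF \<open>\<mu> > 0\<close>] using \<open>a > 0\<close> by simp
          then have 2: "a * norm (y - z) powr p - R * norm \<xi> powr q \<le> - (\<rho> * \<mu>) - norm \<xi> powr q / q"
            using 1 by (simp add: algebra_simps)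
          have "cmod (V \<theta> (y - z) \<xi>) \<le> C2 * exp (a * norm (y - z) powr p - R * norm \<xi> powr q)" by (rule C2)
          also have "\<dots> \<le> C * exp (- (\<rho> * \<mu>) - norm \<xi> powr q / q)"
            using 2 \<open>0 \<le> C1\<close> \<open>C2 > 0\<close> by (intro mult_mono) (auto simp: C_def)
          finally show ?thesis by (simp add: w_def exp_diff exp_minus field_simps)
        qed
      qed
      define h where "h v = F v * cnj (\<theta> (v - (y - z)))" for v
      have inth: "integrable lborel h"
        unfolding h_def[abs_def] by (intro integrable_F_cnj exp_decaying_shift \<theta>)
      have conth: "isCont h y"
      proof -
        have "continuous_on UNIV h"
          unfolding h_def[abs_def] using exp_decaying_shift[OF \<theta>, of "y - z"]
          by (intro continuous_intros continuous_on_F) (auto simp: exp_decaying_def)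
        then show ?thesis by (simp add: continuous_on_eq_continuous_at)
      qed
      have Vh: "fourier_integral h \<xi> = V \<theta> (y - z) \<xi>" for \<xi>
        by (simp add: V_eq_fourier_integral h_def[abs_def])
      have [measurable]: "h \<in> borel_measurable borel" using inth by auto
      have mV: "fourier_integral h \<in> borel_measurable lborel"
        unfolding fourier_integral_def[abs_def] by measurable
      have int': "integrable lborel (fourier_integral h)"
        by (rule Bochner_Integration.integrable_bound[OF integrable_mult_right[OF intw, of "C * exp (- (\<rho> * \<mu>))"] mV])
          (use order_trans[OF Vx abs_ge_self] in \<open>auto simp: Vh\<close>)
      have "cmod (F y) * cmod (\<theta> z) * (2 * pi) ^ CARD('d) = cmod ((2 * pi) ^ CARD('d) * h y)"
        by (simp add: h_def norm_mult norm_power)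
      also have "\<dots> = cmod (\<integral>\<xi>. fourier_integral h \<xi> * character y \<xi> \<partial>lborel)"
        unfolding fourier_inversion[OF inth conth int'] by simp
      also have "\<dots> \<le> (\<integral>\<xi>. C * exp (- (\<rho> * \<mu>)) * w \<xi> \<partial>lborel)"
      proof (rule norm_lebesgue_integral_le)
        show "integrable lborel (\<lambda>\<xi>. fourier_integral h \<xi> * character y \<xi>)"
          by (rule Bochner_Integration.integrable_bound[OF int']) (use mV in \<open>auto simp: norm_mult\<close>)
        show "norm (fourier_integral h \<xi> * character y \<xi>) \<le> C * exp (- (\<rho> * \<mu>)) * w \<xi>" for \<xi>
          using Vx[of \<xi>] by (simp add: norm_mult Vh)
      qed (use intw in simp)
      finally show ?thesis by (simp add: I_def mult_ac)
    qed
    define C3 where "C3 = C * I / (cmod (\<theta> z) * (2 * pi) ^ CARD('d))"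
    \<comment> \<open>Covers the part of the cone with \<mu> < \<mu>0; it is bounded, so the general
      growth bound of \<open>F\<close> does.\<close>
    define C4 where "C4 = coeff_sum 1 * exp ((r + 1) * (\<mu>0 * X))"
    have C34: "0 \<le> C3" "0 \<le> C4"
      using \<open>0 \<le> C1\<close> \<open>C2 > 0\<close> \<open>I \<ge> 0\<close> coeff_sum_nonneg[of 1] by (simp_all add: C3_def C4_def C_def)
    have "exp (r * norm y powr p) * cmod (F y) \<le> C3 + C4" if "y \<in> \<Gamma>" for y
    proof -
      obtain l x where l: "l > 0" "x \<in> ball x0 \<epsilon>" "y = l *\<^sub>R x" using \<open>y \<in> \<Gamma>\<close> by (auto simp: \<Gamma>_def)
      define \<mu> where "\<mu> = l powr (1 / s)"
      have "\<mu> > 0" "\<mu> powr s = l" using l s by (auto simp: \<mu>_def powr_powr)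
      then have y: "y = (\<mu> powr s) *\<^sub>R x" using l by simp
      have "x \<in> ball x0 (2 * \<epsilon>)" using l \<epsilon> by auto
      then have yp: "norm y powr p \<le> \<mu> * X" unfolding y dil[OF \<open>\<mu> > 0\<close>] using Xle \<open>\<mu> > 0\<close> by simp
      show ?thesis
      proof (cases "\<mu> \<ge> \<mu>0")
        case True
        have "cmod (F y) * (cmod (\<theta> z) * (2 * pi) ^ CARD('d)) \<le> C * I * exp (- (\<rho> * \<mu>))"
          using large[OF True l(2) y] by (simp add: mult.assoc)
        moreover have "0 < cmod (\<theta> z) * (2 * pi) ^ CARD('d)" using z by simp
        ultimately have "cmod (F y) \<le> C * I * exp (- (\<rho> * \<mu>)) / (cmod (\<theta> z) * (2 * pi) ^ CARD('d))"
          by (subst pos_le_divide_eq)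
        then have 1: "cmod (F y) \<le> C3 * exp (- (\<rho> * \<mu>))" by (simp add: C3_def)
        have "r * norm y powr p \<le> r * (\<mu> * X)" using yp \<open>r > 0\<close> by (intro mult_left_mono) auto
        also have "\<dots> = \<rho> * \<mu>" by (simp add: \<rho>_def)
        finally have "exp (r * norm y powr p) \<le> exp (\<rho> * \<mu>)" by simp
        then have "exp (r * norm y powr p) * cmod (F y) \<le> exp (\<rho> * \<mu>) * (C3 * exp (- (\<rho> * \<mu>)))"
          using 1 by (intro mult_mono) auto
        also have "\<dots> = C3" by (simp add: exp_minus field_simps)
        finally show ?thesis using C34 by simp
      next
        case False
        then have "\<mu> * X \<le> \<mu>0 * X" using X by (intro mult_right_mono) auto
        then have yp': "norm y powr p \<le> \<mu>0 * X" using yp by simp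
        have "exp (r * norm y powr p) * cmod (F y) \<le> exp (r * norm y powr p) * (coeff_sum 1 * exp (1 * norm y powr p))"
          using F_growth[of 1 y] by (intro mult_left_mono) (auto simp: p_def)
        also have "\<dots> = coeff_sum 1 * exp ((r + 1) * norm y powr p)"
          by (simp add: distrib_right exp_add)
        also have "\<dots> \<le> C4"
          unfolding C4_def using yp' \<open>r > 0\<close> coeff_sum_nonneg[of 1] by (intro mult_left_mono) auto
        finally show ?thesis using C34 by simp
      qed
    qed
    then show ?thesis by blast
  qed
  show ?thesis
    unfolding decay_directions_def using \<Gamma> bound unfolding p_def by blast
qed

lemma irregular_points:
  assumes \<theta>: "exp_decaying (1 / s) \<theta>" and z: "\<theta> z \<noteq> 0" and Vb: "V_bounded \<theta> t" and "t > 0"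
  shows "{v. v \<noteq> 0 \<and> \<not> (\<exists>U. open U \<and> U \<subseteq> - {0} \<and> v \<in> U \<and> regular_on \<theta> t U)} =
    {\<eta>. \<eta> \<noteq> 0 \<and> \<eta> \<notin> decay_directions} \<times> {0}"
proof (intro set_eqI iffI)
  fix v assume v: "v \<in> {v. v \<noteq> 0 \<and> \<not> (\<exists>U. open U \<and> U \<subseteq> - {0} \<and> v \<in> U \<and> regular_on \<theta> t U)}"
  obtain x \<xi> where xi: "v = (x, \<xi>)" by (cases v)
  have "\<xi> = 0" using v regular_on_off_axis[OF Vb \<open>t > 0\<close>, of \<xi> x] xi by blast
  moreover have "x \<notin> decay_directions" using v regular_on_decay_directions[OF \<theta>, of x t] xi \<open>\<xi> = 0\<close> by blast
  moreover have "x \<noteq> 0" using v xi \<open>\<xi> = 0\<close> by (auto simp: zero_prod_def)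
  ultimately show "v \<in> {\<eta>. \<eta> \<noteq> 0 \<and> \<eta> \<notin> decay_directions} \<times> {0}" using xi by simp
next
  fix v assume "v \<in> {\<eta>. \<eta> \<noteq> 0 \<and> \<eta> \<notin> decay_directions} \<times> {0::real^'d}"
  then obtain x where x: "v = (x, 0)" "x \<noteq> 0" "x \<notin> decay_directions" by auto
  then show "v \<in> {v. v \<noteq> 0 \<and> \<not> (\<exists>U. open U \<and> U \<subseteq> - {0} \<and> v \<in> U \<and> regular_on \<theta> t U)}"
    using decay_directions_of_regular[OF \<theta> z Vb \<open>t > 0\<close> x(2)] by (auto simp: zero_prod_def)
qed

section \<open>Identification of V_s(u)\<close>

text \<open>The point is uniqueness. A product with vanishing Fourier transform satisfies the
  integrability hypothesis of the inversion theorem trivially, so no growth condition on a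
  competitor \<open>g\<close> enters.\<close>

lemma fourier_fun_u:
  fixes \<theta> :: "real ^ 'd \<Rightarrow> complex"
  assumes \<theta>: "\<theta> \<in> gs_space s t" and z: "\<theta> z \<noteq> 0" and "t > 0"
  shows "fourier_fun t s u = (\<lambda>\<xi>. complex_of_real ((2 * pi) powr (- real CARD('d) / 2)) * F \<xi>)"
  unfolding fourier_fun_def
proof (rule the_equality)
  let ?K = "complex_of_real ((2 * pi) powr (- real CARD('d) / 2))"
  have dec: "exp_decaying (1 / s) \<phi>" if "\<phi> \<in> gs_space s t" for \<phi> :: "real ^ 'd \<Rightarrow> complex"
    using that s \<open>t > 0\<close> by (intro gs_space_exp_decaying) auto
  have KF: "integrable lborel (\<lambda>\<xi>. ?K * F \<xi> * cnj (\<phi> \<xi>))" "distr_fourier u \<phi> = fun_distr (\<lambda>\<xi>. ?K * F \<xi>) \<phi>"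
    if "\<phi> \<in> gs_space s t" for \<phi>
    using integrable_F_cnj[OF dec[OF that]] u_inv_fourier[OF dec[OF that]]
    by (simp_all add: distr_fourier_def fun_distr_def mult.assoc)
  then show "continuous_on UNIV (\<lambda>\<xi>. ?K * F \<xi>) \<and> (\<forall>\<phi>\<in>gs_space s t.
      integrable lborel (\<lambda>\<xi>. ?K * F \<xi> * cnj (\<phi> \<xi>)) \<and> distr_fourier u \<phi> = fun_distr (\<lambda>\<xi>. ?K * F \<xi>) \<phi>)"
    by (intro conjI continuous_intros continuous_on_F) auto
  fix g assume g: "continuous_on UNIV g \<and> (\<forall>\<phi>\<in>gs_space s t.
      integrable lborel (\<lambda>\<xi>. g \<xi> * cnj (\<phi> \<xi>)) \<and> distr_fourier u \<phi> = fun_distr g \<phi>)"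
  define D where "D \<xi> = g \<xi> - ?K * F \<xi>" for \<xi>
  have D: "integrable lborel (\<lambda>\<xi>. D \<xi> * cnj (\<phi> \<xi>))" "(\<integral>\<xi>. D \<xi> * cnj (\<phi> \<xi>) \<partial>lborel) = 0"
    if "\<phi> \<in> gs_space s t" for \<phi>
  proof -
    have eq: "(\<lambda>\<xi>. D \<xi> * cnj (\<phi> \<xi>)) = (\<lambda>\<xi>. g \<xi> * cnj (\<phi> \<xi>) - ?K * F \<xi> * cnj (\<phi> \<xi>))"
      by (simp add: D_def left_diff_distrib)
    have i: "integrable lborel (\<lambda>\<xi>. g \<xi> * cnj (\<phi> \<xi>))" "fun_distr g \<phi> = fun_distr (\<lambda>\<xi>. ?K * F \<xi>) \<phi>"
      using g that KF(2)[OF that] by auto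
    show "integrable lborel (\<lambda>\<xi>. D \<xi> * cnj (\<phi> \<xi>))"
      unfolding eq by (intro Bochner_Integration.integrable_diff i KF that)
    show "(\<integral>\<xi>. D \<xi> * cnj (\<phi> \<xi>) \<partial>lborel) = 0"
      unfolding eq Bochner_Integration.integral_diff[OF i(1) KF(1)[OF that]] using i(2) by (simp add: fun_distr_def)
  qed
  have contD: "continuous_on UNIV D"
    unfolding D_def[abs_def] using g by (intro continuous_intros continuous_on_F) auto
  \<comment> \<open>All translates and modulates of \<open>\<theta>\<close> are test functions, so the Fourier transform of
    \<open>D\<close> times any translate of \<open>\<theta>\<close> vanishes.\<close>
  have "D y = 0" for y
  proof -
    \<comment> \<open>Places the nonzero value of the window at \<open>y\<close>, where it can be
      divided out.\<close>
    define x where "x = y - z"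
    define h where "h v = D v * cnj (translate x \<theta> v)" for v
    have tr: "translate x \<theta> \<in> gs_space s t"
      using s \<open>t > 0\<close> by (intro gs_space_translate \<theta>) auto
    have inth: "integrable lborel h" unfolding h_def[abs_def] by (rule D(1)[OF tr])
    have zero: "fourier_integral h \<xi> = 0" for \<xi>
    proof -
      have "modulate \<xi> (translate x \<theta>) \<in> gs_space s t"
        using s \<open>t > 0\<close> by (intro gs_space_modulate tr) auto
      moreover have "D v * cnj (modulate \<xi> (translate x \<theta>) v) = h v * character (- \<xi>) v" for v
        using cnj_character[of \<xi> v] by (simp add: h_def modulate_def character_def mult_ac)
      ultimately show ?thesis using D(2)[of "modulate \<xi> (translate x \<theta>)"]
        by (simp only: fourier_integral_def)
    qed
    have "continuous_on UNIV h"
      unfolding h_def[abs_def] by (intro continuous_intros contD smooth_fun_continuous gs_space_smooth[OF tr])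
    then have conth: "isCont h y" by (simp add: continuous_on_eq_continuous_at)
    have "(2 * pi) ^ CARD('d) * h y = 0"
    proof -
      have "fourier_integral h = (\<lambda>_. 0)" using zero by blast
      then show ?thesis using fourier_inversion[OF inth conth] by simp
    qed
    then have "h y = 0" by simp
    then show ?thesis using z by (simp add: h_def translate_def x_def)
  qed
  then show "g = (\<lambda>\<xi>. ?K * F \<xi>)" by (auto simp: D_def fun_eq_iff)
qed

lemma V_set_u:
  fixes \<theta> :: "real ^ 'd \<Rightarrow> complex"
  assumes "\<theta> \<in> gs_space s t" "\<theta> z \<noteq> 0" "t > 0"
  shows "V_set t s u = {\<eta>. \<eta> \<noteq> 0 \<and> \<eta> \<notin> decay_directions}"
proof -
  let ?K = "(2 * pi) powr (- real CARD('d) / 2)"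
  have "bdd_above ((\<lambda>\<xi>. exp (r * norm \<xi> powr (1 / s)) * cmod (fourier_fun t s u \<xi>)) ` \<Gamma>) \<longleftrightarrow>
      (\<exists>C. \<forall>\<xi>\<in>\<Gamma>. exp (r * norm \<xi> powr (1 / s)) * cmod (F \<xi>) \<le> C)" (is "?L \<longleftrightarrow> ?R") for \<Gamma> r
  proof -
    have eq: "exp (r * norm \<xi> powr (1 / s)) * cmod (fourier_fun t s u \<xi>) = ?K * (exp (r * norm \<xi> powr (1 / s)) * cmod (F \<xi>))" for \<xi>
      unfolding fourier_fun_u[OF assms] by (simp add: norm_mult)
    have K: "?K > 0" by simp
    have "?L \<longleftrightarrow> (\<exists>C. \<forall>\<xi>\<in>\<Gamma>. ?K * (exp (r * norm \<xi> powr (1 / s)) * cmod (F \<xi>)) \<le> C)"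
      unfolding eq by (auto simp: bdd_above_def)
    also have "\<dots> \<longleftrightarrow> (\<exists>C. \<forall>\<xi>\<in>\<Gamma>. exp (r * norm \<xi> powr (1 / s)) * cmod (F \<xi>) \<le> C / ?K)"
    proof -
      have "?K * v \<le> C \<longleftrightarrow> v \<le> C / ?K" for v C
        unfolding pos_le_divide_eq[OF K] by (simp only: mult.commute)
      then show ?thesis by (simp only:)
    qed
    also have "\<dots> \<longleftrightarrow> ?R"
    proof
      assume ?R
      then obtain C where "\<forall>\<xi>\<in>\<Gamma>. exp (r * norm \<xi> powr (1 / s)) * cmod (F \<xi>) \<le> C" ..
      then have "\<forall>\<xi>\<in>\<Gamma>. exp (r * norm \<xi> powr (1 / s)) * cmod (F \<xi>) \<le> (C * ?K) / ?K" using K by simp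
      then show "\<exists>C. \<forall>\<xi>\<in>\<Gamma>. exp (r * norm \<xi> powr (1 / s)) * cmod (F \<xi>) \<le> C / ?K" ..
    qed blast
    finally show ?thesis .
  qed
  then show ?thesis unfolding V_set_def decay_directions_def by simp
qed

text \<open>Serves both wave front sets: \<open>T\<close> is the identity for \<open>F\<close> and a
  quarter turn of phase space for \<open>u\<close>. The turn exchanges position and frequency and
  with them the two dilation exponents, which is why \<open>f\<close> is compared with
  \<open>V\<close> through \<open>T'\<close>.\<close>

lemma bdd_above_iff_regular_on:
  assumes "k > 0" and W: "\<And>x \<xi>. (x, \<xi>) \<in> T ` U \<longleftrightarrow> T' (x, \<xi>) \<in> U"
    and eq: "\<And>\<mu> x \<xi>. \<mu> > 0 \<Longrightarrow> f \<mu> (T' (x, \<xi>)) = k * cmod (V \<theta> ((\<mu> powr s) *\<^sub>R x) ((\<mu> powr t) *\<^sub>R \<xi>))"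
    and T': "\<And>v. T' (T v) = v"
  shows "(\<forall>r>0. bdd_above {exp (r * \<mu>) * f \<mu> (x, \<xi>) | \<mu> x \<xi>. \<mu> > 0 \<and> (x, \<xi>) \<in> U}) \<longleftrightarrow> regular_on \<theta> t (T ` U)"
proof -
  have "bdd_above {exp (r * \<mu>) * f \<mu> (x, \<xi>) | \<mu> x \<xi>. \<mu> > 0 \<and> (x, \<xi>) \<in> U} \<longleftrightarrow>
    (\<exists>C. \<forall>\<mu> x \<xi>. \<mu> > 0 \<longrightarrow> (x, \<xi>) \<in> T ` U \<longrightarrow>
      exp (r * \<mu>) * cmod (V \<theta> ((\<mu> powr s) *\<^sub>R x) ((\<mu> powr t) *\<^sub>R \<xi>)) \<le> C)" (is "?L \<longleftrightarrow> ?R") for r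
  proof
    assume ?L
    then obtain C where "\<And>\<mu> v. \<mu> > 0 \<Longrightarrow> v \<in> U \<Longrightarrow> exp (r * \<mu>) * f \<mu> v \<le> C"
      by (auto simp: bdd_above_def) blast
    then have "exp (r * \<mu>) * (k * cmod (V \<theta> ((\<mu> powr s) *\<^sub>R x) ((\<mu> powr t) *\<^sub>R \<xi>))) \<le> C"
      if "\<mu> > 0" "(x, \<xi>) \<in> T ` U" for \<mu> x \<xi> using that by (simp add: W flip: eq)
    then have "exp (r * \<mu>) * cmod (V \<theta> ((\<mu> powr s) *\<^sub>R x) ((\<mu> powr t) *\<^sub>R \<xi>)) \<le> C / k"
      if "\<mu> > 0" "(x, \<xi>) \<in> T ` U" for \<mu> x \<xi> using that \<open>k > 0\<close> by (simp add: pos_le_divide_eq mult_ac)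
    then show ?R by blast
  next
    assume ?R
    then obtain C where C: "\<And>\<mu> x \<xi>. \<mu> > 0 \<Longrightarrow> (x, \<xi>) \<in> T ` U \<Longrightarrow>
      exp (r * \<mu>) * cmod (V \<theta> ((\<mu> powr s) *\<^sub>R x) ((\<mu> powr t) *\<^sub>R \<xi>)) \<le> C" by blast
    have "exp (r * \<mu>) * f \<mu> v \<le> k * C" if "\<mu> > 0" "v \<in> U" for \<mu> v
    proof -
      obtain x \<xi> where x: "T v = (x, \<xi>)" by (cases "T v")
      have "(x, \<xi>) \<in> T ` U" unfolding x[symmetric] using that by blast
      then have "k * (exp (r * \<mu>) * cmod (V \<theta> ((\<mu> powr s) *\<^sub>R x) ((\<mu> powr t) *\<^sub>R \<xi>))) \<le> k * C"
        using C \<open>\<mu> > 0\<close> \<open>k > 0\<close> by (intro mult_left_mono) auto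
      moreover have "f \<mu> v = k * cmod (V \<theta> ((\<mu> powr s) *\<^sub>R x) ((\<mu> powr t) *\<^sub>R \<xi>))"
        using eq[OF \<open>\<mu> > 0\<close>, of x \<xi>] T'[of v] x by simp
      ultimately show ?thesis by (simp add: mult_ac)
    qed
    then show ?L unfolding bdd_above_def by blast
  qed
  then show ?thesis unfolding regular_on_def by simp
qed

section \<open>The two wave front sets\<close>

lemma wave_front_set_F:
  fixes \<theta> :: "real ^ 'd \<Rightarrow> complex"
  assumes \<theta>: "\<theta> \<in> gs_space s t" and z: "\<theta> z \<noteq> 0" and "t > 0"
  shows "wave_front_set \<theta> s t (fun_distr F) = V_set t s u \<times> {0}"
proof -
  have dec: "exp_decaying (1 / s) \<theta>" by (rule gs_space_exp_decaying[OF \<theta>]) (use s \<open>t > 0\<close> in auto)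
  have "V_bounded \<theta> t"
    unfolding V_bounded_def
  proof (rule exI[of _ 1], intro conjI allI impI)
    fix R :: real assume "R > 0"
    from V_decay[OF \<theta> \<open>t > 0\<close> this] show "\<exists>C>0. \<forall>x \<xi>. cmod (V \<theta> x \<xi>) \<le> C * exp (1 * norm x powr (1 / s) - R * norm \<xi> powr (1 / t))"
      by (metis mult_1)
  qed simp
  have "(\<forall>r>0. bdd_above {exp (r * \<mu>) * cmod (stft \<theta> (fun_distr F) ((\<mu> powr s) *\<^sub>R x) ((\<mu> powr t) *\<^sub>R \<xi>)) |
      \<mu> x \<xi>. \<mu> > 0 \<and> (x, \<xi>) \<in> U}) \<longleftrightarrow> regular_on \<theta> t U" for U
    using bdd_above_iff_regular_on[of "(2 * pi) powr (- real CARD('d) / 2)" "\<lambda>v. v" U "\<lambda>v. v"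
        "\<lambda>\<mu> v. cmod (stft \<theta> (fun_distr F) ((\<mu> powr s) *\<^sub>R fst v) ((\<mu> powr t) *\<^sub>R snd v))" \<theta> t]
    by (simp add: stft_F norm_mult)
  then show ?thesis
    unfolding wave_front_set_def V_set_u[OF assms] irregular_points[OF dec z \<open>V_bounded \<theta> t\<close> \<open>t > 0\<close>, symmetric]
    by simp
qed

text \<open>Three windows occur: \<open>\<psi>\<close> defines the transform of \<open>u\<close>,
  its own transform \<open>\<kappa>\<close> is the window for \<open>F\<close>, and
  \<open>\<theta>\<close> is a test function on the Fourier side that identifies
  \<open>V_set\<close>.\<close>

lemma wave_front_set_u:
  fixes \<psi> \<theta> :: "real ^ 'd \<Rightarrow> complex"
  assumes \<psi>: "\<psi> \<in> gs_space t s" "\<psi> \<noteq> (\<lambda>x. 0)" and \<theta>: "\<theta> \<in> gs_space s t" "\<theta> z \<noteq> 0" and "t > 0"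
  shows "wave_front_set \<psi> t s u = {0} \<times> V_set t s u"
proof -
  let ?K = "(2 * pi) powr (- real CARD('d) / 2)"
  have K: "?K > 0" by simp
  define \<kappa> where "\<kappa> \<xi> = inv_fourier \<psi> (- \<xi>)" for \<xi>
  have "s > 0" using s by simp
  have dec: "exp_decaying (1 / s) \<kappa>" and inv: "inv_fourier \<kappa> = \<psi>"
    unfolding \<kappa>_def[abs_def]
    using exp_decaying_fourier[OF \<psi>(1) \<open>t > 0\<close> \<open>s > 0\<close>] inv_fourier_fourier[OF \<psi>(1) \<open>t > 0\<close> \<open>s > 0\<close>] by auto
  have "\<exists>y. \<kappa> y \<noteq> 0"
  proof (rule ccontr)
    assume "\<not> ?thesis"
    then have "inv_fourier \<kappa> = (\<lambda>x. 0)" by (simp add: inv_fourier_def fun_eq_iff)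
    then show False using inv \<psi> by simp
  qed
  then obtain y where y: "\<kappa> y \<noteq> 0" by blast
  \<comment> \<open>One normalising factor comes from the short-time transform, the other from the
    Fourier transform of \<open>u\<close>.\<close>
  have stft: "cmod (stft \<psi> u x \<xi>) = ?K\<^sup>2 * cmod (V \<kappa> \<xi> (- x))" for x \<xi>
    using cmod_u_modulate_translate[OF dec, of \<xi> x] by (simp add: stft_def inv norm_mult power2_eq_square)
  have Vb: "V_bounded \<kappa> t"
    unfolding V_bounded_def
  \<comment> \<open>s is the rate at which derivatives of the character at the origin make the
    transform of \<open>u\<close> grow in frequency, which is position for \<open>F\<close>.\<close>
  proof (rule exI[of _ s], intro conjI allI impI)
    fix R :: real assume "R > 0"
    from u_stft_decay[OF \<psi>(1) \<open>t > 0\<close> this] obtain C where "C > 0"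
      and C: "\<And>x \<xi>. cmod (u (modulate \<xi> (translate x \<psi>))) \<le> C * exp (s * norm \<xi> powr (1 / s) - R * norm x powr (1 / t))"
      by blast
    have "cmod (V \<kappa> x \<xi>) \<le> (C / ?K) * exp (s * norm x powr (1 / s) - R * norm \<xi> powr (1 / t))" for x \<xi>
    proof -
      have "cmod (V \<kappa> x \<xi>) * ?K \<le> C * exp (s * norm x powr (1 / s) - R * norm \<xi> powr (1 / t))"
        using C[of x "- \<xi>"] cmod_u_modulate_translate[OF dec, of x "- \<xi>"] by (simp add: inv mult.commute)
      then have "cmod (V \<kappa> x \<xi>) \<le> C * exp (s * norm x powr (1 / s) - R * norm \<xi> powr (1 / t)) / ?K"
        using K by (subst pos_le_divide_eq)
      then show ?thesis by simp
    qed
    then show "\<exists>C>0. \<forall>x \<xi>. cmod (V \<kappa> x \<xi>) \<le> C * exp (s * norm x powr (1 / s) - R * norm \<xi> powr (1 / t))"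
      using \<open>C > 0\<close> K by (intro exI[of _ "C / ?K"]) auto
  qed (rule \<open>s > 0\<close>)
  \<comment> \<open>The quarter turn (x, \<xi>) to (\<xi>, - x), which carries {0} \<times> V_s(u)
    to V_s(u) \<times> {0}.\<close>
  define T :: "(real ^ 'd) \<times> (real ^ 'd) \<Rightarrow> (real ^ 'd) \<times> (real ^ 'd)" where "T v = (snd v, - fst v)" for v
  define T' :: "(real ^ 'd) \<times> (real ^ 'd) \<Rightarrow> (real ^ 'd) \<times> (real ^ 'd)" where "T' v = (- snd v, fst v)" for v
  have TT: "T' (T v) = v" "T (T' v) = v" for v by (simp_all add: T_def T'_def)
  have img: "T ` U = T' -` U" "T' ` U = T -` U" for U
    using TT by (auto simp: image_iff) (metis, metis)
  have open_T: "open (T ` U)" "open (T' ` U)" if "open U" for U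
  proof -
    have "continuous_on UNIV T" "continuous_on UNIV T'"
      unfolding T_def[abs_def] T'_def[abs_def] by (auto intro!: continuous_intros)
    then show "open (T ` U)" "open (T' ` U)"
      unfolding img using that by (auto intro: open_vimage)
  qed
  have T0: "T v = 0 \<longleftrightarrow> v = 0" "T' v = 0 \<longleftrightarrow> v = 0" for v
    by (auto simp: T_def T'_def zero_prod_def prod_eq_iff)
  have reg: "(\<forall>r>0. bdd_above {exp (r * \<mu>) * cmod (stft \<psi> u ((\<mu> powr t) *\<^sub>R x) ((\<mu> powr s) *\<^sub>R \<xi>)) |
      \<mu> x \<xi>. \<mu> > 0 \<and> (x, \<xi>) \<in> U}) \<longleftrightarrow> regular_on \<kappa> t (T ` U)" for U
    using bdd_above_iff_regular_on[of "?K\<^sup>2" T U T'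
        "\<lambda>\<mu> v. cmod (stft \<psi> u ((\<mu> powr t) *\<^sub>R fst v) ((\<mu> powr s) *\<^sub>R snd v))" \<kappa> t] TT
    by (simp add: stft img(1)) (simp add: T'_def)
  have "(\<exists>U. open U \<and> U \<subseteq> - {0} \<and> v \<in> U \<and> regular_on \<kappa> t (T ` U)) \<longleftrightarrow>
      (\<exists>U. open U \<and> U \<subseteq> - {0} \<and> T v \<in> U \<and> regular_on \<kappa> t U)" for v
  proof
    assume "\<exists>U. open U \<and> U \<subseteq> - {0} \<and> v \<in> U \<and> regular_on \<kappa> t (T ` U)"
    then obtain U where U: "open U" "U \<subseteq> - {0}" "v \<in> U" "regular_on \<kappa> t (T ` U)" by blast
    have "T ` U \<subseteq> - {0}" using U(2) T0 by auto
    then show "\<exists>U. open U \<and> U \<subseteq> - {0} \<and> T v \<in> U \<and> regular_on \<kappa> t U" using U open_T(1) by blast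
  next
    assume "\<exists>U. open U \<and> U \<subseteq> - {0} \<and> T v \<in> U \<and> regular_on \<kappa> t U"
    then obtain U where U: "open U" "U \<subseteq> - {0}" "T v \<in> U" "regular_on \<kappa> t U" by blast
    have "T' ` U \<subseteq> - {0}" using U(2) T0 by auto
    moreover have "T ` (T' ` U) = U" by (simp add: image_image TT)
    moreover have "v \<in> T' ` U" using U(3) by (simp add: img)
    ultimately show "\<exists>U. open U \<and> U \<subseteq> - {0} \<and> v \<in> U \<and> regular_on \<kappa> t (T ` U)"
      using U open_T(2)[OF U(1)] by (intro exI[of _ "T' ` U"]) simp
  qed
  then have "wave_front_set \<psi> t s u = {v. T v \<in> {v. v \<noteq> 0 \<and> \<not> (\<exists>U. open U \<and> U \<subseteq> - {0} \<and> v \<in> U \<and> regular_on \<kappa> t U)}}"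
    unfolding wave_front_set_def reg by (simp add: T0)
  also have "\<dots> = {0} \<times> V_set t s u"
    unfolding irregular_points[OF dec y Vb \<open>t > 0\<close>] V_set_u[OF \<theta> \<open>t > 0\<close>]
    by (auto simp: T_def)
  finally show ?thesis .
qed

end

text \<open>Both windows are arbitrary and the right-hand sides do not mention them, so independence
  of the window is part of the conclusion. Membership in the dual spaces is included because
  ultradistributions are represented by total functions, whose type does not guarantee it.\<close>

theorem proposition7p5:
  fixes s t :: real
    and c :: "('d::finite \<Rightarrow> nat) \<Rightarrow> complex"
    and u :: "'d distr"
    and f :: "real ^ 'd \<Rightarrow> complex"
    and \<psi> \<theta> :: "real ^ 'd \<Rightarrow> complex"
  assumes "s > 1" and "t > 0"
    and "\<And>r. r > 0 \<Longrightarrow> (\<lambda>\<alpha>. cmod (c \<alpha>) * r ^ mi_abs \<alpha> * mi_fact \<alpha> powr s) summable_on UNIV"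
    and "u = (\<lambda>\<phi>. \<Sum>\<^sub>\<infinity>\<alpha>. c \<alpha> * distr_D \<alpha> delta0 \<phi>)"
    and "f = (\<lambda>x. \<Sum>\<^sub>\<infinity>\<alpha>. c \<alpha> * complex_of_real (mi_pow x \<alpha>))"
    and "\<psi> \<in> gs_space t s" and "\<psi> \<noteq> (\<lambda>x. 0)"
    and "\<theta> \<in> gs_space s t" and "\<theta> \<noteq> (\<lambda>x. 0)"
  shows "u \<in> gs_dual t s \<and> fun_distr f \<in> gs_dual s t \<and>
    wave_front_set \<psi> t s u = {0} \<times> V_set t s u \<and>
    wave_front_set \<theta> s t (fun_distr f) = V_set t s u \<times> {0}"
proof -
  interpret rapid_coeffs s c by standard (use assms in auto)
  have u: "u = local.u" unfolding assms(4) local.u_def[abs_def] ..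
  have f: "f = F" unfolding assms(5) F_def[abs_def] ..
  obtain z where z: "\<theta> z \<noteq> 0" using assms(9) by auto
  show ?thesis
    unfolding u f
    by (intro conjI u_in_dual fun_distr_F_in_dual wave_front_set_u[OF assms(6,7,8) z]
        wave_front_set_F[OF assms(8) z] assms(2))
qed

end
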